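(* Let $q$ be a prime power, $w\ge1$ and $A\geq 1$ integers, and let $V$ be an $A$-dimensional vector space over $GF(q^w)$. Let $\alpha\in GF(q^w)^*$ and let $L:GF(q^w)\to GF(q)$, $L(x)=\mathrm{Tr}_{GF(q^w)/GF(q)}(\alpha x)$. Regard $V$ also as an $Aw$-dimensional vector space over $GF(q)$. (I) Let $Q:V\to GF(q^w)$ be a non-degenerate quadratic form and $LQ=L\circ Q:V\to GF(q)$. If $Q$ has a germ $U$, write $Q|_U(x)=\gamma x^2$ with $\gamma\in GF(q^w)^*$ (after identifying $U$ with $GF(q^w)$). Then: (1) If $Q$ has type $O^+$, then $LQ$ has type $O^+$, giving an embedding $O^+(A,q^w)\le O^+(Aw,q)$. (2) If $Q$ has type $O^-$, then $LQ$ has type $O^-$, giving an embedding $O^-(A,q^w)\le O^-(Aw,q)$. (3) If $Q$ has type $O$ and $q$ is even, then $LQ$ is degenerate. (4) If $Q$ has type $O$, $w$ is odd and $q$ is odd, then $LQ$ has type $O$, giving an embedding $O(A,q^w)\le O(Aw,q)$. (5) If $Q$ has type $O$, $w$ is even, $q$ is odd, and either $(\alpha\gamma)^{-2}\in GF(q^{w/2})\setminus GF(q^{w/2})^{*2}$ or $(\alpha\gamma)^{q+1}\not\equiv-1 \pmod{GF(q^{w/2})^{*2}}$, then $LQ$ has type $O^+$, giving an embedding $O(A,q^w)\le O^+(Aw,q)$. (6) If $Q$ has type $O$, $w$ is even, $q$ is odd, $(\alpha\gamma)^{-2}\notin GF(q^{w/2})\setminus GF(q^{w/2})^{*2}$ and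 $(\alpha\gamma)^{q+1}\equiv-1 \pmod{GF(q^{w/2})^{*2}}$, then $LQ$ has type $O^-$, giving an embedding $O(A,q^w)\le O^-(Aw,q)$. (II) Let $\beta:V\times V\to GF(q^w)$ be a non-degenerate reflexive $\sigma$-sesquilinear form which is alternating, symmetric or hermitian, and $L\beta=L\circ\beta:V\times V\to GF(q)$. If $q$ is odd and $\beta$ is symmetric, then the type of $L\beta$ and the associated embedding are those given by (I) for the quadratic form $Q(v)=\frac12\beta(v,v)$. In all other cases: (1) If $\beta$ is hermitian, $w$ is odd and $\sigma(\alpha)=\alpha$, then $L\beta$ is hermitian, giving an embedding $U(A,q^w)\le U(Aw,q)$. (2) If $\beta$ is hermitian, $w$ is odd and $\sigma(\alpha)\ne\alpha$, then $L\beta$ is atypical. (3) If $\beta$ is hermitian, $w$ is even, $q$ is even and $\sigma(\alpha)=\alpha$, then $L\beta$ is alternating, giving an embedding $U(A,q^w)\le Sp(Aw,q)$. (4) If $\beta$ is hermitian, $w$ is even, $q$ is odd and $\sigma(\alpha)=-\alpha$, then $L\beta$ is alternating, giving an embedding $U(A,q^w)\le Sp(Aw,q)$. (5) If $\beta$ is hermitian, $w$ is even and $\sigma(\alpha)\ne\pm\alpha$, then $L\beta$ is atypical. (6) If $\beta$ is hermitian, $w$ is even, $q$ is odd, $A$ is even and $\sigma(\alpha)=\alpha$, then $L\beta$ is symmetric of type $O^+$, giving an embedding $U(A,q^w)\le O^+(Aw,q)$. (7) If $\beta$ is hermitian, $w$ is even, $q$ is odd, $A$ is odd and $\sigma(\alpha)=\alpha$,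 then $L\beta$ is symmetric of type $O^-$, giving an embedding $U(A,q^w)\le O^-(Aw,q)$. (8) If $\beta$ is alternating, then $L\beta$ is alternating, giving an embedding $Sp(A,q^w)\le Sp(Aw,q)$. (9) If $q$ is even and $\beta$ is pseudo-symplectic, then $L\beta$ is pseudo-symplectic.
   Context: $GF(q)$ is the finite field with $q$ elements; $GF(q)^{*2}$ is the subgroup of nonzero squares of $GF(q)^*$, and for a subgroup $H$ of the multiplicative group of a field, $a\equiv b\pmod{H}$ means $a/b\in H$. Quadratic forms: the polar form of $Q$ is $f_Q(u,v)=Q(u+v)-Q(u)-Q(v)$; $Q$ is non-degenerate if ($Q(u)=0$ and $f_Q(u,v)=0$ for all $v$) implies $u=0$, and degenerate otherwise. A non-degenerate quadratic form on a space of dimension $n$ over a finite field has type $O$ if $n$ is odd; if $n$ is even it has type $O^+$ when its maximal totally singular subspaces have dimension $n/2$, and type $O^-$ when they have dimension $n/2-1$. When $Q$ has type $O$, $V$ is an orthogonal direct sum $R\perp U$ with $R$ an orthogonal direct sum of hyperbolic lines (possibly $R=0$) and $U$ a one-dimensional anisotropic subspace; such a $U$ is called a germ. Sesquilinear forms: a $\sigma$-sesquilinear form is biadditive with $\beta(\lambda u,\mu v)=\lambda\,\sigma(\mu)\,\beta(u,v)$; it is reflexive if $\beta(u,v)=0$ implies $\beta(v,u)=0$, and non-degenerate if ($\beta(u,v)=0$ for all $v$) implies $u=0$. It is alternating if bilinear with $\beta(x,x)=0$ for all $x$; symmetric if bilinear with $\beta(u,v)=\beta(v,u)$; hermitian if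 $\sigma$ has order $2$ and $\beta(u,v)=\sigma(\beta(v,u))$. $L\beta$ is sesquilinear over $GF(q)$ with respect to the restriction of $\sigma$ to $GF(q)$, and "hermitian" for $L\beta$ refers to this restriction (which must have order 2). A form is atypical if it is none of alternating, symmetric, hermitian. Pseudo-symplectic means non-degenerate, symmetric and not alternating, in characteristic 2. In odd characteristic, the type ($O$, $O^+$, $O^-$) of a non-degenerate symmetric form $b$ is that of the quadratic form $v\mapsto\frac12 b(v,v)$. $O(n,q)$, $O^{\pm}(n,q)$, $U(n,q)$, $Sp(n,q)$ denote the full isometry groups of non-degenerate forms of type $O$, $O^\pm$, hermitian, alternating respectively on an $n$-dimensional space over $GF(q)$ (so in the notation $U(n,q)$ the field of definition is $GF(q)$, with $q$ a square). "Giving an embedding" means that the composed form $LQ$ or $L\beta$ is non-degenerate of the stated type over $GF(q)$ and that the isometry group of $(V,Q)$ (resp. $(V,\beta)$) is a subgroup of the isometry group of $(V,LQ)$ (resp. $(V,L\beta)$).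
   Formalization: (I)(3) assumes w>1; in (I)(5) the alternative (αγ)^{q+1}≢−1 also requires (αγ)^{q+1}∈GF(q^{w/2}), and (I)(5),(6) are also proved with exponent q^{w/2}+1 in place of q+1, which covers every αγ; likewise in (II) for q odd, β symmetric. *)

theory Defs
  imports Complex_Main "HOL-Library.Cardinality" "HOL-Algebra.Group"
begin

text \<open>
  \<open>GF(q)\<close> is a finite field type \<open>'f\<close> with \<open>q = CARD('f)\<close>, which makes \<open>q\<close> a prime power.
  \<open>GF(q^w)\<close> is a finite field type \<open>'k\<close> with \<open>q^w\<close> elements. The inclusion of the former in the
  latter is a field homomorphism \<open>\<iota>\<close>; a scalar multiplication \<open>s\<close> of \<open>'k\<close> on a vector space then
  restricts to the scalar multiplication \<open>restrict_scalars \<iota> s\<close> of \<open>'f\<close>.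
\<close>

definition field_hom :: "('a::field \<Rightarrow> 'b::field) \<Rightarrow> bool" where
  "field_hom h \<longleftrightarrow>
     h 1 = 1 \<and> (\<forall>x y. h (x + y) = h x + h y) \<and> (\<forall>x y. h (x * y) = h x * h y)"

definition field_auto :: "('a::field \<Rightarrow> 'a) \<Rightarrow> bool" where
  "field_auto \<sigma> \<longleftrightarrow> field_hom \<sigma> \<and> bij \<sigma>"

definition restrict_scalars :: "('f \<Rightarrow> 'k) \<Rightarrow> ('k \<Rightarrow> 'v \<Rightarrow> 'v) \<Rightarrow> 'f \<Rightarrow> 'v \<Rightarrow> 'v" where
  "restrict_scalars \<iota> s = (\<lambda>c. s (\<iota> c))"

definition restrict_auto :: "('f \<Rightarrow> 'k) \<Rightarrow> ('k \<Rightarrow> 'k) \<Rightarrow> 'f \<Rightarrow> 'f" where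
  "restrict_auto \<iota> \<sigma> = (\<lambda>c. the_inv \<iota> (\<sigma> (\<iota> c)))"

text \<open>The trace is the sum of the conjugates \<open>x, x^q, \<dots>, x^(q^(w-1))\<close>; this sum lies in the image
  of \<open>\<iota>\<close> and is read back in \<open>'f\<close>.\<close>

definition field_trace :: "('f::{finite,field} \<Rightarrow> 'k::{finite,field}) \<Rightarrow> nat \<Rightarrow> 'k \<Rightarrow> 'f" where
  "field_trace \<iota> w x = the_inv \<iota> (\<Sum>i<w. x ^ (CARD('f) ^ i))"

definition trace_map ::
  "('f::{finite,field} \<Rightarrow> 'k::{finite,field}) \<Rightarrow> nat \<Rightarrow> 'k \<Rightarrow> 'k \<Rightarrow> 'f" where
  "trace_map \<iota> w \<alpha> = (\<lambda>x. field_trace \<iota> w (\<alpha> * x))"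

text \<open>The subfield of order \<open>m\<close> of a finite field (when there is one) consists of the solutions
  of \<open>x^m = x\<close>.\<close>

definition subfield_of_order :: "nat \<Rightarrow> 'k::{finite,field} set" where
  "subfield_of_order m = {x. x ^ m = x}"

definition nonzero_squares :: "'k::field set \<Rightarrow> 'k set" where
  "nonzero_squares M = {x ^ 2 | x. x \<in> M \<and> x \<noteq> 0}"

text \<open>\<open>mult_cong H a b\<close> is \<open>a \<equiv> b (mod H)\<close>. For \<open>H = nonzero_squares M\<close> the negation also
  holds when \<open>a / b\<close> lies outside \<open>M\<close>; where non-congruence is meant inside \<open>M\<close>, membership of
  \<open>a\<close> in \<open>M\<close> has to be required separately.\<close>

definition mult_cong :: "'k::field set \<Rightarrow> 'k \<Rightarrow> 'k \<Rightarrow> bool" where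
  "mult_cong H a b \<longleftrightarrow> a / b \<in> H"

definition polar :: "('v::ab_group_add \<Rightarrow> 'k::field) \<Rightarrow> 'v \<Rightarrow> 'v \<Rightarrow> 'k" where
  "polar Q u v = Q (u + v) - Q u - Q v"

definition quadratic_form ::
  "('k::field \<Rightarrow> 'v::ab_group_add \<Rightarrow> 'v) \<Rightarrow> ('v \<Rightarrow> 'k) \<Rightarrow> bool" where
  "quadratic_form s Q \<longleftrightarrow>
     (\<forall>c v. Q (s c v) = c ^ 2 * Q v) \<and>
     (\<forall>u. Vector_Spaces.linear s (*) (polar Q u)) \<and>
     (\<forall>v. Vector_Spaces.linear s (*) (\<lambda>u. polar Q u v))"

definition qf_nondegenerate :: "('v::ab_group_add \<Rightarrow> 'k::field) \<Rightarrow> bool" where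
  "qf_nondegenerate Q \<longleftrightarrow> (\<forall>u. Q u = 0 \<and> (\<forall>v. polar Q u v = 0) \<longrightarrow> u = 0)"

definition totally_singular ::
  "('k::field \<Rightarrow> 'v::ab_group_add \<Rightarrow> 'v) \<Rightarrow> ('v \<Rightarrow> 'k) \<Rightarrow> 'v set \<Rightarrow> bool" where
  "totally_singular s Q W \<longleftrightarrow> module.subspace s W \<and> (\<forall>u\<in>W. Q u = 0)"

definition maximal_totally_singular ::
  "('k::field \<Rightarrow> 'v::ab_group_add \<Rightarrow> 'v) \<Rightarrow> ('v \<Rightarrow> 'k) \<Rightarrow> 'v set \<Rightarrow> bool" where
  "maximal_totally_singular s Q W \<longleftrightarrow>
     totally_singular s Q W \<and> (\<forall>W'. totally_singular s Q W' \<and> W \<subseteq> W' \<longrightarrow> W' = W)"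

definition type_O :: "('k::field \<Rightarrow> 'v::ab_group_add \<Rightarrow> 'v) \<Rightarrow> ('v \<Rightarrow> 'k) \<Rightarrow> bool" where
  "type_O s Q \<longleftrightarrow>
     quadratic_form s Q \<and> qf_nondegenerate Q \<and> odd (vector_space.dim s (UNIV :: 'v set))"

definition type_O_plus :: "('k::field \<Rightarrow> 'v::ab_group_add \<Rightarrow> 'v) \<Rightarrow> ('v \<Rightarrow> 'k) \<Rightarrow> bool" where
  "type_O_plus s Q \<longleftrightarrow>
     quadratic_form s Q \<and> qf_nondegenerate Q \<and> even (vector_space.dim s (UNIV :: 'v set)) \<and>
     (\<forall>W. maximal_totally_singular s Q W \<longrightarrow>
        vector_space.dim s W = vector_space.dim s (UNIV :: 'v set) div 2)"

text \<open>The condition \<open>dim W = n/2 - 1\<close> is written additively to avoid truncated subtraction.\<close>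

definition type_O_minus :: "('k::field \<Rightarrow> 'v::ab_group_add \<Rightarrow> 'v) \<Rightarrow> ('v \<Rightarrow> 'k) \<Rightarrow> bool" where
  "type_O_minus s Q \<longleftrightarrow>
     quadratic_form s Q \<and> qf_nondegenerate Q \<and> even (vector_space.dim s (UNIV :: 'v set)) \<and>
     (\<forall>W. maximal_totally_singular s Q W \<longrightarrow>
        vector_space.dim s W + 1 = vector_space.dim s (UNIV :: 'v set) div 2)"

definition hyperbolic_line ::
  "('k::field \<Rightarrow> 'v::ab_group_add \<Rightarrow> 'v) \<Rightarrow> ('v \<Rightarrow> 'k) \<Rightarrow> 'v set \<Rightarrow> bool" where
  "hyperbolic_line s Q H \<longleftrightarrow>
     (\<exists>e f. Q e = 0 \<and> Q f = 0 \<and> polar Q e f = 1 \<and> H = module.span s {e, f})"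

definition orthogonal_direct_sum ::
  "('k::field \<Rightarrow> 'v::ab_group_add \<Rightarrow> 'v) \<Rightarrow> ('v \<Rightarrow> 'k) \<Rightarrow> 'i set \<Rightarrow> ('i \<Rightarrow> 'v set) \<Rightarrow> 'v set \<Rightarrow> bool"
  where
  "orthogonal_direct_sum s Q I W X \<longleftrightarrow>
     finite I \<and> (\<forall>i\<in>I. module.subspace s (W i)) \<and>
     (\<forall>i\<in>I. \<forall>j\<in>I. i \<noteq> j \<longrightarrow> (\<forall>u\<in>W i. \<forall>v\<in>W j. polar Q u v = 0)) \<and>
     (\<forall>x. (\<forall>i\<in>I. x i \<in> W i) \<and> (\<Sum>i\<in>I. x i) = 0 \<longrightarrow> (\<forall>i\<in>I. x i = 0)) \<and>
     X = {\<Sum>i\<in>I. x i | x. \<forall>i\<in>I. x i \<in> W i}"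

text \<open>A germ is the last summand \<open>W m\<close> of an orthogonal decomposition of the whole space whose
  other \<open>m \<ge> 0\<close> summands are hyperbolic lines.\<close>

definition germ ::
  "('k::field \<Rightarrow> 'v::ab_group_add \<Rightarrow> 'v) \<Rightarrow> ('v \<Rightarrow> 'k) \<Rightarrow> 'v set \<Rightarrow> bool" where
  "germ s Q U \<longleftrightarrow>
     module.subspace s U \<and> vector_space.dim s U = 1 \<and> (\<forall>u\<in>U. Q u = 0 \<longrightarrow> u = 0) \<and>
     (\<exists>(m::nat) W. (\<forall>i<m. hyperbolic_line s Q (W i)) \<and> W m = U \<and>
        orthogonal_direct_sum s Q {..m} W UNIV)"

text \<open>\<open>germ_coeff s Q \<gamma>\<close>: on some germ, identified with the field through some nonzero vector \<open>u\<close>,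
  the form is \<open>x \<mapsto> \<gamma> x^2\<close>.\<close>

definition germ_coeff ::
  "('k::field \<Rightarrow> 'v::ab_group_add \<Rightarrow> 'v) \<Rightarrow> ('v \<Rightarrow> 'k) \<Rightarrow> 'k \<Rightarrow> bool" where
  "germ_coeff s Q \<gamma> \<longleftrightarrow>
     (\<exists>U u. germ s Q U \<and> u \<in> U \<and> u \<noteq> 0 \<and> (\<forall>x. Q (s x u) = \<gamma> * x ^ 2))"

definition sesquilinear_form ::
  "('k::field \<Rightarrow> 'v::ab_group_add \<Rightarrow> 'v) \<Rightarrow> ('k \<Rightarrow> 'k) \<Rightarrow> ('v \<Rightarrow> 'v \<Rightarrow> 'k) \<Rightarrow> bool" where
  "sesquilinear_form s \<sigma> b \<longleftrightarrow>
     field_auto \<sigma> \<and>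
     (\<forall>u v x. b (u + v) x = b u x + b v x) \<and>
     (\<forall>u v x. b u (v + x) = b u v + b u x) \<and>
     (\<forall>c d u v. b (s c u) (s d v) = c * \<sigma> d * b u v)"

definition reflexive_form :: "('v \<Rightarrow> 'v \<Rightarrow> 'k::field) \<Rightarrow> bool" where
  "reflexive_form b \<longleftrightarrow> (\<forall>u v. b u v = 0 \<longrightarrow> b v u = 0)"

definition form_nondegenerate :: "('v::ab_group_add \<Rightarrow> 'v \<Rightarrow> 'k::field) \<Rightarrow> bool" where
  "form_nondegenerate b \<longleftrightarrow> (\<forall>u. (\<forall>v. b u v = 0) \<longrightarrow> u = 0)"

definition alternating_form ::
  "('k::field \<Rightarrow> 'v::ab_group_add \<Rightarrow> 'v) \<Rightarrow> ('v \<Rightarrow> 'v \<Rightarrow> 'k) \<Rightarrow> bool" where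
  "alternating_form s b \<longleftrightarrow> sesquilinear_form s id b \<and> (\<forall>x. b x x = 0)"

definition symmetric_form ::
  "('k::field \<Rightarrow> 'v::ab_group_add \<Rightarrow> 'v) \<Rightarrow> ('v \<Rightarrow> 'v \<Rightarrow> 'k) \<Rightarrow> bool" where
  "symmetric_form s b \<longleftrightarrow> sesquilinear_form s id b \<and> (\<forall>u v. b u v = b v u)"

definition hermitian_form ::
  "('k::field \<Rightarrow> 'v::ab_group_add \<Rightarrow> 'v) \<Rightarrow> ('k \<Rightarrow> 'k) \<Rightarrow> ('v \<Rightarrow> 'v \<Rightarrow> 'k) \<Rightarrow> bool" where
  "hermitian_form s \<sigma> b \<longleftrightarrow>
     sesquilinear_form s \<sigma> b \<and> \<sigma> \<noteq> id \<and> \<sigma> \<circ> \<sigma> = id \<and> (\<forall>u v. b u v = \<sigma> (b v u))"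

definition atypical_form ::
  "('k::field \<Rightarrow> 'v::ab_group_add \<Rightarrow> 'v) \<Rightarrow> ('k \<Rightarrow> 'k) \<Rightarrow> ('v \<Rightarrow> 'v \<Rightarrow> 'k) \<Rightarrow> bool" where
  "atypical_form s \<sigma> b \<longleftrightarrow>
     sesquilinear_form s \<sigma> b \<and>
     \<not> alternating_form s b \<and> \<not> symmetric_form s b \<and> \<not> hermitian_form s \<sigma> b"

definition pseudo_symplectic_form ::
  "('k::field \<Rightarrow> 'v::ab_group_add \<Rightarrow> 'v) \<Rightarrow> ('v \<Rightarrow> 'v \<Rightarrow> 'k) \<Rightarrow> bool" where
  "pseudo_symplectic_form s b \<longleftrightarrow>
     (2::'k) = 0 \<and> form_nondegenerate b \<and> symmetric_form s b \<and> \<not> alternating_form s b"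

text \<open>The quadratic form \<open>v \<mapsto> b(v,v)/2\<close>, of use only in odd characteristic.\<close>

definition half_form :: "('v \<Rightarrow> 'v \<Rightarrow> 'k::field) \<Rightarrow> 'v \<Rightarrow> 'k" where
  "half_form b = (\<lambda>v. b v v / 2)"

definition qf_isometry_group ::
  "('k::field \<Rightarrow> 'v::ab_group_add \<Rightarrow> 'v) \<Rightarrow> ('v \<Rightarrow> 'k) \<Rightarrow> ('v \<Rightarrow> 'v) monoid" where
  "qf_isometry_group s Q =
     \<lparr>carrier = {g. Vector_Spaces.linear s s g \<and> bij g \<and> (\<forall>v. Q (g v) = Q v)},
      mult = (\<circ>), one = id\<rparr>"

definition form_isometry_group ::
  "('k::field \<Rightarrow> 'v::ab_group_add \<Rightarrow> 'v) \<Rightarrow> ('v \<Rightarrow> 'v \<Rightarrow> 'k) \<Rightarrow> ('v \<Rightarrow> 'v) monoid" where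
  "form_isometry_group s b =
     \<lparr>carrier = {g. Vector_Spaces.linear s s g \<and> bij g \<and> (\<forall>u v. b (g u) (g v) = b u v)},
      mult = (\<circ>), one = id\<rparr>"

text \<open>The isometry groups above all have composition as multiplication, so the group structure on the
  subgroup is the induced one.\<close>

definition is_subgroup_of :: "('v \<Rightarrow> 'v) monoid \<Rightarrow> ('v \<Rightarrow> 'v) monoid \<Rightarrow> bool" where
  "is_subgroup_of G H \<longleftrightarrow> group G \<and> group H \<and> subgroup (carrier G) H"

end

theory Submission
  imports Defs "HOL-Computational_Algebra.Polynomial"
begin

text \<open>
  The type of a form is read off from its number of singular vectors. If \<open>W\<close> is a maximal totally
  singular subspace of a form with nondegenerate polar form on a space of order \<open>q\<^sup>n\<close>, then on every
  coset of \<open>W\<close> outside \<open>W\<^sup>\<bottom>\<close> the form is a nonconstant affine function, while inside \<open>W\<^sup>\<bottom>\<close> its zeros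
  are exactly \<open>W\<close>; so the number of zeros is a strictly increasing function of \<open>dim W\<close>, and it decides
  between the types \<open>O\<^sup>+\<close> and \<open>O\<^sup>-\<close>.

  The zeros of \<open>LQ\<close> are the \<open>v\<close> with \<open>Q v \<in> ker L\<close>. For the types \<open>O\<^sup>+\<close> and \<open>O\<^sup>-\<close> every nonzero value is
  taken equally often, by a second moment computation, and the count for \<open>LQ\<close> follows. For type \<open>O\<close>
  with \<open>w = 2h\<close> and for hermitian forms the same coset argument reduces the count to a form in one
  variable over \<open>GF(q^w)\<close>. That form is \<open>c \<mapsto> Tr (\<alpha>\<gamma> c\<^sup>2)\<close> in the orthogonal case: if it has a totally
  singular subspace of the shape \<open>x\<^sub>0 GF(q^h)\<close>, it is hyperbolic; otherwise multiplying \<open>\<gamma>\<close> by a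
  nonsquare leads to this case, and the two zero counts add up to \<open>2 q^(w-1)\<close>. In the hermitian case it
  is \<open>c \<mapsto> Tr (\<alpha>\<kappa> c \<sigma>(c))\<close>, whose zeros are counted through the norm map, and it occurs exactly when \<open>A\<close>
  is odd.
\<close>

subsection \<open>Counting in finite fields\<close>

text \<open>Let n be the order of the field and |V| = (nT)^2. Types O+ and O- are then the zero
  counts n T^2 + \<epsilon> (n-1) T with \<epsilon> = 1 and \<epsilon> = -1, so every count in even
  dimension amounts to following the sign \<epsilon>. The counts need a nondegenerate polar form,
  which a nondegenerate Q has in odd characteristic or in even dimension. In characteristic 2 and
  odd dimension the polar form has a radical, and this is what makes LQ degenerate for w > 1. With w
  = 2h, m = q^h and N = (q^w - 1)/2 the sign of the one-variable form depends on \<delta> =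
  \<alpha>\<gamma> only through \<delta>^N: it is +1 exactly if \<delta>^N = (-1)^((m+1)/2), the
  condition under which a suitable x0 can be found. The conditions on squares of GF(m) in the
  theorem have to be translated into this power of \<delta>, and the translation depends on the
  exponent and on the parity of h.\<close>

lemma card_pos_field: "CARD('a::{finite,field}) > 1"
proof -
  have "card {0, 1::'a} \<le> CARD('a)" by (rule card_mono) auto
  then show ?thesis by simp
qed

text \<open>Fibers are translates of each other, so all of them have the same size. The domain is a
  set closed under sums and differences and the map is additive, which covers subspaces over either
  field, fixed fields and semilinear maps.\<close>

lemma card_fiber_additive:
  fixes \<phi> :: "'v::ab_group_add \<Rightarrow> 'a::{finite,ab_group_add}"
  assumes fin: "finite W"
    and diff: "\<And>u v. u \<in> W \<Longrightarrow> v \<in> W \<Longrightarrow> u - v \<in> W \<and> u + v \<in> W"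
    and add: "\<And>u v. u \<in> W \<Longrightarrow> v \<in> W \<Longrightarrow> \<phi> (u + v) = \<phi> u + \<phi> v"
    and surj: "\<And>a. \<exists>w\<in>W. \<phi> w = a"
  shows "CARD('a) * card {w \<in> W. \<phi> w = a} = card W"
proof -
  have same: "card {w \<in> W. \<phi> w = b} = card {w \<in> W. \<phi> w = a}" for b
  proof -
    obtain w0 where w0: "w0 \<in> W" "\<phi> w0 = a - b" using surj by blast
    have sub: "\<phi> (u - w0) = \<phi> u - (a - b)" if "u \<in> W" for u
      using add[of "u - w0" w0] diff[OF that w0(1)] w0 by (simp add: algebra_simps)
    have "bij_betw (\<lambda>w. w + w0) {w \<in> W. \<phi> w = b} {w \<in> W. \<phi> w = a}"
      by (rule bij_betw_byWitness[where f'="\<lambda>w. w - w0"])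
        (simp_all add: image_subset_iff w0 diff add sub)
    then show ?thesis by (rule bij_betw_same_card)
  qed
  have "W = (\<Union>b\<in>UNIV. {w \<in> W. \<phi> w = b})" by auto
  then have "card W = card (\<Union>b\<in>UNIV. {w \<in> W. \<phi> w = b})" by simp
  also have "\<dots> = (\<Sum>b\<in>UNIV. card {w \<in> W. \<phi> w = b})"
    using fin by (intro card_UN_disjoint) auto
  also have "\<dots> = (\<Sum>b\<in>(UNIV::'a set). card {w \<in> W. \<phi> w = a})"
    by (intro sum.cong refl same)
  also have "\<dots> = CARD('a) * card {w \<in> W. \<phi> w = a}" by simp
  finally show ?thesis by simp
qed

lemma card_roots_monom_le:
  fixes c :: "'a::field"
  assumes "k > 0"
  shows "card {x. x ^ k = c} \<le> k" and "finite {x. x ^ k = c}"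
proof -
  let ?p = "monom 1 k + [:- c:]"
  have deg: "degree ?p = k" using assms by (simp add: degree_add_eq_left degree_monom_eq)
  then have nz: "?p \<noteq> 0" using assms by auto
  have eq: "{x. poly ?p x = 0} = {x. x ^ k = c}" by (auto simp: poly_monom)
  show "card {x. x ^ k = c} \<le> k"
    using card_poly_roots_bound[OF nz] deg eq by simp
  show "finite {x. x ^ k = c}" using poly_roots_finite[OF nz] eq by simp
qed

text \<open>Multiplication by \<open>x\<close> permutes the nonzero elements of \<open>S\<close> and
  so preserves their product. Formulated for a subset because it is also applied to the fixed field
  of an involution.\<close>

lemma power_card_minus_one_eq_1:
  fixes S :: "'a::field set"
  assumes "finite S" "0 \<in> S" and mult: "\<And>x y. x \<in> S \<Longrightarrow> y \<in> S \<Longrightarrow> x * y \<in> S"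
    and x: "x \<in> S" "x \<noteq> 0"
  shows "x ^ (card S - 1) = 1"
proof -
  let ?S = "S - {0}"
  have inj: "inj_on ((*) x) ?S" using x(2) by (auto intro: inj_onI)
  moreover have "(*) x ` ?S \<subseteq> ?S" using mult x by auto
  ultimately have "(*) x ` ?S = ?S" using assms(1) by (intro endo_inj_surj) auto
  then have "(\<Prod>y\<in>?S. x * y) = (\<Prod>y\<in>?S. y)"
    using prod.reindex[OF inj, of "\<lambda>y. y"] by simp
  then have "x ^ card ?S * (\<Prod>y\<in>?S. y) = (\<Prod>y\<in>?S. y)" by (simp add: prod.distrib)
  moreover have "(\<Prod>y\<in>?S. y) \<noteq> 0" using assms(1) by simp
  ultimately show ?thesis using assms(1,2) by (simp add: card_Diff_singleton)
qed

lemma finite_field_power_card_minus_one: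
  fixes x :: "'a::{finite,field}"
  assumes "x \<noteq> 0" shows "x ^ (CARD('a) - 1) = 1"
  using assms by (intro power_card_minus_one_eq_1) auto

lemma finite_field_power_card:
  fixes x :: "'a::{finite,field}" shows "x ^ CARD('a) = x"
proof (cases "x = 0")
  case False
  have "x ^ CARD('a) = x ^ (CARD('a) - 1) * x"
    using card_pos_field[where 'a='a] by (metis less_imp_le power_minus_mult not_one_less_zero gr0I)
  then show ?thesis using finite_field_power_card_minus_one[OF False] by simp
qed (use card_pos_field[where 'a='a] in auto)

text \<open>Every fiber of \<open>z \<mapsto> z\<^sup>b\<close> has at most \<open>b\<close> elements and the values lie among the at most \<open>a\<close>
  roots of \<open>x\<^sup>a = 1\<close>; since \<open>a b\<close> elements are mapped, all these bounds are equalities.\<close>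

lemma
  assumes ab: "CARD('a::{finite,field}) - 1 = a * b"
  shows card_roots_of_unity: "card {x::'a. x ^ a = 1} = a"
    and card_power_fiber: "\<And>x::'a. x ^ a = 1 \<Longrightarrow> card {z. z ^ b = x} = b"
proof -
  have pos: "a > 0" "b > 0" using ab card_pos_field[where 'a='a] by (auto intro: gr0I)
  let ?A = "{x::'a. x ^ a = 1}"
  have nz: "z \<noteq> 0" if "z ^ b \<in> ?A" for z :: 'a using that pos by (auto simp: power_0_left)
  have un: "UNIV - {0} = (\<Union>x\<in>?A. {z::'a. z ^ b = x})"
  proof -
    have "(z ^ b) ^ a = 1" if "z \<noteq> 0" for z :: 'a
      using finite_field_power_card_minus_one[OF that] ab by (simp add: power_mult[symmetric] mult.commute)
    then show ?thesis using nz by auto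
  qed
  have "a * b = card (UNIV - {0::'a})" using ab by (simp add: card_Diff_singleton)
  also have "\<dots> = (\<Sum>x\<in>?A. card {z. z ^ b = x})"
    unfolding un by (intro card_UN_disjoint) auto
  finally have sum: "(\<Sum>x\<in>?A. card {z. z ^ b = x}) = a * b" ..
  have le: "card {z::'a. z ^ b = x} \<le> b" for x using card_roots_monom_le(1)[OF pos(2)] .
  have leA: "card ?A \<le> a" using card_roots_monom_le(1)[OF pos(1)] .
  have "(\<Sum>x\<in>?A. card {z. z ^ b = x}) \<le> card ?A * b"
    using sum_bounded_above[of ?A "\<lambda>x. card {z. z ^ b = x}" b] le by simp
  then have "a * b \<le> card ?A * b" using sum by simp
  then show A: "card ?A = a" using leA pos by auto
  fix x :: 'a assume x: "x ^ a = 1"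
  show "card {z. z ^ b = x} = b"
  proof (rule ccontr)
    assume "card {z. z ^ b = x} \<noteq> b"
    then have "card {z. z ^ b = x} < b" using le[of x] by simp
    then have "(\<Sum>x\<in>?A. card {z. z ^ b = x}) < (\<Sum>x\<in>?A. b)"
      using x le by (intro sum_strict_mono_ex1) auto
    then show False using sum A by simp
  qed
qed

text \<open>A nonempty fiber in the preceding count is a solution; this takes the place of a
  generator of the multiplicative group.\<close>

lemma ex_power_eq:
  assumes "CARD('a::{finite,field}) - 1 = a * b" "(x::'a) ^ a = 1"
  shows "\<exists>z. z \<noteq> 0 \<and> z ^ b = x"
proof -
  have "b > 0" using assms(1) card_pos_field[where 'a='a] by (auto intro: gr0I)
  moreover have "card {z. z ^ b = x} = b" using card_power_fiber[OF assms] .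
  ultimately obtain z where "z ^ b = x" by (metis (mono_tags) Collect_empty_eq card.empty less_irrefl)
  moreover have "x \<noteq> 0" using assms card_pos_field[where 'a='a] by (cases "a = 0") (auto simp: power_0_left)
  ultimately show ?thesis using \<open>b > 0\<close> by (intro exI[of _ z]) auto
qed

text \<open>\<open>(X + 1)\<^sup>m - X\<^sup>m - 1\<close> has degree below \<open>m\<close> but vanishes on a subfield \<open>S\<close> of order \<open>m\<close>, so it is
  the zero polynomial.\<close>

lemma power_subfield_order_add:
  fixes S :: "'a::field set"
  assumes fin: "finite S" and m: "card S = m" and add1: "\<And>x. x \<in> S \<Longrightarrow> x + 1 \<in> S"
    and pw: "\<And>x. x \<in> S \<Longrightarrow> x ^ m = x" and m0: "m > 0"
  shows "(x + y) ^ m = x ^ m + (y::'a) ^ m"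
proof -
  have one: "(1 + z) ^ m = 1 + z ^ m" for z :: 'a
  proof -
    let ?p = "[:1, 1:] ^ m - monom 1 m - [:1::'a:]"
    have c: "coeff ([:1, 1::'a:] ^ m) m = 1" and d: "degree ([:1, 1::'a:] ^ m) = m"
      using lead_coeff_power[of "[:1, 1::'a:]" m] by (auto simp: degree_power_eq)
    have "?p = 0"
    proof (rule ccontr)
      assume nz: "?p \<noteq> 0"
      have "degree ?p \<le> m"
        by (intro degree_diff_le) (auto simp: d degree_monom_le)
      moreover have "coeff ?p m = 0" using c m0 by (cases m) auto
      ultimately have deg: "degree ?p < m"
        using nz by (metis le_neq_implies_less leading_coeff_0_iff)
      have "S \<subseteq> {x. poly ?p x = 0}"
      proof
        fix x assume x: "x \<in> S"
        have "(1 + x) ^ m = 1 + x" using pw[OF add1[OF x]] by (simp add: add.commute)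
        then show "x \<in> {x. poly ?p x = 0}" using pw[OF x] by (simp add: poly_monom)
      qed
      then have "m \<le> card {x. poly ?p x = 0}"
        using m card_mono[OF poly_roots_finite[OF nz]] by blast
      then show False using card_poly_roots_bound[OF nz] deg by simp
    qed
    then have "poly ?p z = 0" by simp
    then show ?thesis by (simp add: poly_monom algebra_simps)
  qed
  show ?thesis
  proof (cases "x = 0")
    case False
    have "x * (1 + y / x) = x + y" using False by (simp add: field_simps)
    then have "(x + y) ^ m = (x * (1 + y / x)) ^ m" by simp
    also have "\<dots> = x ^ m * (1 + (y / x) ^ m)" by (simp only: power_mult_distrib one)
    also have "\<dots> = x ^ m + y ^ m" using False by (simp add: power_divide field_simps)
    finally show ?thesis .
  qed (use m0 in auto)
qed

text \<open>Adding 1 permutes the field, so the sum of all elements absorbs \<open>CARD('a)\<close>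
  copies of 1.\<close>

lemma of_nat_card_eq_0: "of_nat CARD('a::{finite,field}) = (0::'a)"
proof -
  have "bij_betw (\<lambda>x. x + 1) (UNIV::'a set) UNIV"
    by (rule bij_betw_byWitness[where f'="\<lambda>x. x - 1"]) auto
  then have "(\<Sum>x\<in>(UNIV::'a set). x + 1) = (\<Sum>x\<in>UNIV. x)"
    using sum.reindex_bij_betw[of "\<lambda>x. x + 1" _ _ "\<lambda>x. x"] by blast
  then show ?thesis by (simp add: sum.distrib)
qed

text \<open>For even order, \<open>-1 = (-1) ^ CARD('a) = 1\<close>. An odd order
  \<open>2 * k + 1\<close> is 0 in the field, so 2 = 0 would give 1 = 0. The parity of
  \<open>q\<close> can thus stand for the characteristic.\<close>

lemma two_eq_0_iff_even_card: "(2::'a::{finite,field}) = 0 \<longleftrightarrow> even CARD('a)"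
proof
  assume "even CARD('a)"
  then have "(-1::'a) ^ CARD('a) = 1" by simp
  then have "(-1::'a) = 1" by (simp only: finite_field_power_card)
  then have "(1::'a) + 1 = 0" by (metis add.right_inverse)
  then show "(2::'a) = 0" by simp
next
  assume two: "(2::'a) = 0"
  show "even CARD('a)"
  proof (rule ccontr)
    assume "odd CARD('a)"
    then obtain k where k: "CARD('a) = 2 * k + 1" by (elim oddE)
    have "of_nat CARD('a) = (2::'a) * of_nat k + 1" unfolding k by simp
    then show False using two of_nat_card_eq_0[where 'a='a] by simp
  qed
qed

lemma field_hom_simps:
  assumes "field_hom h"
  shows "h 0 = 0" "h 1 = 1" "h (x + y) = h x + h y" "h (x * y) = h x * h y" "h (- x) = - h x"
    "h (x - y) = h x - h y" "h (x ^ k) = h x ^ k" "h (sum f I) = (\<Sum>i\<in>I. h (f i))"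
    "h x = 0 \<longleftrightarrow> x = 0" "inj h"
proof -
  have a: "h (x + y) = h x + h y" and m: "h (x * y) = h x * h y" and 1: "h 1 = 1" for x y
    using assms by (auto simp: field_hom_def)
  have "h 0 + h 0 = h 0 + 0" using a[of 0 0] by simp
  then show 0: "h 0 = 0" by (simp only: add_left_cancel)
  show "h 1 = 1" "h (x + y) = h x + h y" "h (x * y) = h x * h y" by (fact 1 a m)+
  show neg: "h (- x) = - h x" for x
    using a[of x "- x"] 0 by (simp add: add_eq_0_iff)
  show dif: "h (x - y) = h x - h y" for x y using a[of x "- y"] neg by simp
  show "h (x ^ k) = h x ^ k" by (induction k) (auto simp: 1 m)
  show "h (sum f I) = (\<Sum>i\<in>I. h (f i))"
    by (induction I rule: infinite_finite_induct) (auto simp: 0 a)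
  show z: "h x = 0 \<longleftrightarrow> x = 0" for x
  proof
    assume "h x = 0"
    show "x = 0"
    proof (rule ccontr)
      assume "x \<noteq> 0"
      then have "h x * h (inverse x) = 1" by (simp add: m[symmetric] 1)
      then show False using \<open>h x = 0\<close> by simp
    qed
  qed (simp add: 0)
  show "inj h"
  proof (rule injI)
    fix x y assume "h x = h y"
    then have "h (x - y) = 0" using dif by simp
    then show "x = y" using z by simp
  qed
qed

subsection \<open>The trace of a finite field extension\<close>

locale traced_extension =
  fixes \<iota> :: "'f::{finite,field} \<Rightarrow> 'k::{finite,field}" and q w :: nat and \<alpha> :: 'k
  assumes card_f: "CARD('f) = q" and hom: "field_hom \<iota>" and card_k: "CARD('k) = q ^ w" and w_pos: "w \<ge> 1"
    and \<alpha>_nonzero: "\<alpha> \<noteq> 0"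
begin

abbreviation "L \<equiv> trace_map \<iota> w \<alpha>"

lemma q_gt_1: "q > 1" using card_pos_field[where 'a='f] by (simp add: card_f)

lemmas \<iota>_simps = field_hom_simps[OF hom]

lemma \<iota>_power_q: "\<iota> c ^ q = \<iota> c"
  by (simp only: \<iota>_simps(7)[symmetric] finite_field_power_card card_f[symmetric])

lemma \<iota>_power_q_power: "\<iota> c ^ (q ^ i) = \<iota> c"
  by (induction i) (auto simp: power_mult \<iota>_power_q)

text \<open>Additivity of Frobenius, taken from the subfield \<open>range \<iota>\<close> of order
  \<open>q\<close>, so that no prime factorization of \<open>q\<close> enters.\<close>

lemma power_q_add: "(x + y) ^ q = x ^ q + (y::'k) ^ q"
proof (rule power_subfield_order_add[of "range \<iota>"])
  show "card (range \<iota>) = q" using card_image[OF \<iota>_simps(10)] card_f by simp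
  show "x + 1 \<in> range \<iota>" if "x \<in> range \<iota>" for x
    using that by (auto simp: \<iota>_simps(2,3)[symmetric])
qed (use q_gt_1 \<iota>_power_q in auto)

lemma power_q_power_add: "(x + y) ^ (q ^ i) = x ^ (q ^ i) + (y::'k) ^ (q ^ i)"
  by (induction i) (auto simp: power_mult power_q_add power_Suc2 simp del: power_Suc)

lemma power_q_power_sum: "(sum f I) ^ (q ^ i) = (\<Sum>j\<in>I. (f j :: 'k) ^ (q ^ i))"
  using q_gt_1 by (induction I rule: infinite_finite_induct) (auto simp: power_q_power_add)

text \<open>The equation has at most \<open>q\<close> solutions, and the \<open>q\<close> elements
  of \<open>range \<iota>\<close> already are solutions.\<close>

lemma range_\<iota>: "x \<in> range \<iota> \<longleftrightarrow> x ^ q = x"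
proof -
  let ?S = "{x::'k. x ^ q = x}"
  have "?S \<subseteq> insert 0 {x. x ^ (q - 1) = 1}"
  proof
    fix x :: 'k assume "x \<in> ?S"
    then have "x ^ (q - 1) * x = x" using q_gt_1 power_minus_mult[of q x] by simp
    then show "x \<in> insert 0 {x. x ^ (q - 1) = 1}" by auto
  qed
  then have "card ?S \<le> card (insert 0 {x::'k. x ^ (q - 1) = 1})" by (intro card_mono) auto
  also have "\<dots> \<le> Suc (card {x::'k. x ^ (q - 1) = 1})" by (rule card_insert_le_m1) auto
  also have "\<dots> \<le> q" using card_roots_monom_le(1)[of "q - 1" "1::'k"] q_gt_1 by simp
  also have "\<dots> = card (range \<iota>)" using card_image[OF \<iota>_simps(10)] card_f by simp
  finally have "range \<iota> = ?S"
    by (intro card_seteq) (auto simp: \<iota>_power_q)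
  then show ?thesis by auto
qed

lemma power_qw: "x ^ (q ^ w) = (x::'k)"
  using finite_field_power_card[of x] card_k by simp

text \<open>Raising to the power \<open>q\<close> permutes the conjugates cyclically because
  \<open>x ^ (q ^ w) = x\<close>. Hence their sum lies in \<open>range \<iota>\<close>, where
  \<open>the_inv \<iota>\<close> is a genuine inverse.\<close>

lemma \<iota>_trace: "\<iota> (field_trace \<iota> w x) = (\<Sum>i<w. x ^ (q ^ i))"
proof -
  have "(\<Sum>i<w. x ^ (q ^ i)) ^ q = (\<Sum>i<w. (x ^ (q ^ i)) ^ q)"
    using power_q_power_sum[of _ _ 1] by simp
  also have "\<dots> = (\<Sum>i<w. x ^ (q ^ Suc i))"
    by (simp add: power_mult power_Suc2 del: power_Suc)
  also have "\<dots> = (\<Sum>i<w. x ^ (q ^ i))"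
    using sum.lessThan_Suc_shift[of "\<lambda>i. x ^ (q ^ i)" w] sum.lessThan_Suc[of "\<lambda>i. x ^ (q ^ i)" w] power_qw[of x]
    by (simp add: add.commute)
  finally have "(\<Sum>i<w. x ^ (q ^ i)) \<in> range \<iota>" by (simp add: range_\<iota>)
  then show ?thesis unfolding field_trace_def card_f by (rule f_the_inv_into_f[OF \<iota>_simps(10)])
qed

lemma \<iota>_eq_iff: "\<iota> x = \<iota> y \<longleftrightarrow> x = y"
  using \<iota>_simps(10) by (auto dest: injD)

lemma \<iota>_L: "\<iota> (L x) = (\<Sum>i<w. (\<alpha> * x) ^ (q ^ i))"
  by (simp add: trace_map_def \<iota>_trace)

lemma L_add: "L (x + y) = L x + L y"
  by (simp add: \<iota>_eq_iff[symmetric] \<iota>_L \<iota>_simps(3) distrib_left power_q_power_add sum.distrib)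

lemma L_scale: "L (\<iota> c * x) = c * L x"
proof -
  have "(\<alpha> * (\<iota> c * x)) ^ (q ^ i) = \<iota> c * (\<alpha> * x) ^ (q ^ i)" for i
    by (simp add: power_mult_distrib \<iota>_power_q_power)
  then show ?thesis
    by (simp add: \<iota>_eq_iff[symmetric] \<iota>_L \<iota>_simps(4) sum_distrib_left)
qed

lemma L_0 [simp]: "L 0 = 0" using L_scale[of 0 0] by (simp add: \<iota>_simps(1))

lemma L_minus: "L (- x) = - L x"
  using L_scale[of "-1" x] by (simp add: \<iota>_simps(2,5))

lemma L_diff: "L (x - y) = L x - L y"
  using L_add[of x "- y"] by (simp add: L_minus)

text \<open>An identically vanishing trace would be a polynomial with \<open>q ^ w\<close> roots and
  degree at most \<open>q ^ (w - 1)\<close>; its coefficient 1 at X shows that it is not the zero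
  polynomial.\<close>

lemma L_nonzero: "\<exists>x. L x \<noteq> 0"
proof (rule ccontr)
  assume "\<not> ?thesis"
  then have all: "(\<Sum>i<w. x ^ (q ^ i)) = 0" for x :: 'k
    using \<iota>_L[of "x / \<alpha>"] \<alpha>_nonzero by (auto simp: \<iota>_simps(1))
  let ?p = "\<Sum>i<w. monom (1::'k) (q ^ i)"
  have "coeff ?p 1 = (\<Sum>i<w. if i = 0 then 1 else 0)"
    unfolding coeff_sum using q_gt_1 by (intro sum.cong) (auto simp: coeff_monom)
  also have "\<dots> = 1" using w_pos by simp
  finally have nz: "?p \<noteq> 0" by (metis coeff_0 zero_neq_one)
  have "degree (monom (1::'k) (q ^ i)) \<le> q ^ (w - 1)" if "i < w" for i
    using that q_gt_1 by (simp add: degree_monom_eq power_increasing)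
  then have "degree ?p \<le> q ^ (w - 1)" by (intro degree_sum_le) auto
  moreover have "{x. poly ?p x = 0} = UNIV" using all by (simp add: poly_sum poly_monom)
  then have "q ^ w \<le> degree ?p" using card_poly_roots_bound[OF nz] card_k by simp
  ultimately have "q ^ w \<le> q ^ (w - 1)" by simp
  then show False using q_gt_1 w_pos by simp
qed

lemma L_surj_mult:
  assumes "a \<noteq> 0" shows "\<exists>x. L (x * a) = b"
proof -
  obtain y where y: "L y \<noteq> 0" using L_nonzero by blast
  have "L (\<iota> (b / L y) * y / a * a) = b" using assms y by (simp add: L_scale)
  then show ?thesis by blast
qed

text \<open>Nondegeneracy of the trace form.\<close>

lemma L_eq_0_iff: "(\<forall>x. L (x * a) = 0) \<longleftrightarrow> a = 0"
  using L_surj_mult[of a 1] by (metis L_0 mult_zero_right zero_neq_one)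

lemma card_L_fiber: "q * card {x. L x = a} = q ^ w"
proof -
  have "\<exists>x\<in>UNIV. L x = a" for a using L_surj_mult[of 1 a] by auto
  then have "q * card {x \<in> UNIV. L x = a} = CARD('k)"
    unfolding card_f[symmetric] by (intro card_fiber_additive) (auto simp: L_add)
  then show ?thesis by (simp add: card_k)
qed

end

subsection \<open>Forms on finite vector spaces\<close>

lemma sum_card_swap:
  assumes "finite A" "finite B"
  shows "(\<Sum>a\<in>A. card {b \<in> B. R a b}) = (\<Sum>b\<in>B. card {a \<in> A. R a b})"
proof -
  have "(\<Sum>a\<in>A. card {b \<in> B. R a b}) = (\<Sum>a\<in>A. \<Sum>b\<in>B. if R a b then 1 else 0)"
    using assms by (simp add: card_eq_sum sum.inter_filter del: sum_constant One_nat_def)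
  also have "\<dots> = (\<Sum>b\<in>B. \<Sum>a\<in>A. if R a b then 1 else 0)" by (rule sum.swap)
  also have "\<dots> = (\<Sum>b\<in>B. card {a \<in> A. R a b})"
    using assms by (simp add: card_eq_sum sum.inter_filter del: sum_constant One_nat_def)
  finally show ?thesis .
qed

text \<open>Shared by polar forms and hermitian forms; \<open>left_perp b UNIV\<close> is the left
  radical.\<close>

definition left_perp :: "('v \<Rightarrow> 'v \<Rightarrow> 'k::zero) \<Rightarrow> 'v set \<Rightarrow> 'v set" where
  "left_perp b W = {v. \<forall>w\<in>W. b v w = 0}"

lemma left_perpD: "v \<in> left_perp b W \<Longrightarrow> w \<in> W \<Longrightarrow> b v w = 0"
  by (simp add: left_perp_def)

lemma polar_commute: "polar Q u v = polar Q v u"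
  by (simp add: polar_def add.commute)

lemma quadratic_add: "Q (u + v) = Q u + Q v + polar Q u v"
  by (simp add: polar_def)

lemma maximal_totally_singularE:
  fixes W0 :: "'v::ab_group_add set"
  assumes fin: "finite (UNIV :: 'v set)" and W0: "totally_singular s Q W0"
  obtains W where "maximal_totally_singular s Q W" "W0 \<subseteq> W"
proof -
  let ?C = "{W. totally_singular s Q W \<and> W0 \<subseteq> W}"
  have "finite ?C" using fin by (metis Finite_Set.finite_set finite_subset subset_UNIV)
  moreover have "?C \<noteq> {}" using W0 by auto
  ultimately obtain W where "W \<in> ?C" "\<And>W'. W' \<in> ?C \<Longrightarrow> W \<subseteq> W' \<Longrightarrow> W' = W"
    using finite_has_maximal[of ?C] by (metis (no_types, lifting))
  then show ?thesis by (intro that[of W]) (auto simp: maximal_totally_singular_def)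
qed

locale finite_vector_space = vector_space scale
  for scale :: "'k::{finite,field} \<Rightarrow> 'v::ab_group_add \<Rightarrow> 'v" +
  assumes finite_V: "finite (UNIV :: 'v set)"
begin

lemma fin [simp]: "finite (S :: 'v set)"
  using finite_V by (rule finite_subset[rotated]) simp

lemma card_span_independent: "independent B \<Longrightarrow> card (span B) = CARD('k) ^ card B"
proof (induction B rule: finite_induct[OF fin])
  case (2 a B)
  have a: "a \<notin> span B" and B: "independent B" using 2 by (auto simp: independent_insert)
  let ?f = "\<lambda>(c, x). scale c a + x"
  have "span (insert a B) = ?f ` (UNIV \<times> span B)"
  proof -
    have "x \<in> ?f ` (UNIV \<times> span B)" if "x - scale k a \<in> span B" for x k
      using that by (intro image_eqI[of _ _ "(k, x - scale k a)"]) auto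
    moreover have "scale c a + x \<in> span (insert a B)" if "x \<in> span B" for c x
      using that span_mono[of B "insert a B"] by (intro span_add span_scale) (auto intro: span_base)
    ultimately show ?thesis by (auto simp: span_insert[of a B])
  qed
  moreover have "inj_on ?f (UNIV \<times> span B)"
  proof (rule inj_onI, clarify)
    fix c x d y assume *: "x \<in> span B" "y \<in> span B" "scale c a + x = scale d a + y"
    have "scale (c - d) a = y - x" using *(3) by (simp add: scale_left_diff_distrib algebra_simps)
    then have "scale (c - d) a \<in> span B" using * by (simp add: span_diff)
    then have "scale (inverse (c - d)) (scale (c - d) a) \<in> span B" by (rule span_scale)
    then have "c = d" using a by (cases "c = d") auto
    then show "c = d \<and> x = y" using * by simp
  qed
  ultimately have "card (span (insert a B)) = CARD('k) * card (span B)"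
    by (simp add: card_image card_cartesian_product)
  then show ?case using 2 B by simp
qed auto

lemma card_subspace: "subspace W \<Longrightarrow> card W = CARD('k) ^ dim W"
proof -
  assume W: "subspace W"
  obtain B where B: "B \<subseteq> W" "independent B" "W \<subseteq> span B" "card B = dim W"
    using basis_exists by blast
  then have "span B = W" using W by (simp add: span_minimal subset_antisym)
  then show ?thesis using card_span_independent[OF B(2)] B(4) by simp
qed

lemma card_V: "card (UNIV :: 'v set) = CARD('k) ^ dim UNIV"
  by (simp add: card_subspace)

lemma dim_eq_if_card_eq:
  assumes "subspace W" "card W = CARD('k) ^ d" shows "dim W = d"
  using assms card_subspace[of W] card_pos_field[where 'a='k] by simp

subsection \<open>Sesquilinear forms\<close>

context
  fixes \<sigma> b assumes b: "sesquilinear_form scale \<sigma> b"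
begin

lemma sesq_simps:
  shows "b (u + v) x = b u x + b v x" "b u (v + x) = b u v + b u x"
    "b (scale c u) v = c * b u v" "b u (scale c v) = \<sigma> c * b u v"
    "b 0 v = 0" "b u 0 = 0" "b (- u) v = - b u v" "b u (- v) = - b u v"
    "b (u - v) x = b u x - b v x" "b u (v - x) = b u v - b u x"
proof -
  have add: "b (u + v) x = b u x + b v x" "b u (v + x) = b u v + b u x" for u v x
    using b by (auto simp: sesquilinear_form_def)
  show "b (u + v) x = b u x + b v x" "b u (v + x) = b u v + b u x" by (fact add)+
  have sc: "b (scale c u) (scale d v) = c * \<sigma> d * b u v" and 1: "\<sigma> 1 = 1" for c d u v
    using b by (auto simp: sesquilinear_form_def field_auto_def field_hom_def)
  show s1: "b (scale c u) v = c * b u v" for c u v using sc[of c u 1 v] 1 by simp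
  show "b u (scale c v) = \<sigma> c * b u v" using sc[of 1 u c v] by simp
  show z: "b 0 v = 0" for v using s1[of 0 0 v] by simp
  have "b u 0 + b u 0 = b u 0 + 0" for u using add(2)[of u 0 0] by simp
  then show z': "b u 0 = 0" for u by (simp only: add_left_cancel)
  show n: "b (- u) v = - b u v" for u v using add(1)[of u "- u" v] z by (simp add: add_eq_0_iff)
  show n': "b u (- v) = - b u v" for u v using add(2)[of u v "- v"] z' by (simp add: add_eq_0_iff)
  show "b (u - v) x = b u x - b v x" using add(1)[of u "- v" x] n by simp
  show "b u (v - x) = b u v - b u x" using add(2)[of u v "- x"] n' by simp
qed

lemma sesq_surj_right:
  assumes "b v w \<noteq> 0" shows "\<exists>c. b v (scale c w) = a"
proof -
  have "surj \<sigma>" using b by (auto simp: sesquilinear_form_def field_auto_def bij_def)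
  then obtain c where "\<sigma> c = a / b v w" by (metis surjD)
  then show ?thesis using assms by (auto simp: sesq_simps intro!: exI[of _ c])
qed

lemma subspace_left_perp: "subspace (left_perp b W)"
  unfolding left_perp_def by (rule subspaceI) (auto simp: sesq_simps)

lemma card_fiber_right:
  assumes W: "subspace W" and v: "v \<notin> left_perp b W"
  shows "CARD('k) * card {w \<in> W. b v w = a} = card W"
proof (rule card_fiber_additive)
  obtain w where w: "w \<in> W" "b v w \<noteq> 0" using v by (auto simp: left_perp_def)
  show "\<exists>w\<in>W. b v w = a" for a
    using sesq_surj_right[OF w(2), of a] subspace_scale[OF W w(1)] by blast
qed (auto simp: sesq_simps subspace_add[OF W] subspace_diff[OF W])

lemma card_fiber_left:
  assumes U: "subspace U" and u: "u \<in> U" "b u v \<noteq> 0"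
  shows "CARD('k) * card {x \<in> U. b x v = a} = card U"
proof (rule card_fiber_additive)
  show "\<exists>x\<in>U. b x v = a" for a
    using u by (intro bexI[of _ "scale (a / b u v) u"]) (auto simp: sesq_simps subspace_scale[OF U])
qed (auto simp: sesq_simps subspace_add[OF U] subspace_diff[OF U])

text \<open>Count the pairs \<open>(v, w)\<close> with \<open>w \<in> W\<close> and \<open>b v w = 0\<close> along each coordinate.\<close>

lemma card_left_perp:
  assumes W: "subspace W"
  shows "card (left_perp b W) * card W = card (UNIV :: 'v set) * card {w \<in> W. \<forall>v. b v w = 0}"
proof -
  let ?n = "int CARD('k)" and ?P = "left_perp b W" and ?R = "{w \<in> W. \<forall>v. b v w = 0}"
  let ?V = "UNIV :: 'v set"
  have "?n * (\<Sum>v\<in>?V. int (card {w \<in> W. b v w = 0}))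
      = (\<Sum>v\<in>?V. int (CARD('k) * card {w \<in> W. b v w = 0}))"
    by (simp add: sum_distrib_left)
  \<comment> \<open>After multiplication by the field order each \<open>v\<close> contributes
    \<open>card W\<close>, and a further \<open>(?n - 1) * card W\<close> exactly if it annihilates
    all of \<open>W\<close>.\<close>
  also have "\<dots> = (\<Sum>v\<in>?V. int (card W) + (if v \<in> ?P then (?n - 1) * int (card W) else 0))"
  proof (rule sum.cong[OF refl])
    fix v
    have "{w \<in> W. b v w = 0} = W" if "v \<in> ?P" using that by (auto simp: left_perp_def)
    then show "int (CARD('k) * card {w \<in> W. b v w = 0}) =
        int (card W) + (if v \<in> ?P then (?n - 1) * int (card W) else 0)"
      using card_fiber_right[OF W, of v 0] by (auto simp: algebra_simps simp flip: of_nat_mult)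
  qed
  also have "\<dots> = int (card ?V) * int (card W) + int (card ?P) * ((?n - 1) * int (card W))"
    by (simp add: sum.distrib sum.If_cases)
  finally have A: "?n * (\<Sum>v\<in>?V. int (card {w \<in> W. b v w = 0}))
      = int (card ?V) * int (card W) + int (card ?P) * ((?n - 1) * int (card W))" .
  have "?n * (\<Sum>w\<in>W. int (card {v \<in> ?V. b v w = 0}))
      = (\<Sum>w\<in>W. int (CARD('k) * card {v \<in> ?V. b v w = 0}))"
    by (simp add: sum_distrib_left)
  also have "\<dots> = (\<Sum>w\<in>W. int (card ?V) + (if w \<in> ?R then (?n - 1) * int (card ?V) else 0))"
  proof (rule sum.cong[OF refl])
    fix w assume w: "w \<in> W"
    have full: "{v \<in> ?V. b v w = 0} = ?V" if "w \<in> ?R" using that by auto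
    have "CARD('k) * card {v \<in> ?V. b v w = 0} = card ?V" if nr: "w \<notin> ?R"
    proof -
      obtain u where "b u w \<noteq> 0" using nr w by auto
      then show ?thesis by (intro card_fiber_left) auto
    qed
    then show "int (CARD('k) * card {v \<in> ?V. b v w = 0}) =
        int (card ?V) + (if w \<in> ?R then (?n - 1) * int (card ?V) else 0)"
      using full by (auto simp: algebra_simps simp flip: of_nat_mult)
  qed
  also have "\<dots> = int (card W) * int (card ?V) + int (card ?R) * ((?n - 1) * int (card ?V))"
    by (simp add: sum.distrib sum.If_cases Int_def conj_commute)
  finally have B: "?n * (\<Sum>w\<in>W. int (card {v \<in> ?V. b v w = 0}))
      = int (card W) * int (card ?V) + int (card ?R) * ((?n - 1) * int (card ?V))" .
  have "(\<Sum>v\<in>?V. int (card {w \<in> W. b v w = 0})) = (\<Sum>w\<in>W. int (card {v \<in> ?V. b v w = 0}))"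
    unfolding of_nat_sum[symmetric] by (subst sum_card_swap) auto
  then have "int (card ?P) * ((?n - 1) * int (card W)) = int (card ?R) * ((?n - 1) * int (card ?V))"
    using A B by (simp add: mult.commute)
  then have "(?n - 1) * int (card ?P * card W) = (?n - 1) * int (card ?V * card ?R)"
    by (simp add: ac_simps)
  then have "int (card ?P * card W) = int (card ?V * card ?R)"
    using card_pos_field[where 'a='k] by (subst (asm) mult_cancel_left) auto
  then show ?thesis by (simp only: of_nat_eq_iff)
qed

lemma card_left_perp_nondegenerate:
  assumes W: "subspace W" and nd: "\<And>w. (\<And>v. b v w = 0) \<Longrightarrow> w = 0"
  shows "card (left_perp b W) * card W = card (UNIV :: 'v set)"
proof -
  have "{w \<in> W. \<forall>v. b v w = 0} = {0}" using nd subspace_0[OF W] by (auto simp: sesq_simps)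
  then show ?thesis using card_left_perp[OF W] by simp
qed

end

subsection \<open>Quadratic forms\<close>

lemma field_auto_id: "field_auto id"
  by (simp add: field_auto_def field_hom_def)

lemma vector_space_self: "vector_space ((*) :: 'k \<Rightarrow> 'k \<Rightarrow> 'k)"
  by unfold_locales (auto simp: algebra_simps)

lemma linear_self_iff:
  "Vector_Spaces.linear scale (*) f \<longleftrightarrow> (\<forall>x y. f (x + y) = f x + f y) \<and> (\<forall>c x. f (scale c x) = c * f x)"
  using vector_space_axioms vector_space_self by (simp add: Vector_Spaces.linear_iff)

text \<open>Treating the polar form as sesquilinear for the identity lets one set of rules and
  counts cover quadratic and hermitian forms.\<close>

lemma quadratic_form_iff:
  "quadratic_form scale Q \<longleftrightarrow> (\<forall>c v. Q (scale c v) = c ^ 2 * Q v) \<and> sesquilinear_form scale id (polar Q)"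
proof
  assume Q: "quadratic_form scale Q"
  then show "(\<forall>c v. Q (scale c v) = c ^ 2 * Q v) \<and> sesquilinear_form scale id (polar Q)"
    unfolding quadratic_form_def sesquilinear_form_def linear_self_iff by (simp add: field_auto_id)
next
  assume R: "(\<forall>c v. Q (scale c v) = c ^ 2 * Q v) \<and> sesquilinear_form scale id (polar Q)"
  then have S: "sesquilinear_form scale id (polar Q)" by simp
  show "quadratic_form scale Q"
    unfolding quadratic_form_def linear_self_iff using R by (simp add: sesq_simps[OF S])
qed

context
  fixes Q assumes Q: "quadratic_form scale Q"
begin

lemma polar_sesq: "sesquilinear_form scale id (polar Q)"
  using Q by (simp add: quadratic_form_iff)

lemma Q_scale: "Q (scale c v) = c ^ 2 * Q v"
  using Q by (simp add: quadratic_form_iff)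

lemma Q_0: "Q 0 = 0" using Q_scale[of 0 0] by simp

lemma polar_self: "polar Q u u = 2 * Q u"
proof -
  have "u + u = scale 2 u" using scale_left_distrib[of 1 1 u] by simp
  then have "Q (u + u) = 2 ^ 2 * Q u" by (simp only: Q_scale)
  moreover have "2 ^ 2 * Q u - Q u - Q u = 2 * Q u" by algebra
  ultimately show ?thesis by (simp only: polar_def)
qed

text \<open>On each coset \<open>v + W\<close> with \<open>v\<close> not orthogonal to \<open>W\<close>, the form is a nonconstant affine function.\<close>

lemma card_value_off_perp:
  assumes W: "totally_singular scale Q W"
  shows "int CARD('k) * int (card {v. v \<notin> left_perp (polar Q) W \<and> Q v = a})
    = int (card (UNIV :: 'v set)) - int (card (left_perp (polar Q) W))"
proof -
  let ?P = "left_perp (polar Q) W"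
  have sW: "subspace W" and QW: "\<And>w. w \<in> W \<Longrightarrow> Q w = 0" using W by (auto simp: totally_singular_def)
  note sesq = sesq_simps[OF polar_sesq]
  have polW: "polar Q w w' = 0" if "w \<in> W" "w' \<in> W" for w w'
    using QW that subspace_add[OF sW that] by (simp add: polar_def)
  have memP: "v + w \<in> ?P \<longleftrightarrow> v \<in> ?P" if "w \<in> W" for v w
    using polW that by (auto simp: left_perp_def sesq)
  have "card {v \<in> - ?P. Q (v + w) = a} = card {v \<in> - ?P. Q v = a}" if w: "w \<in> W" for w
  proof -
    have m: "v + w \<in> ?P \<longleftrightarrow> v \<in> ?P" "v - w \<in> ?P \<longleftrightarrow> v \<in> ?P" for v
      using memP[OF w, of v] memP[OF w, of "v - w"] by simp_all
    have "bij_betw (\<lambda>v. v + w) {v \<in> - ?P. Q (v + w) = a} {v \<in> - ?P. Q v = a}"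
      by (intro bij_betw_byWitness[where f'="\<lambda>v. v - w"]) (auto simp: m)
    then show ?thesis by (rule bij_betw_same_card)
  qed
  \<comment> \<open>Averaging over the translations by \<open>W\<close> turns the count off the perp
    into counts along cosets of \<open>W\<close>.\<close>
  then have "card W * card {v \<in> - ?P. Q v = a} = (\<Sum>w\<in>W. card {v \<in> - ?P. Q (v + w) = a})" by simp
  also have "\<dots> = (\<Sum>v\<in>-?P. card {w \<in> W. Q (v + w) = a})" by (rule sum_card_swap) auto
  finally have "CARD('k) * (card W * card {v \<in> - ?P. Q v = a})
      = (\<Sum>v\<in>-?P. CARD('k) * card {w \<in> W. Q (v + w) = a})" by (simp add: sum_distrib_left)
  also have "\<dots> = (\<Sum>v\<in>-?P. card W)"
  proof (rule sum.cong[OF refl])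
    fix v assume v: "v \<in> - ?P"
    have "{w \<in> W. Q (v + w) = a} = {w \<in> W. polar Q v w = a - Q v}"
      by (rule Collect_cong, rule conj_cong[OF refl]) (auto simp: quadratic_add[of Q v] QW)
    then show "CARD('k) * card {w \<in> W. Q (v + w) = a} = card W"
      using card_fiber_right[OF polar_sesq sW, of v "a - Q v"] v by simp
  qed
  also have "\<dots> = card W * card (- ?P)" by simp
  finally have "card W * (CARD('k) * card {v \<in> - ?P. Q v = a}) = card W * card (- ?P)"
    by (simp add: ac_simps)
  moreover have "card W > 0" using subspace_0[OF sW] by (auto simp: card_gt_0_iff)
  ultimately have "CARD('k) * card {v \<in> - ?P. Q v = a} = card (- ?P)"
    by (metis mult_cancel1 less_irrefl)
  moreover have "card (- ?P) + card ?P = card (UNIV :: 'v set)"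
    using card_Un_disjoint[of "- ?P" ?P] by (simp add: Un_commute Compl_partition)
  moreover have "{v \<in> - ?P. Q v = a} = {v. v \<notin> ?P \<and> Q v = a}" by auto
  ultimately show ?thesis by (metis add_diff_cancel_right' of_nat_add of_nat_mult)
qed

lemma card_zeros:
  assumes W: "totally_singular scale Q W"
  shows "int CARD('k) * int (card {v. Q v = 0})
    = int (card (UNIV :: 'v set)) - int (card (left_perp (polar Q) W))
      + int CARD('k) * int (card {v \<in> left_perp (polar Q) W. Q v = 0})"
proof -
  let ?P = "left_perp (polar Q) W"
  have "{v. Q v = 0} = {v. v \<notin> ?P \<and> Q v = 0} \<union> {v \<in> ?P. Q v = 0}" by auto
  then have "card {v. Q v = 0} = card {v. v \<notin> ?P \<and> Q v = 0} + card {v \<in> ?P. Q v = 0}"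
    by (auto intro!: card_Un_disjoint)
  then show ?thesis using card_value_off_perp[OF W, of 0] by (simp add: algebra_simps)
qed

text \<open>A singular \<open>v\<close> in the perp spans together with \<open>W\<close> a totally
  singular subspace, so maximality forces \<open>v\<close> into \<open>W\<close>.\<close>

lemma maximal_singular_in_perp:
  assumes W: "maximal_totally_singular scale Q W"
  shows "{v \<in> left_perp (polar Q) W. Q v = 0} = W"
proof
  have ts: "totally_singular scale Q W" using W by (simp add: maximal_totally_singular_def)
  have sW: "subspace W" and QW: "\<And>w. w \<in> W \<Longrightarrow> Q w = 0" using ts by (auto simp: totally_singular_def)
  show "W \<subseteq> {v \<in> left_perp (polar Q) W. Q v = 0}"
    using QW subspace_add[OF sW] by (auto simp: left_perp_def polar_def)
  show "{v \<in> left_perp (polar Q) W. Q v = 0} \<subseteq> W"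
  proof clarify
    fix v assume v: "v \<in> left_perp (polar Q) W" "Q v = 0"
    have "Q x = 0" if "x \<in> span (insert v W)" for x
    proof -
      obtain k where k: "x - scale k v \<in> W"
        using \<open>x \<in> span (insert v W)\<close> span_eq_iff[THEN iffD2, OF sW] by (auto simp: span_insert)
      have "Q (scale k v + (x - scale k v)) = 0"
        unfolding quadratic_add[of Q "scale k v"] using left_perpD[OF v(1) k] v(2) QW[OF k]
        by (simp add: Q_scale sesq_simps(3)[OF polar_sesq])
      then show ?thesis by simp
    qed
    then have "totally_singular scale Q (span (insert v W))" by (simp add: totally_singular_def)
    moreover have "W \<subseteq> span (insert v W)" by (auto intro: span_base)
    ultimately have "span (insert v W) = W" using W by (simp add: maximal_totally_singular_def)
    then show "v \<in> W" using span_base[of v "insert v W"] by auto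
  qed
qed

end

end

text \<open>With the product fixed, \<open>y\<close> falls as \<open>x\<close> grows, so
  \<open>n * x - y\<close> is strictly increasing in \<open>x\<close>. With \<open>x\<close> and
  \<open>y\<close> the orders of \<open>W\<close> and its perp this recovers \<open>W\<close>'s
  order from the number of zeros.\<close>

lemma factor_pair_unique:
  fixes x y X Y n :: int
  assumes "x > 0" "y > 0" "X > 0" "Y > 0" "n > 0" "x * y = X * Y" "n * x - y = n * X - Y"
  shows "x = X"
proof (rule ccontr)
  assume "x \<noteq> X"
  then consider "x > X" | "x < X" by linarith
  then show False
  proof cases
    case 1
    then have "n * x > n * X" using assms by simp
    then have "y > Y" using assms by linarith
    then have "x * y > X * Y" using 1 assms by (intro mult_strict_mono) auto
    then show False using assms by simp
  next
    case 2
    then have "n * x < n * X" using assms by simp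
    then have "y < Y" using assms by linarith
    then have "x * y < X * Y" using 2 assms by (intro mult_strict_mono) auto
    then show False using assms by simp
  qed
qed

context finite_vector_space begin

context
  fixes Q assumes Q: "quadratic_form scale Q"
begin

lemma left_perp_UNIV: "left_perp (polar Q) UNIV = {w. \<forall>v. polar Q v w = 0}"
  by (auto simp: left_perp_def polar_commute)

text \<open>In characteristic 2 the polar form is alternating, so a maximal totally isotropic subspace \<open>W\<close> is
  its own orthogonal complement and \<open>|W|\<^sup>2\<close> is \<open>|V|\<close> times the size of the radical.\<close>

lemma even_dim_plus_radical:
  assumes two: "(2::'k) = 0"
  shows "even (dim (UNIV :: 'v set) + dim (left_perp (polar Q) UNIV))"
proof -
  note sesq = sesq_simps[OF polar_sesq[OF Q]]
  let ?iso = "\<lambda>W. subspace W \<and> (\<forall>u\<in>W. \<forall>v\<in>W. polar Q u v = 0)"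
  have finC: "finite {W. ?iso W}" by (rule finite_subset[OF subset_UNIV]) (simp add: Finite_Set.finite_set)
  have "{0} \<in> {W. ?iso W}" by (simp add: sesq(5))
  then have "{W. ?iso W} \<noteq> {}" by blast
  then have "\<exists>W\<in>{W. ?iso W}. \<forall>W'\<in>{W. ?iso W}. W \<subseteq> W' \<longrightarrow> W = W'"
    by (rule finite_has_maximal[OF finC])
  then obtain W where W: "?iso W" and max: "\<And>W'. ?iso W' \<Longrightarrow> W \<subseteq> W' \<Longrightarrow> W = W'"
    unfolding Bex_def Ball_def mem_Collect_eq by metis
  have sW: "subspace W" using W by simp
  have perp: "left_perp (polar Q) W = W"
  proof
    show "W \<subseteq> left_perp (polar Q) W" using W by (auto simp: left_perp_def)
    show "left_perp (polar Q) W \<subseteq> W"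
    proof
      fix v assume v: "v \<in> left_perp (polar Q) W"
      have vv: "polar Q v v = 0" using two by (simp add: polar_self[OF Q])
      have "polar Q x y = 0" if xy: "x \<in> span (insert v W)" "y \<in> span (insert v W)" for x y
      proof -
        obtain k where k: "x - scale k v \<in> W"
          using xy(1) span_eq_iff[THEN iffD2, OF sW] by (auto simp: span_insert)
        obtain l where l: "y - scale l v \<in> W"
          using xy(2) span_eq_iff[THEN iffD2, OF sW] by (auto simp: span_insert)
        have 1: "polar Q (x - scale k v) (y - scale l v) = 0" using W k l by blast
        have 2: "polar Q v (y - scale l v) = 0" using left_perpD[OF v l] .
        have 3: "polar Q (x - scale k v) v = 0" using left_perpD[OF v k] by (simp add: polar_commute)
        have "polar Q (x - scale k v + scale k v) (y - scale l v + scale l v) = 0"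
          unfolding sesq(1-4) by (simp only: 1 2 3 vv) simp
        then show ?thesis by simp
      qed
      then have "?iso (span (insert v W))" by simp
      then have "W = span (insert v W)" by (rule max) (auto intro: span_base)
      then show "v \<in> W" using span_base[of v "insert v W"] by auto
    qed
  qed
  have R: "{w \<in> W. \<forall>v. polar Q v w = 0} = left_perp (polar Q) UNIV"
  proof -
    have "w \<in> W" if "\<forall>v. polar Q v w = 0" for w
    proof -
      have "w \<in> left_perp (polar Q) W" using that by (simp add: left_perp_def polar_commute)
      then show ?thesis by (simp only: perp)
    qed
    then show ?thesis by (auto simp: left_perp_UNIV)
  qed
  have "CARD('k) ^ (2 * dim W) = CARD('k) ^ (dim (UNIV :: 'v set) + dim (left_perp (polar Q) UNIV))"
    using card_left_perp[OF polar_sesq[OF Q] sW]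
    by (simp add: perp R card_subspace sW subspace_left_perp[OF polar_sesq[OF Q]] power_add mult_2)
  then have "2 * dim W = dim (UNIV :: 'v set) + dim (left_perp (polar Q) UNIV)"
    using card_pos_field[where 'a='k] by simp
  then show ?thesis by (metis dvd_triv_left)
qed

lemma polar_nondegenerate_odd_char:
  assumes nd: "qf_nondegenerate Q" and two: "(2::'k) \<noteq> 0" and w: "\<And>v. polar Q v w = 0"
  shows "w = 0"
proof -
  have "2 * Q w = 0" using w[of w] by (simp add: polar_self[OF Q])
  then have "Q w = 0" using two by simp
  then show ?thesis using nd w by (auto simp: qf_nondegenerate_def polar_commute)
qed

text \<open>In characteristic 2, \<open>Q\<close> is additive and injective on the radical of the polar form, whose
  dimension is therefore at most 1, hence 0 by parity.\<close>

lemma polar_nondegenerate: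
  assumes nd: "qf_nondegenerate Q" and even: "even (dim (UNIV :: 'v set))"
    and w: "\<And>v. polar Q v w = 0"
  shows "w = 0"
proof (cases "(2::'k) = 0")
  case False
  then show ?thesis using polar_nondegenerate_odd_char nd w by blast
next
  case two: True
  let ?R = "left_perp (polar Q) UNIV"
  have sR: "subspace ?R" by (rule subspace_left_perp[OF polar_sesq[OF Q]])
  have "inj_on Q ?R"
  proof (rule inj_onI)
    fix x y assume x: "x \<in> ?R" and y: "y \<in> ?R" and eq: "Q x = Q y"
    have "Q (x + y) = 2 * Q y"
      using x eq by (simp add: quadratic_add[of Q x] left_perp_def)
    then have "x + y = 0"
      using nd two subspace_add[OF sR x y] by (auto simp: qf_nondegenerate_def left_perp_def)
    moreover have "y + y = scale 2 y" using scale_left_distrib[of 1 1 y] by simp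
    ultimately show "x = y" using two by (simp add: add_eq_0_iff)
  qed
  then have "card ?R \<le> CARD('k)" using card_inj_on_le[of Q ?R UNIV] by simp
  then have "CARD('k) ^ dim ?R \<le> CARD('k) ^ 1" by (simp add: card_subspace[OF sR])
  then have "dim ?R \<le> 1" using card_pos_field[where 'a='k] by (simp only: power_increasing_iff)
  moreover have "even (dim ?R)" using even_dim_plus_radical[OF two] even by simp
  ultimately have "dim ?R = 0" by (cases "dim ?R = 1") auto
  then have "card ?R = 1" using card_subspace[OF sR] by simp
  moreover have "0 \<in> ?R" by (rule subspace_0[OF sR])
  moreover have "w \<in> ?R" using w by (simp add: left_perp_UNIV)
  ultimately show ?thesis by (auto simp: card_1_singleton_iff)
qed

subsection \<open>The number of singular vectors determines the type\<close>

context
  assumes nd: "\<And>w. (\<And>v. polar Q v w = 0) \<Longrightarrow> w = 0"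
begin

lemma qf_nondegenerate_if_polar: "qf_nondegenerate Q"
  unfolding qf_nondegenerate_def using nd polar_commute by metis

lemma totally_singular_0: "totally_singular scale Q {0}"
  using Q_0[OF Q] by (simp add: totally_singular_def)

text \<open>\<open>e\<close> is the dimension of the perp. The right-hand side does not mention
  \<open>W\<close>: a single maximal subspace, which exists by finiteness, fixes the count, and the
  count then fixes the dimension of all of them.\<close>

lemma maximal_dim_iff:
  assumes d: "d + e = dim (UNIV :: 'v set)"
  shows "(\<forall>W. maximal_totally_singular scale Q W \<longrightarrow> dim W = d) \<longleftrightarrow>
    int CARD('k) * int (card {v. Q v = 0})
      = int (CARD('k) ^ (d + e)) - int (CARD('k) ^ e) + int (CARD('k) ^ (d + 1))"
proof -
  let ?n = "int CARD('k)" and ?Z = "int (card {v. Q v = 0})"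
  have n: "?n > 1" using card_pos_field[where 'a='k] by simp
  have sub: "subspace W" if "maximal_totally_singular scale Q W" for W
    using that by (simp add: maximal_totally_singular_def totally_singular_def)
  have key: "?n * ?Z = ?n ^ (d + e) - int (card (left_perp (polar Q) W)) + ?n * int (card W)"
    "int (card W) * int (card (left_perp (polar Q) W)) = ?n ^ d * ?n ^ e"
    if W: "maximal_totally_singular scale Q W" for W
  proof -
    show "?n * ?Z = ?n ^ (d + e) - int (card (left_perp (polar Q) W)) + ?n * int (card W)"
      using card_zeros[OF Q, of W] W maximal_singular_in_perp[OF Q W] card_V d
      by (simp add: maximal_totally_singular_def)
    have "card (left_perp (polar Q) W) * card W = card (UNIV :: 'v set)"
      by (rule card_left_perp_nondegenerate[OF polar_sesq[OF Q] sub[OF W] nd])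
    then show "int (card W) * int (card (left_perp (polar Q) W)) = ?n ^ d * ?n ^ e"
      using card_V d by (metis mult.commute of_nat_mult of_nat_power power_add)
  qed
  have pos: "int (card W) > 0" "int (card (left_perp (polar Q) W)) > 0"
    if "maximal_totally_singular scale Q W" for W
    using subspace_0[OF sub[OF that]] subspace_0[OF subspace_left_perp[OF polar_sesq[OF Q]]]
    by (auto simp: card_gt_0_iff)
  show ?thesis
  proof
    assume all: "\<forall>W. maximal_totally_singular scale Q W \<longrightarrow> dim W = d"
    obtain W where W: "maximal_totally_singular scale Q W"
      using maximal_totally_singularE[OF finite_V totally_singular_0] .
    have c: "int (card W) = ?n ^ d" using all W card_subspace[OF sub[OF W]] by simp
    then have "int (card (left_perp (polar Q) W)) = ?n ^ e" using key(2)[OF W] n by simp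
    then show "?n * ?Z = int (CARD('k) ^ (d + e)) - int (CARD('k) ^ e) + int (CARD('k) ^ (d + 1))"
      using key(1)[OF W] c by simp
  next
    assume Z: "?n * ?Z = int (CARD('k) ^ (d + e)) - int (CARD('k) ^ e) + int (CARD('k) ^ (d + 1))"
    show "\<forall>W. maximal_totally_singular scale Q W \<longrightarrow> dim W = d"
    proof (intro allI impI)
      fix W assume W: "maximal_totally_singular scale Q W"
      have "int (card W) = ?n ^ d"
      proof (rule factor_pair_unique)
        show "?n * int (card W) - int (card (left_perp (polar Q) W)) = ?n * ?n ^ d - ?n ^ e"
          using key(1)[OF W] Z by simp
      qed (use key(2)[OF W] pos[OF W] n in auto)
      then have "card W = CARD('k) ^ d" by (metis of_nat_eq_iff of_nat_power)
      then show "dim W = d" by (rule dim_eq_if_card_eq[OF sub[OF W]])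
    qed
  qed
qed

text \<open>With T = n^r the space has (nT)^2 elements; writing half the dimension as
  \<open>Suc r\<close> makes T an integer.\<close>

lemma type_O_plus_iff:
  assumes d: "dim (UNIV :: 'v set) = 2 * Suc r"
  shows "type_O_plus scale Q \<longleftrightarrow> int (card {v. Q v = 0})
    = int CARD('k) * (int CARD('k) ^ r) ^ 2 + (int CARD('k) - 1) * int CARD('k) ^ r"
proof -
  let ?n = "int CARD('k)"
  have n: "?n \<noteq> 0" using card_pos_field[where 'a='k] by simp
  have "type_O_plus scale Q \<longleftrightarrow> (\<forall>W. maximal_totally_singular scale Q W \<longrightarrow> dim W = Suc r)"
    unfolding type_O_plus_def d using Q qf_nondegenerate_if_polar by simp
  also have "\<dots> \<longleftrightarrow> ?n * int (card {v. Q v = 0})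
      = ?n * (?n * (?n ^ r) ^ 2 + (?n - 1) * ?n ^ r)"
    using d by (subst maximal_dim_iff[of _ "Suc r"]) (auto simp: power_add power2_eq_square algebra_simps)
  finally show ?thesis using n by (simp only: mult_cancel_left) simp
qed

lemma type_O_minus_iff:
  assumes d: "dim (UNIV :: 'v set) = 2 * Suc r"
  shows "type_O_minus scale Q \<longleftrightarrow> int (card {v. Q v = 0})
    = int CARD('k) * (int CARD('k) ^ r) ^ 2 - (int CARD('k) - 1) * int CARD('k) ^ r"
proof -
  let ?n = "int CARD('k)"
  have n: "?n \<noteq> 0" using card_pos_field[where 'a='k] by simp
  have "type_O_minus scale Q \<longleftrightarrow> (\<forall>W. maximal_totally_singular scale Q W \<longrightarrow> dim W = r)"
    unfolding type_O_minus_def d using Q qf_nondegenerate_if_polar by simp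
  also have "\<dots> \<longleftrightarrow> ?n * int (card {v. Q v = 0})
      = ?n * (?n * (?n ^ r) ^ 2 - (?n - 1) * ?n ^ r)"
    \<comment> \<open>Dimension \<open>r\<close> for \<open>W\<close> leaves \<open>r + 2\<close>
      for its perp.\<close>
    using d by (subst maximal_dim_iff[of _ "Suc (Suc r)"]) (auto simp: power_add power2_eq_square algebra_simps)
  finally show ?thesis using n by (simp only: mult_cancel_left) simp
qed

text \<open>The sum of squares counts the pairs with \<open>Q u = Q v\<close>. With
  \<open>v = u + x\<close> the condition becomes \<open>polar Q u x = - Q x\<close>: for fixed
  nonzero \<open>x\<close> an affine hyperplane in \<open>u\<close>, and for \<open>x = 0\<close> no
  condition.\<close>

lemma sum_card_values_squared:
  "int CARD('k) * (\<Sum>a\<in>UNIV. (int (card {v. Q v = a}))\<^sup>2)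
    = int CARD('k) * int (card (UNIV :: 'v set))
      + (int (card (UNIV :: 'v set)) - 1) * int (card (UNIV :: 'v set))"
proof -
  let ?V = "UNIV :: 'v set" and ?n = "int CARD('k)"
  have "(\<Sum>a\<in>UNIV. (card {v. Q v = a})\<^sup>2) = (\<Sum>a\<in>UNIV. \<Sum>u\<in>{u \<in> ?V. Q u = a}. card {v. Q v = Q u})"
    by (simp add: power2_eq_square)
  also have "\<dots> = (\<Sum>u\<in>?V. card {v. Q v = Q u})" by (rule sum.group) auto
  also have "\<dots> = (\<Sum>u\<in>?V. card {x \<in> ?V. polar Q u x = - Q x})"
  proof (rule sum.cong[OF refl])
    fix u
    have "polar Q u x = - Q x \<longleftrightarrow> Q (u + x) = Q u" for x
      by (simp only: quadratic_add[of Q u x] add.assoc add_cancel_left_right add_eq_0_iff)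
    then have "{x \<in> ?V. polar Q u x = - Q x} = {x. Q (u + x) = Q u}" by (simp only:) simp
    moreover have "bij_betw (\<lambda>x. u + x) {x. Q (u + x) = Q u} {v. Q v = Q u}"
      by (intro bij_betw_byWitness[where f'="\<lambda>v. v - u"]) auto
    ultimately have "bij_betw (\<lambda>x. u + x) {x \<in> ?V. polar Q u x = - Q x} {v. Q v = Q u}"
      by (simp only:)
    then show "card {v. Q v = Q u} = card {x \<in> ?V. polar Q u x = - Q x}"
      by (rule bij_betw_same_card[symmetric])
  qed
  also have "\<dots> = (\<Sum>x\<in>?V. card {u \<in> ?V. polar Q u x = - Q x})" by (rule sum_card_swap) auto
  finally have "(\<Sum>a\<in>UNIV. (card {v. Q v = a})\<^sup>2) = (\<Sum>x\<in>?V. card {u \<in> ?V. polar Q u x = - Q x})" .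
  then have "int (\<Sum>a\<in>UNIV. (card {v. Q v = a})\<^sup>2) = int (\<Sum>x\<in>?V. card {u \<in> ?V. polar Q u x = - Q x})"
    by (simp only:)
  then have "?n * (\<Sum>a\<in>UNIV. (int (card {v. Q v = a}))\<^sup>2)
      = (\<Sum>x\<in>?V. int (CARD('k) * card {u \<in> ?V. polar Q u x = - Q x}))"
    by (simp add: sum_distrib_left)
  also have "\<dots> = (\<Sum>x\<in>?V. int (card ?V) + (if x = 0 then (?n - 1) * int (card ?V) else 0))"
  proof (rule sum.cong[OF refl])
    fix x :: 'v
    show "int (CARD('k) * card {u \<in> ?V. polar Q u x = - Q x})
        = int (card ?V) + (if x = 0 then (?n - 1) * int (card ?V) else 0)"
    proof (cases "x = 0")
      case True
      then have "{u \<in> ?V. polar Q u x = - Q x} = ?V"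
        by (simp add: sesq_simps(6)[OF polar_sesq[OF Q]] Q_0[OF Q])
      then show ?thesis using True by (simp add: algebra_simps)
    next
      case False
      then obtain u where "polar Q u x \<noteq> 0" using nd by blast
      then have "CARD('k) * card {u \<in> ?V. polar Q u x = - Q x} = card ?V"
        by (intro card_fiber_left[OF polar_sesq[OF Q]]) auto
      then show ?thesis using False by (simp flip: of_nat_mult)
    qed
  qed
  also have "\<dots> = int (card ?V) * int (card ?V) + (?n - 1) * int (card ?V)"
    by (simp add: sum.distrib)
  finally show ?thesis by (simp add: algebra_simps)
qed

text \<open>The zero count makes the Cauchy--Schwarz inequality for the numbers of solutions of
  \<open>Q v = a\<close>, \<open>a \<noteq> 0\<close>, an equality.\<close>

lemma card_nonzero_value:
  fixes T \<epsilon> :: int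
  assumes V: "int (card (UNIV :: 'v set)) = (int CARD('k) * T)\<^sup>2" and \<epsilon>: "\<epsilon>\<^sup>2 = 1"
    and Z: "int (card {v. Q v = 0}) = int CARD('k) * T\<^sup>2 + \<epsilon> * (int CARD('k) - 1) * T"
    and a: "a \<noteq> 0"
  shows "int (card {v. Q v = a}) = int CARD('k) * T\<^sup>2 - \<epsilon> * T"
proof -
  define n where "n = int CARD('k)"
  define N where "N a = int (card {v. Q v = a})" for a
  \<comment> \<open>The mean of the counts over nonzero values, (|V| - N 0) / (n - 1).\<close>
  define \<mu> where "\<mu> = n * T\<^sup>2 - \<epsilon> * T"
  have n: "n > 1" using card_pos_field[where 'a='k] by (simp add: n_def)
  have "(\<Sum>a\<in>UNIV. card {v. Q v = a}) = (\<Sum>a\<in>UNIV. \<Sum>v\<in>{v \<in> UNIV. Q v = a}. 1)" by simp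
  also have "\<dots> = (\<Sum>v\<in>(UNIV :: 'v set). 1)" by (rule sum.group) auto
  finally have "(\<Sum>a\<in>UNIV. N a) = (n * T)\<^sup>2"
    using V by (simp add: N_def n_def flip: of_nat_sum)
  then have S1: "(\<Sum>a\<in>UNIV-{0}. N a) = (n - 1) * \<mu>"
    using Z unfolding sum_diff1[OF finite] by (simp add: N_def[of 0] \<mu>_def n_def algebra_simps power2_eq_square)
  have S2: "n * (\<Sum>a\<in>UNIV-{0}. (N a)\<^sup>2) = n * (n * T)\<^sup>2 + ((n * T)\<^sup>2 - 1) * (n * T)\<^sup>2 - n * (N 0)\<^sup>2"
    using sum_card_values_squared V unfolding sum_diff1[OF finite]
    by (simp add: N_def n_def right_diff_distrib)
  have "n * (\<Sum>a\<in>UNIV-{0}. (N a - \<mu>)\<^sup>2)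
      = n * (\<Sum>a\<in>UNIV-{0}. (N a)\<^sup>2) - 2 * \<mu> * n * (\<Sum>a\<in>UNIV-{0}. N a) + n * (n - 1) * \<mu>\<^sup>2"
    using card_pos_field[where 'a='k]
    by (simp add: power2_diff sum.distrib sum_subtractf sum_distrib_left card_Diff_singleton n_def
        of_nat_diff algebra_simps)
  also have "\<dots> = n * (n * T)\<^sup>2 + ((n * T)\<^sup>2 - 1) * (n * T)\<^sup>2 - n * (N 0)\<^sup>2 - n * (n - 1) * \<mu>\<^sup>2"
    unfolding S1 S2 by (simp add: power2_eq_square algebra_simps)
  also have "\<dots> = 0"
  proof -
    have N0: "N 0 = n * T\<^sup>2 + \<epsilon> * (n - 1) * T" using Z by (simp add: N_def n_def)
    show ?thesis unfolding N0 \<mu>_def using \<epsilon> by algebra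
  qed
  finally have "(\<Sum>a\<in>UNIV-{0}. (N a - \<mu>)\<^sup>2) = 0" using n by simp
  then have "\<forall>a\<in>UNIV-{0}. (N a - \<mu>)\<^sup>2 = 0" by (subst (asm) sum_nonneg_eq_0_iff) auto
  then show ?thesis using a by (simp add: N_def \<mu>_def n_def)
qed

end

end

end

subsection \<open>Isometry groups\<close>

lemma group_of_bijections:
  assumes "id \<in> S" "\<And>f g. f \<in> S \<Longrightarrow> g \<in> S \<Longrightarrow> f \<circ> g \<in> S"
    and "\<And>f. f \<in> S \<Longrightarrow> bij f" "\<And>f. f \<in> S \<Longrightarrow> inv_into UNIV f \<in> S"
  shows "group \<lparr>carrier = S, monoid.mult = (\<circ>), one = id\<rparr>"
proof -
  let ?G = "\<lparr>carrier = S, monoid.mult = (\<circ>), one = id\<rparr>"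
  have "\<exists>g\<in>carrier ?G. monoid.mult ?G g f = one ?G" if "f \<in> carrier ?G" for f
    using that assms(3,4)[of f] by (intro bexI[of _ "inv_into UNIV f"]) (auto simp: bij_is_inj)
  then show ?thesis by (intro groupI) (use assms in \<open>auto simp: comp_assoc\<close>)
qed

lemma linear_inv:
  assumes "Vector_Spaces.linear s s g" "bij g"
  shows "Vector_Spaces.linear s s (inv_into UNIV g)"
proof -
  have *: "vector_space s" "\<And>x y. g (x + y) = g x + g y" "\<And>c x. g (s c x) = s c (g x)"
    using assms(1) by (auto simp: Vector_Spaces.linear_iff)
  have g: "inv_into UNIV g (g x) = x" "g (inv_into UNIV g x) = x" for x
    using assms(2) by (auto simp: bij_is_inj bij_is_surj surj_f_inv_f)
  have "inv_into UNIV g (x + y) = inv_into UNIV g x + inv_into UNIV g y" for x y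
    using *(2)[of "inv_into UNIV g x" "inv_into UNIV g y"] g by metis
  moreover have "inv_into UNIV g (s c x) = s c (inv_into UNIV g x)" for c x
    using *(3)[of c "inv_into UNIV g x"] g by metis
  ultimately show ?thesis using *(1) by (simp add: Vector_Spaces.linear_iff)
qed

lemma linear_comp:
  "Vector_Spaces.linear s s f \<Longrightarrow> Vector_Spaces.linear s s g \<Longrightarrow> Vector_Spaces.linear s s (f \<circ> g)"
  by (simp add: Vector_Spaces.linear_iff)

lemma group_qf_isometry:
  assumes "vector_space s" shows "group (qf_isometry_group s Q)"
  unfolding qf_isometry_group_def
proof (rule group_of_bijections)
  fix f assume f: "f \<in> {g. Vector_Spaces.linear s s g \<and> bij g \<and> (\<forall>v. Q (g v) = Q v)}"
  then have "Q (f (inv_into UNIV f v)) = Q (inv_into UNIV f v)" for v by blast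
  then show "inv_into UNIV f \<in> {g. Vector_Spaces.linear s s g \<and> bij g \<and> (\<forall>v. Q (g v) = Q v)}"
    using f by (auto simp: linear_inv bij_imp_bij_inv bij_is_surj surj_f_inv_f)
qed (use assms in \<open>auto simp: linear_comp bij_comp Vector_Spaces.linear_iff\<close>)

lemma group_form_isometry:
  assumes "vector_space s" shows "group (form_isometry_group s b)"
  unfolding form_isometry_group_def
proof (rule group_of_bijections)
  fix f assume f: "f \<in> {g. Vector_Spaces.linear s s g \<and> bij g \<and> (\<forall>u v. b (g u) (g v) = b u v)}"
  then have "b (f (inv_into UNIV f u)) (f (inv_into UNIV f v)) = b (inv_into UNIV f u) (inv_into UNIV f v)" for u v by blast
  then show "inv_into UNIV f \<in> {g. Vector_Spaces.linear s s g \<and> bij g \<and> (\<forall>u v. b (g u) (g v) = b u v)}"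
    using f by (auto simp: linear_inv bij_imp_bij_inv bij_is_surj surj_f_inv_f)
qed (use assms in \<open>auto simp: linear_comp bij_comp Vector_Spaces.linear_iff\<close>)

lemma is_subgroup_ofI:
  assumes "group \<lparr>carrier = S, monoid.mult = (\<circ>), one = id\<rparr>" "group \<lparr>carrier = S', monoid.mult = (\<circ>), one = id\<rparr>"
    and "S \<subseteq> S'"
  shows "is_subgroup_of \<lparr>carrier = S, monoid.mult = (\<circ>), one = id\<rparr> \<lparr>carrier = S', monoid.mult = (\<circ>), one = id\<rparr>"
  using assms group.group_incl_imp_subgroup[OF assms(2), of S] by (simp add: is_subgroup_of_def)

subsection \<open>Forms composed with the trace\<close>

locale trace_lift = traced_extension \<iota> q w \<alpha> + K: finite_vector_space s
  for \<iota> :: "'f::{finite,field} \<Rightarrow> 'k::{finite,field}" and q w and \<alpha> :: 'k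
    and s :: "'k \<Rightarrow> 'v::ab_group_add \<Rightarrow> 'v"
begin

abbreviation sq :: "'f \<Rightarrow> 'v \<Rightarrow> 'v" where "sq \<equiv> restrict_scalars \<iota> s"

lemma sq_def: "sq c = s (\<iota> c)"
  by (simp add: restrict_scalars_def)

sublocale F: finite_vector_space sq
  by unfold_locales
    (auto simp: sq_def \<iota>_simps K.scale_left_distrib K.scale_right_distrib)

text \<open>The order of \<open>V\<close> determines both dimensions, so no basis has to be
  transported between the fields.\<close>

lemma dim_sq: "F.dim UNIV = K.dim UNIV * w"
  by (rule F.dim_eq_if_card_eq) (simp_all add: K.card_V card_k card_f mult.commute flip: power_mult)

lemma half_dim_sq:
  assumes "F.dim UNIV = 2 * R" "K.dim UNIV > 0"
  obtains r' where "F.dim UNIV = 2 * Suc r'" "Suc r' = R"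
proof -
  have "R > 0" using assms dim_sq w_pos by (auto intro: gr0I)
  then show thesis using that[of "R - 1"] assms by simp
qed

lemma subspace_sq: "K.subspace W \<Longrightarrow> F.subspace W"
  unfolding K.subspace_def F.subspace_def by (simp add: sq_def)

lemma linear_sq: "Vector_Spaces.linear s s g \<Longrightarrow> Vector_Spaces.linear sq sq g"
  using F.vector_space_axioms by (simp add: Vector_Spaces.linear_iff sq_def)

lemma qf_embedding: "is_subgroup_of (qf_isometry_group s Q) (qf_isometry_group sq (L \<circ> Q))"
  using group_qf_isometry[OF K.vector_space_axioms, of Q] group_qf_isometry[OF F.vector_space_axioms, of "L \<circ> Q"]
  unfolding qf_isometry_group_def by (rule is_subgroup_ofI) (auto intro: linear_sq)

lemma form_embedding:
  "is_subgroup_of (form_isometry_group s b) (form_isometry_group sq (\<lambda>u v. L (b u v)))"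
  using group_form_isometry[OF K.vector_space_axioms, of b]
    group_form_isometry[OF F.vector_space_axioms, of "\<lambda>u v. L (b u v)"]
  unfolding form_isometry_group_def by (rule is_subgroup_ofI) (auto intro: linear_sq)

text \<open>If \<open>b u v\<close> is not 0, then \<open>b u\<close> takes every value on the line
  through \<open>v\<close>, and \<open>L\<close> does not vanish identically.\<close>

lemma form_nondegenerate_L:
  assumes b: "sesquilinear_form s \<sigma> b" and nd: "form_nondegenerate b"
  shows "form_nondegenerate (\<lambda>u v. L (b u v))"
  unfolding form_nondegenerate_def
proof (intro allI impI)
  fix u assume u: "\<forall>v. L (b u v) = 0"
  have "b u v = 0" for v
  proof (rule ccontr)
    assume v: "b u v \<noteq> 0"
    obtain x where "L x \<noteq> 0" using L_nonzero by blast
    moreover obtain c where "b u (s c v) = x" using K.sesq_surj_right[OF b v] by blast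
    ultimately show False using u by metis
  qed
  then show "u = 0" using nd by (simp add: form_nondegenerate_def)
qed

text \<open>A subspace over the large field keeps its perp under composition with \<open>L\<close>,
  so decompositions found over GF(q^w) serve directly for counting over GF(q).\<close>

lemma left_perp_L:
  assumes b: "sesquilinear_form s \<sigma> b" and W: "K.subspace W"
  shows "left_perp (\<lambda>u v. L (b u v)) W = left_perp b W"
proof
  show "left_perp (\<lambda>u v. L (b u v)) W \<subseteq> left_perp b W"
  proof
    fix u assume u: "u \<in> left_perp (\<lambda>u v. L (b u v)) W"
    have "b u v = 0" if "v \<in> W" for v
    proof (rule ccontr)
      assume v: "b u v \<noteq> 0"
      obtain x where "L x \<noteq> 0" using L_nonzero by blast
      moreover obtain c where "b u (s c v) = x" using K.sesq_surj_right[OF b v] by blast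
      ultimately show False using left_perpD[OF u, of "s c v"] K.subspace_scale[OF W that] by metis
    qed
    then show "u \<in> left_perp b W" by (simp add: left_perp_def)
  qed
qed (simp add: left_perp_def subset_iff)

lemma sesquilinear_L:
  assumes b: "sesquilinear_form s \<sigma> b" and \<tau>: "field_auto \<tau>" and \<sigma>: "\<And>c. \<sigma> (\<iota> c) = \<iota> (\<tau> c)"
  shows "sesquilinear_form sq \<tau> (\<lambda>u v. L (b u v))"
proof -
  note sesq = K.sesq_simps[OF b]
  have "L (b (sq c u) (sq d v)) = c * \<tau> d * L (b u v)" for c d u v
    using L_scale[of "c * \<tau> d" "b u v"] by (simp add: sq_def sesq \<sigma> \<iota>_simps(4) mult.assoc mult.left_commute)
  then show ?thesis using \<tau> by (simp add: sesquilinear_form_def sesq L_add)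
qed

lemma polar_L: "polar (L \<circ> Q) u v = L (polar Q u v)"
  by (simp add: polar_def L_diff)

context
  fixes Q assumes Q: "quadratic_form s Q"
begin

lemma quadratic_form_L: "quadratic_form sq (L \<circ> Q)"
proof -
  have "L (\<iota> c ^ 2 * Q v) = c ^ 2 * L (Q v)" for c v
    using L_scale[of "c ^ 2"] by (simp add: \<iota>_simps(7))
  moreover have "sesquilinear_form sq id (\<lambda>u v. L (polar Q u v))"
    using K.polar_sesq[OF Q] by (rule sesquilinear_L) (simp_all add: K.field_auto_id F.field_auto_id)
  moreover have "polar (L \<circ> Q) = (\<lambda>u v. L (polar Q u v))" by (intro ext polar_L)
  ultimately show ?thesis by (simp add: F.quadratic_form_iff sq_def K.Q_scale[OF Q])
qed

text \<open>Odd dimension leaves a nonzero \<open>u\<close> in the radical of the polar form. In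
  even order \<open>2 * h\<close> every \<open>y\<close> has the square root \<open>y ^ h\<close>,
  so \<open>c\<^sup>2 * Q u\<close> can be made a nonzero element of the kernel of \<open>L\<close>,
  which exists as \<open>w > 1\<close>; if \<open>Q u = 0\<close>, then \<open>u\<close> itself
  serves.\<close>

lemma degenerate_L_even_char:
  assumes two: "(2::'k) = 0" and odd: "odd (K.dim UNIV)" and w: "w > 1"
  shows "\<not> qf_nondegenerate (L \<circ> Q)"
proof -
  let ?R = "left_perp (polar Q) UNIV"
  have sR: "K.subspace ?R" by (rule K.subspace_left_perp[OF K.polar_sesq[OF Q]])
  have "odd (K.dim ?R)" using K.even_dim_plus_radical[OF Q two] odd by simp
  then have "K.dim ?R \<noteq> 0" by (metis even_zero)
  then have "card ?R \<noteq> 1" using K.card_subspace[OF sR] card_pos_field[where 'a='k] by simp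
  then obtain u where u: "u \<in> ?R" "u \<noteq> 0"
    using K.subspace_0[OF sR] by (metis card_1_singleton_iff is_singletonI is_singletonI' is_singleton_altdef empty_iff)
  have "card {x. L x = 0} \<noteq> 1"
    using card_L_fiber[of 0] w q_gt_1 power_strict_increasing[of 1 w q] by auto
  then obtain x where x: "L x = 0" "x \<noteq> 0"
    using L_0 by (metis (mono_tags, lifting) card_1_singleton_iff mem_Collect_eq One_nat_def
        is_singletonI' is_singleton_altdef empty_iff)
  have "\<exists>c. c \<noteq> 0 \<and> L (c ^ 2 * Q u) = 0"
  proof (cases "Q u = 0")
    case False
    have "even CARD('k)" using two two_eq_0_iff_even_card by blast
    then obtain h where h: "CARD('k) = 2 * h" by (elim evenE)
    let ?y = "x / Q u"
    have "(?y ^ h) ^ 2 = ?y ^ CARD('k)" by (simp add: h mult.commute flip: power_mult)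
    then have "(?y ^ h) ^ 2 = ?y" by (simp only: finite_field_power_card)
    then show ?thesis using x False by (intro exI[of _ "?y ^ h"]) simp
  qed (auto intro: exI[of _ 1])
  then obtain c where c: "c \<noteq> 0" "L (c ^ 2 * Q u) = 0" by blast
  have "L (Q (s c u)) = 0" using c by (simp add: K.Q_scale[OF Q])
  moreover have "polar (L \<circ> Q) (s c u) v = 0" for v
    using u(1) by (simp add: polar_L K.sesq_simps(3)[OF K.polar_sesq[OF Q]] left_perp_def)
  moreover have "s c u \<noteq> 0" using c u by simp
  ultimately show ?thesis by (auto simp: qf_nondegenerate_def)
qed

context
  assumes nd: "\<And>z. (\<And>v. polar Q v z = 0) \<Longrightarrow> z = 0"
begin

lemma polar_nondegenerate_L:
  assumes "\<And>v. polar (L \<circ> Q) v z = 0" shows "z = 0"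
proof (rule nd, rule ccontr)
  fix v assume "polar Q v z \<noteq> 0"
  moreover obtain x where "L (x * polar Q v z) = 1"
    using L_surj_mult \<open>polar Q v z \<noteq> 0\<close> by blast
  ultimately show False
    using assms[of "s x v"] by (simp add: polar_L K.sesq_simps(3)[OF K.polar_sesq[OF Q]])
qed

lemma card_zeros_L:
  "card {v. L (Q v) = 0} = (\<Sum>a\<in>{a. L a = 0}. card {v. Q v = a})"
proof -
  have "{v. L (Q v) = 0} = (\<Union>a\<in>{a. L a = 0}. {v. Q v = a})" by auto
  then show ?thesis by (simp only:) (subst card_UN_disjoint, auto)
qed

text \<open>The sign \<epsilon> survives: the kernel of \<open>L\<close> has \<open>k\<close>
  elements, each nonzero one is attained \<open>n * T\<^sup>2 - \<epsilon> * T\<close> times, and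
  with \<open>T' = k * T\<close> and \<open>n = q * k\<close> the total takes the same shape over
  the small field.\<close>

lemma zero_count_L:
  assumes d: "K.dim UNIV = 2 * Suc r" and r': "Suc r' = Suc r * w" and \<epsilon>: "\<epsilon>\<^sup>2 = (1::int)"
    and Z: "int (card {v. Q v = 0}) = int CARD('k) * (int CARD('k) ^ r)\<^sup>2 + \<epsilon> * (int CARD('k) - 1) * int CARD('k) ^ r"
  shows "int (card {v. L (Q v) = 0}) = int q * (int q ^ r')\<^sup>2 + \<epsilon> * (int q - 1) * int q ^ r'"
proof -
  define n T k T' where "n = int CARD('k)" and "T = n ^ r" and "k = int q ^ (w - 1)" and "T' = int q ^ r'"
  have q1: "int q > 0" using q_gt_1 by simp
  have qw: "q ^ w = q * q ^ (w - 1)" using w_pos by (cases w) auto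
  have n: "n = int q * k" unfolding n_def k_def card_k qw by simp
  have "int q * T' = int q ^ Suc r'" by (simp add: T'_def)
  also have "\<dots> = n ^ Suc r"
    unfolding r' mult.commute[of "Suc r" w] power_mult by (simp only: n_def card_k of_nat_power)
  also have "\<dots> = n * T" by (simp add: T_def)
  finally have T': "T' = k * T" using n q1 by simp
  have val: "int (card {v. Q v = a}) = n * T\<^sup>2 - \<epsilon> * T" if "a \<noteq> 0" for a
    unfolding n_def
  proof (rule K.card_nonzero_value[OF Q nd _ \<epsilon> _ that])
    show "int (card (UNIV :: 'v set)) = (int CARD('k) * T)\<^sup>2"
      by (simp add: K.card_V d T_def n_def power2_eq_square power_add mult_2)
    show "int (card {v. Q v = 0}) = int CARD('k) * T\<^sup>2 + \<epsilon> * (int CARD('k) - 1) * T"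
      using Z by (simp add: T_def n_def)
  qed
  have "q * card {x. L x = 0} = q * q ^ (w - 1)" using card_L_fiber[of 0] qw by simp
  then have kerL: "int (card {x. L x = 0}) = k" using q_gt_1 by (simp add: k_def)
  have "int (card {v. L (Q v) = 0})
      = int (card {v. Q v = 0}) + (\<Sum>a\<in>{a. L a = 0} - {0}. int (card {v. Q v = a}))"
    unfolding card_zeros_L by (subst sum.remove[of _ 0]) auto
  also have "(\<Sum>a\<in>{a. L a = 0} - {0}. int (card {v. Q v = a})) = (\<Sum>a\<in>{a. L a = 0} - {0}. n * T\<^sup>2 - \<epsilon> * T)"
    by (intro sum.cong refl val) auto
  also have "\<dots> = (k - 1) * (n * T\<^sup>2 - \<epsilon> * T)"
  proof -
    have "card ({a. L a = 0} - {0}) = card {x. L x = 0} - 1" by (simp add: card_Diff_singleton)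
    moreover have "card {x. L x = 0} > 0" using L_0 by (auto simp: card_gt_0_iff intro!: exI[of _ 0])
    ultimately have "int (card ({a. L a = 0} - {0})) = k - 1" using kerL by linarith
    then show ?thesis by simp
  qed
  finally have "int (card {v. L (Q v) = 0}) = n * T\<^sup>2 + \<epsilon> * (n - 1) * T + (k - 1) * (n * T\<^sup>2 - \<epsilon> * T)"
    using Z by (simp add: n_def T_def)
  also have "\<dots> = int q * T'\<^sup>2 + \<epsilon> * (int q - 1) * T'"
    unfolding T' n by (simp add: algebra_simps power2_eq_square)
  finally show ?thesis by (simp add: T'_def)
qed

lemma type_O_plus_L:
  assumes "type_O_plus s Q" "K.dim UNIV > 0" shows "type_O_plus sq (L \<circ> Q)"
proof -
  have "even (K.dim UNIV)" using assms by (simp add: type_O_plus_def)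
  then obtain R where R: "K.dim UNIV = 2 * R" by (elim evenE)
  then obtain r where d: "K.dim UNIV = 2 * Suc r" using assms by (cases R) auto
  obtain r' where r': "F.dim UNIV = 2 * Suc r'" "Suc r' = Suc r * w"
    using half_dim_sq[of "Suc r * w"] assms dim_sq d by auto
  show ?thesis
    unfolding F.type_O_plus_iff[OF quadratic_form_L polar_nondegenerate_L r'(1), simplified]
    using zero_count_L[OF d r'(2), of 1] assms(1)
    by (simp add: K.type_O_plus_iff[OF Q nd d] card_f)
qed

lemma type_O_minus_L:
  assumes "type_O_minus s Q" "K.dim UNIV > 0" shows "type_O_minus sq (L \<circ> Q)"
proof -
  have "even (K.dim UNIV)" using assms by (simp add: type_O_minus_def)
  then obtain R where R: "K.dim UNIV = 2 * R" by (elim evenE)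
  then obtain r where d: "K.dim UNIV = 2 * Suc r" using assms by (cases R) auto
  obtain r' where r': "F.dim UNIV = 2 * Suc r'" "Suc r' = Suc r * w"
    using half_dim_sq[of "Suc r * w"] assms dim_sq d by auto
  show ?thesis
    unfolding F.type_O_minus_iff[OF quadratic_form_L polar_nondegenerate_L r'(1), simplified]
    using zero_count_L[OF d r'(2), of "-1"] assms(1)
    by (simp add: K.type_O_minus_iff[OF Q nd d] card_f left_diff_distrib)
qed

lemma qf_nondegenerate_L: "qf_nondegenerate (L \<circ> Q)"
  using F.qf_nondegenerate_if_polar[OF quadratic_form_L polar_nondegenerate_L] by blast

lemma type_O_L:
  assumes "type_O s Q" "odd w" shows "type_O sq (L \<circ> Q)"
  using assms qf_nondegenerate_L quadratic_form_L by (simp add: type_O_def dim_sq)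

end

end

end

section \<open>Reduction of the zero count to the perp of a totally singular subspace\<close>

context finite_vector_space begin

text \<open>The perp modulo \<open>W\<close> carries a form on a space of dimension
  \<open>2 * h\<close>; the sign \<epsilon> of its zero count passes to the whole space. For
  \<open>h = 0\<close> and \<epsilon> = 1 the assumptions describe a \<open>W\<close> that is its
  own perp.\<close>

lemma zero_count_from_perp:
  fixes \<epsilon> :: int
  assumes Q: "quadratic_form scale Q" and nd: "\<And>w. (\<And>v. polar Q v w = 0) \<Longrightarrow> w = 0"
    and d: "dim (UNIV :: 'v set) = 2 * Suc r" and W: "totally_singular scale Q W"
    and P: "card (left_perp (polar Q) W) = card W * CARD('k) ^ (2 * h)"
    and Z: "int CARD('k) * int (card {v \<in> left_perp (polar Q) W. Q v = 0})
      = int (card W) * (int CARD('k) ^ (2 * h) + \<epsilon> * (int CARD('k) - 1) * int CARD('k) ^ h)"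
  shows "int (card {v. Q v = 0})
    = int CARD('k) * (int CARD('k) ^ r)\<^sup>2 + \<epsilon> * (int CARD('k) - 1) * int CARD('k) ^ r"
proof -
  define n where "n = int CARD('k)"
  have n: "n > 1" using card_pos_field[where 'a='k] by (simp add: n_def)
  have sW: "subspace W" using W by (simp add: totally_singular_def)
  have "card (left_perp (polar Q) W) * card W = card (UNIV :: 'v set)"
    by (rule card_left_perp_nondegenerate[OF polar_sesq[OF Q] sW nd])
  then have "(card W * CARD('k) ^ h)\<^sup>2 = (CARD('k) ^ Suc r)\<^sup>2"
    unfolding P card_V d by (simp add: power2_eq_square mult_2 mult_2_right power_add ac_simps)
  then have "card W * CARD('k) ^ h = CARD('k) ^ Suc r" by (rule power2_eq_imp_eq) auto
  then have "int (card W * CARD('k) ^ h) = int (CARD('k) ^ Suc r)" by (simp only:)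
  then have Wh: "int (card W) * n ^ h = n ^ Suc r" by (simp add: n_def)
  have "n * int (card {v. Q v = 0})
      = n ^ (2 * Suc r) - int (card W) * n ^ (2 * h) + int (card W) * (n ^ (2 * h) + \<epsilon> * (n - 1) * n ^ h)"
    using card_zeros[OF Q W] Z P card_V d by (simp add: n_def)
  also have "\<dots> = n ^ (2 * Suc r) + \<epsilon> * (n - 1) * (int (card W) * n ^ h)"
    by (simp add: algebra_simps)
  also have "\<dots> = n * (n * (n ^ r)\<^sup>2 + \<epsilon> * (n - 1) * n ^ r)"
    unfolding Wh by (simp add: power2_eq_square mult_2 mult_2_right power_add algebra_simps)
  finally show ?thesis using n unfolding n_def by simp
qed

lemma totally_singular_subset_perp:
  assumes "totally_singular scale Q W" shows "W \<subseteq> left_perp (polar Q) W"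
  using assms subspace_add by (auto simp: left_perp_def polar_def totally_singular_def)

end

subsection \<open>The form \<open>x \<mapsto> L (\<gamma> x\<^sup>2)\<close>\<close>

text \<open>Euler's criterion in counting form; \<open>N\<close> is half the order of the
  multiplicative group.\<close>

lemma card_square_roots:
  fixes y :: "'k::{finite,field}"
  assumes N: "CARD('k) - 1 = N * 2" and y: "y \<noteq> 0"
  shows "card {x. x\<^sup>2 = y} = (if y ^ N = 1 then 2 else 0)"
proof (cases "y ^ N = 1")
  case True
  then show ?thesis using card_power_fiber[OF N True] by simp
next
  case False
  have "x\<^sup>2 \<noteq> y" for x
  proof
    assume x: "x\<^sup>2 = y"
    then have "y ^ N = (x\<^sup>2) ^ N" by simp
    then have "y ^ N = x ^ (CARD('k) - 1)" by (simp only: N power_mult[symmetric] mult.commute)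
    moreover have "x \<noteq> 0" using x y by auto
    ultimately show False using False finite_field_power_card_minus_one by metis
  qed
  then show ?thesis using False by simp
qed

lemma half_power_eq_pm1:
  fixes y :: "'k::{finite,field}"
  assumes N: "CARD('k) - 1 = N * 2" and y: "y \<noteq> 0"
  shows "y ^ N = 1 \<or> y ^ N = -1"
proof -
  have "(y ^ N)\<^sup>2 = 1" using finite_field_power_card_minus_one[OF y] N by (simp add: power_mult)
  then show ?thesis by (simp add: power2_eq_1_iff)
qed

lemma ex_nonsquare:
  assumes N: "CARD('k::{finite,field}) - 1 = N * 2"
  shows "\<exists>\<nu>::'k. \<nu> \<noteq> 0 \<and> \<nu> ^ N = -1"
proof -
  have "N > 0" using N card_pos_field[where 'a='k] by (auto intro: gr0I)
  have "card {x::'k. x ^ N = 1} < card (UNIV - {0::'k})"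
    using card_roots_of_unity[OF N] N \<open>N > 0\<close> by (simp add: card_Diff_singleton)
  then obtain \<nu> :: 'k where "\<nu> \<in> UNIV - {0}" "\<nu> \<notin> {x. x ^ N = 1}"
    by (meson card_mono finite less_le_not_le subsetI)
  then show ?thesis using half_power_eq_pm1[OF N] by blast
qed

context traced_extension begin

lemma finite_vector_space_extension: "finite_vector_space (\<lambda>c x. \<iota> c * x :: 'k)"
  by unfold_locales (simp_all add: \<iota>_simps algebra_simps)

text \<open>The conjugates with exponents \<open>q ^ (h + i)\<close> are the negatives of those with
  exponents \<open>q ^ i\<close>, so the two halves of the sum cancel.\<close>

lemma trace_eq_0_if_antifixed:
  assumes w: "w = 2 * h" and z: "z ^ (q ^ h) = - (z::'k)" shows "(\<Sum>i<w. z ^ (q ^ i)) = 0"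
proof -
  have neg: "(- z) ^ (q ^ i) = - (z ^ (q ^ i))" for i
    using power_q_power_add[of "- z" z i] q_gt_1 by (simp add: eq_neg_iff_add_eq_0 power_0_left)
  have "(\<Sum>i<w. z ^ (q ^ i)) = (\<Sum>i<h. z ^ (q ^ i)) + (\<Sum>i<h. z ^ (q ^ (h + i)))"
  proof -
    have "(\<Sum>i<a+b. z ^ (q ^ i)) = (\<Sum>i<a. z ^ (q ^ i)) + (\<Sum>i<b. z ^ (q ^ (a + i)))" for a b
      by (induction b) (auto simp: add.assoc)
    then show ?thesis by (simp only: w mult_2)
  qed
  also have "(\<Sum>i<h. z ^ (q ^ (h + i))) = (\<Sum>i<h. - (z ^ (q ^ i)))"
    by (simp add: power_add power_mult z neg)
  finally show ?thesis by (simp add: sum_negf)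
qed

context
  fixes h m N
  assumes odd_q: "odd q" and w: "w = 2 * h" and m: "m = q ^ h" and N: "CARD('k) - 1 = N * 2"
begin

lemma card_k_m: "CARD('k) = m\<^sup>2" by (simp add: card_k w m power_mult mult.commute)

lemma m_facts: "odd m" "m > 1" "h > 0"
proof -
  show "h > 0" using w w_pos by simp
  then show "m > 1" unfolding m using q_gt_1 by (intro one_less_power)
  show "odd m" using odd_q by (simp add: m)
qed

lemma card_k_minus_one: "CARD('k) - 1 = (m - 1) * (m + 1)"
proof -
  have "(m - 1) * (m + 1) + 1 = m\<^sup>2"
    using m_facts(2) by (cases m) (auto simp: power2_eq_square)
  then show ?thesis using card_k_m by simp
qed

text \<open>Both \<open>m - 1\<close> and \<open>m + 1\<close> are even. The first factorization
  serves powers of \<open>\<delta> ^ (m - 1)\<close>, the second those of the norm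
  \<open>\<delta> ^ (m + 1)\<close>.\<close>

lemma N_eq: "N = (m - 1) * ((m + 1) div 2)" "N = (m - 1) div 2 * (m + 1)"
proof -
  have e: "even (m + 1)" "even (m - 1)" using m_facts by auto
  have "2 * N = (m - 1) * (m + 1)" using N card_k_minus_one by simp
  moreover have "(m - 1) * (m + 1) = 2 * ((m - 1) * ((m + 1) div 2))"
    using e(1) by (metis dvd_mult_div_cancel mult.left_commute)
  moreover have "(m - 1) * (m + 1) = 2 * ((m - 1) div 2 * (m + 1))"
    using e(2) by (metis dvd_mult_div_cancel mult.assoc)
  ultimately show "N = (m - 1) * ((m + 1) div 2)" "N = (m - 1) div 2 * (m + 1)" by linarith+
qed

lemma two_nonzero: "(2::'k) \<noteq> 0" "(2::'f) \<noteq> 0" "(1::'k) \<noteq> -1"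
proof -
  show "(2::'f) \<noteq> 0" using odd_q two_eq_0_iff_even_card[where 'a='f] card_f by simp
  have "odd CARD('k)" using m_facts card_k_m by simp
  then show two: "(2::'k) \<noteq> 0" using two_eq_0_iff_even_card[where 'a='k] by simp
  show "(1::'k) \<noteq> -1"
  proof
    assume "(1::'k) = -1"
    then have "(1::'k) + 1 = 0" by (metis add.right_inverse)
    then show False using two by simp
  qed
qed

lemma card_M: "card {y::'k. y ^ m = y} = m"
proof -
  have "{y::'k. y ^ m = y} = insert 0 {y. y ^ (m - 1) = 1}"
  proof -
    have "y ^ m = y ^ (m - 1) * y" for y :: 'k using m_facts(2) power_minus_mult[of m y] by simp
    then show ?thesis by auto
  qed
  moreover have "(0::'k) \<notin> {y. y ^ (m - 1) = 1}" using m_facts(2) by (simp add: power_0_left)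
  ultimately show ?thesis using card_roots_of_unity[OF card_k_minus_one] m_facts(2) by simp
qed

text \<open>\<open>x0\<close> has to make \<open>\<delta> * (x0 * y)\<^sup>2\<close> change sign
  under the power \<open>m\<close> for all \<open>y\<close> in GF(m), that is,
  \<open>x0 ^ (2 * (m - 1)) = - inverse (\<delta> ^ (m - 1))\<close>. By \<chi> the power
  \<open>(m + 1) div 2\<close> of the right-hand side is 1, which makes this solvable. The resulting
  GF(m)-line has \<open>m\<close> elements in a space of \<open>m\<^sup>2\<close>, so it is its own
  perp.\<close>

lemma card_trace_square_plus:
  assumes \<gamma>: "\<gamma> \<noteq> 0" and \<chi>: "(\<alpha> * \<gamma>) ^ N = (-1) ^ ((m + 1) div 2)"
  shows "int q * int (card {x. L (\<gamma> * x\<^sup>2) = 0}) = int q ^ (2 * h) + (int q - 1) * int q ^ h"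
proof -
  define sc where "sc = (\<lambda>c x. \<iota> c * x :: 'k)"
  interpret E: finite_vector_space sc unfolding sc_def by (rule finite_vector_space_extension)
  define Q where "Q = (\<lambda>x. L (\<gamma> * x\<^sup>2))"
  define \<delta> where "\<delta> = \<alpha> * \<gamma>"
  have \<delta>0: "\<delta> \<noteq> 0" using \<gamma> \<alpha>_nonzero by (simp add: \<delta>_def)
  have pol: "polar Q x y = L (2 * \<gamma> * x * y)" for x y
  proof -
    have "\<gamma> * (x + y)\<^sup>2 - \<gamma> * x\<^sup>2 - \<gamma> * y\<^sup>2 = 2 * \<gamma> * x * y" by algebra
    then show ?thesis by (simp add: polar_def Q_def L_diff[symmetric])
  qed
  have Q: "quadratic_form sc Q"
  proof -
    have "Q (sc c x) = c\<^sup>2 * Q x" for c x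
      using L_scale[of "c\<^sup>2" "\<gamma> * x\<^sup>2"] by (simp add: Q_def sc_def \<iota>_simps(7) power_mult_distrib ac_simps)
    moreover have "L (2 * \<gamma> * sc c x * sc d y) = c * d * L (2 * \<gamma> * x * y)" for c d x y
      using L_scale[of "c * d" "2 * \<gamma> * x * y"] by (simp add: sc_def \<iota>_simps(4) ac_simps)
    ultimately show ?thesis
      unfolding E.quadratic_form_iff sesquilinear_form_def
      by (simp add: pol E.field_auto_id distrib_left distrib_right L_add)
  qed
  have nd: "y = 0" if "\<And>x. polar Q x y = 0" for y
  proof -
    have "L (x * (2 * \<gamma> * y)) = 0" for x using that[of x] by (simp add: pol ac_simps)
    then have "2 * \<gamma> * y = 0" using L_eq_0_iff by blast
    then show ?thesis using \<gamma> two_nonzero by simp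
  qed
  have "CARD('k) - 1 = (m + 1) div 2 * (2 * (m - 1))"
    using N N_eq(1) by simp
  moreover have "(- inverse (\<delta> ^ (m - 1))) ^ ((m + 1) div 2) = 1"
  proof -
    have "(\<delta> ^ (m - 1)) ^ ((m + 1) div 2) = (-1) ^ ((m + 1) div 2)"
      using \<chi> by (simp add: \<delta>_def N_eq(1) flip: power_mult)
    then show ?thesis
      unfolding power_minus[of "inverse _"] power_inverse by (simp flip: power_inverse power_mult_distrib)
  qed
  ultimately obtain x0 where x0: "x0 \<noteq> 0" "x0 ^ (2 * (m - 1)) = - inverse (\<delta> ^ (m - 1))"
    using ex_power_eq by blast
  define W where "W = (\<lambda>y. x0 * y) ` {y::'k. y ^ m = y}"
  have cW: "card W = m"
    unfolding W_def using x0 card_M by (subst card_image) (auto simp: inj_on_def)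
  have pm: "y ^ m = y ^ (m - 1) * y" for y :: 'k using m_facts(2) power_minus_mult[of m y] by simp
  have QW: "Q (x0 * y) = 0" if y: "y ^ m = y" for y
  proof -
    let ?z = "\<delta> * (x0 * y)\<^sup>2"
    have "((x0 * y)\<^sup>2) ^ m = ((x0 * y) ^ m)\<^sup>2" by (simp only: power_mult[symmetric] mult.commute)
    also have "\<dots> = (x0 ^ m * y)\<^sup>2" by (simp only: power_mult_distrib y)
    finally have "?z ^ m = \<delta> ^ m * (x0 ^ m * y)\<^sup>2" by (simp only: power_mult_distrib[of \<delta>])
    also have "\<dots> = (\<delta> ^ (m - 1) * (x0 ^ (m - 1))\<^sup>2) * ?z"
      unfolding pm[of \<delta>] pm[of x0] by (simp add: power2_eq_square)
    also have "(x0 ^ (m - 1))\<^sup>2 = x0 ^ (2 * (m - 1))" by (simp only: power_mult[symmetric] mult.commute)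
    also have "\<delta> ^ (m - 1) * x0 ^ (2 * (m - 1)) = -1" unfolding x0(2) using \<delta>0 by simp
    also have "-1 * ?z = - ?z" by simp
    finally have "(\<Sum>i<w. ?z ^ (q ^ i)) = 0" by (intro trace_eq_0_if_antifixed[OF w]) (simp only: m)
    then have "\<iota> (Q (x0 * y)) = \<iota> 0" unfolding Q_def \<iota>_L \<iota>_simps(1) by (simp add: \<delta>_def mult.assoc)
    then show ?thesis by (simp only: \<iota>_eq_iff)
  qed
  have padd: "(x + y) ^ m = x ^ m + y ^ m" for x y :: 'k unfolding m by (rule power_q_power_add)
  have ts: "totally_singular sc Q W"
  proof -
    have "E.subspace W"
    proof (rule E.subspaceI)
      show "0 \<in> W" using m_facts(2) by (auto simp: W_def image_iff intro!: exI[of _ 0])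
      show "x + y \<in> W" if "x \<in> W" "y \<in> W" for x y
        using that padd unfolding W_def by (auto simp flip: distrib_left)
      show "sc c x \<in> W" if "x \<in> W" for c x
      proof -
        obtain y where y: "y ^ m = y" "x = x0 * y" using \<open>x \<in> W\<close> by (auto simp: W_def)
        then have "(\<iota> c * y) ^ m = \<iota> c * y" by (simp add: power_mult_distrib m \<iota>_power_q_power)
        then show ?thesis using y by (auto simp: W_def sc_def image_iff ac_simps intro!: exI[of _ "\<iota> c * y"])
      qed
    qed
    then show ?thesis using QW by (auto simp: totally_singular_def W_def)
  qed
  have "card (left_perp (polar Q) W) * m = m\<^sup>2"
    using E.card_left_perp_nondegenerate[OF E.polar_sesq[OF Q] _ nd, of W] ts cW card_k_m
    by (simp add: totally_singular_def)
  then have cP: "card (left_perp (polar Q) W) = m" using m_facts(2) by (simp add: power2_eq_square)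
  have PW: "W = left_perp (polar Q) W"
    using E.totally_singular_subset_perp[OF ts] cP cW by (intro card_subset_eq) auto
  have "{v \<in> left_perp (polar Q) W. Q v = 0} = W"
    unfolding PW[symmetric] using ts by (auto simp: totally_singular_def)
  then have "int q * int (card {v. Q v = 0}) = int (m\<^sup>2) - int m + int q * int m"
    using E.card_zeros[OF Q ts] cP cW by (simp add: card_k_m card_f)
  then show ?thesis by (simp add: Q_def m power_mult mult.commute algebra_simps)
qed

lemma card_trace_square_minus:
  assumes \<gamma>: "\<gamma> \<noteq> 0" and \<chi>: "(\<alpha> * \<gamma>) ^ N \<noteq> (-1) ^ ((m + 1) div 2)"
  shows "int q * int (card {x. L (\<gamma> * x\<^sup>2) = 0}) = int q ^ (2 * h) - (int q - 1) * int q ^ h"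
proof -
  obtain \<nu> :: 'k where \<nu>: "\<nu> \<noteq> 0" "\<nu> ^ N = -1" using ex_nonsquare[OF N] by blast
  have pm: "(\<alpha> * \<gamma>) ^ N = 1 \<or> (\<alpha> * \<gamma>) ^ N = -1"
    using half_power_eq_pm1[OF N] \<alpha>_nonzero \<gamma> by simp
  have "(\<alpha> * (\<gamma> * \<nu>)) ^ N = - ((\<alpha> * \<gamma>) ^ N)" using \<nu> by (simp add: power_mult_distrib)
  also have "\<dots> = (-1) ^ ((m + 1) div 2)"
    using pm \<chi> by (cases "even ((m + 1) div 2)") auto
  finally have plus: "int q * int (card {x. L (\<gamma> * \<nu> * x\<^sup>2) = 0}) = int q ^ (2 * h) + (int q - 1) * int q ^ h"
    using \<gamma> \<nu> by (intro card_trace_square_plus) auto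
  have count: "card {x. L (\<kappa> * x\<^sup>2) = 0} = (\<Sum>b\<in>{b. L b = 0}. card {x. x\<^sup>2 = b / \<kappa>})"
    if "\<kappa> \<noteq> 0" for \<kappa>
  proof -
    have "{x. L (\<kappa> * x\<^sup>2) = 0} = (\<Union>b\<in>{b. L b = 0}. {x. x\<^sup>2 = b / \<kappa>})"
      using that by (auto simp: field_simps)
    then show ?thesis by (simp only:) (subst card_UN_disjoint, use that in auto)
  qed
  \<comment> \<open>For nonzero \<open>b\<close> exactly one of the two quotients is a square, with
    two roots; for \<open>b = 0\<close> each equation has the single root 0.\<close>
  have "card {x. x\<^sup>2 = b / \<gamma>} + card {x. x\<^sup>2 = b / (\<gamma> * \<nu>)} = 2" for b
  proof (cases "b = 0")
    case False
    have "(b / (\<gamma> * \<nu>)) ^ N = - ((b / \<gamma>) ^ N)" using \<nu> by (simp add: power_divide power_mult_distrib)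
    then show ?thesis
      using half_power_eq_pm1[OF N, of "b / \<gamma>"] two_nonzero(3) False \<gamma> \<nu>
      by (auto simp: card_square_roots[OF N])
  qed simp
  then have "card {x. L (\<gamma> * x\<^sup>2) = 0} + card {x. L (\<gamma> * \<nu> * x\<^sup>2) = 0} = 2 * card {b. L b = 0}"
    using \<gamma> \<nu> by (simp add: count flip: sum.distrib)
  then have "int q * int (card {x. L (\<gamma> * x\<^sup>2) = 0}) + int q * int (card {x. L (\<gamma> * \<nu> * x\<^sup>2) = 0})
      = 2 * int (q * card {b. L b = 0})" by (simp flip: of_nat_add distrib_left)
  also have "int (q * card {b. L b = 0}) = int q ^ (2 * h)"
    by (simp only: card_L_fiber) (simp add: w)
  finally show ?thesis using plus by linarith
qed

end

end

section \<open>The germ condition as a power of \<delta>\<close>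

lemma alternating_factor_odd:
  fixes q :: nat
  assumes "odd q" shows "\<exists>t. odd t \<and> q ^ (2 * j + 1) + 1 = (q + 1) * t"
proof (induction j)
  case (Suc j)
  then obtain t where t: "odd t" "q ^ (2 * j + 1) + 1 = (q + 1) * t" by blast
  have "t > 0" "q > 0" using t(1) assms by (auto intro: gr0I)
  then have le: "q - 1 \<le> q\<^sup>2 * t"
    by (metis One_nat_def Suc_leI diff_le_self le_trans mult_le_mono mult.right_neutral power2_nat_le_imp_le power2_eq_square self_le_power zero_less_numeral)
  \<comment> \<open>The cofactor is the alternating sum q^(2j) - q^(2j-1) + ... + 1 of an odd number
    of odd terms; it passes from \<open>j\<close> to \<open>Suc j\<close> by t \<mapsto> q^2 t - (q
    - 1).\<close>
  have "int (q ^ (2 * Suc j + 1) + 1) = int q ^ 2 * (int (q ^ (2 * j + 1) + 1)) - (int q ^ 2 - 1)"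
    by (simp add: algebra_simps power2_eq_square)
  also have "\<dots> = (int q + 1) * (int q ^ 2 * int t - (int q - 1))"
    unfolding t(2) by (simp add: algebra_simps power2_eq_square)
  also have "int q ^ 2 * int t - (int q - 1) = int (q\<^sup>2 * t - (q - 1))"
    using le \<open>q > 0\<close> by (simp add: of_nat_diff)
  also have "(int q + 1) * int (q\<^sup>2 * t - (q - 1)) = int ((q + 1) * (q\<^sup>2 * t - (q - 1)))"
    by (simp only: of_nat_mult of_nat_add of_nat_1)
  finally have "q ^ (2 * Suc j + 1) + 1 = (q + 1) * (q\<^sup>2 * t - (q - 1))" by (simp only: of_nat_eq_iff)
  moreover have "odd (q\<^sup>2 * t - (q - 1))" using assms t(1) le by simp
  ultimately show ?case by blast
qed (auto intro: exI[of _ 1])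

context traced_extension begin

context
  fixes h m N :: nat and \<delta> :: 'k and M SqM :: "'k set"
  assumes odd_q: "odd q" and w: "w = 2 * h" and m: "m = q ^ h" and N: "CARD('k) - 1 = N * 2"
    and M: "M = subfield_of_order m" and SqM: "SqM = nonzero_squares M" and \<delta>: "\<delta> \<noteq> 0"
begin

lemmas m_facts' = m_facts[OF odd_q w m N] and N_eq' = N_eq[OF odd_q w m N]
  and two_nonzero' = two_nonzero[OF odd_q w m N]

lemma m_half: "m - 1 = 2 * ((m - 1) div 2)" "(m + 1) div 2 = (m - 1) div 2 + 1"
  using m_facts'(1,2) by (auto elim!: oddE)

lemma mem_M_iff:
  assumes "y \<noteq> 0" shows "y \<in> M \<longleftrightarrow> y ^ (m - 1) = 1"
proof -
  have "y ^ m = y ^ (m - 1) * y" using m_facts'(2) power_minus_mult[of m y] by simp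
  then show ?thesis using assms by (simp add: M subfield_of_order_def)
qed

text \<open>Euler's criterion inside \<open>M\<close>: the power condition makes \<open>y\<close> a
  square in the large field, and its root \<open>x\<close> then satisfies
  \<open>x ^ (m - 1) = 1\<close>, hence lies in \<open>M\<close>.\<close>

lemma mem_SqM_iff: "y \<in> SqM \<longleftrightarrow> y ^ ((m - 1) div 2) = 1"
proof
  assume "y \<in> SqM"
  then obtain x where x: "x \<in> M" "x \<noteq> 0" "y = x\<^sup>2" by (auto simp: SqM nonzero_squares_def)
  have "y ^ ((m - 1) div 2) = x ^ (m - 1)" unfolding x(3) by (subst (2) m_half(1)) (rule power_mult[symmetric])
  then show "y ^ ((m - 1) div 2) = 1" using x mem_M_iff by simp
next
  assume y: "y ^ ((m - 1) div 2) = 1"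
  then have "y ^ N = 1" unfolding N_eq'(2) power_mult by simp
  then obtain x where x: "x \<noteq> 0" "x\<^sup>2 = y" using ex_power_eq[OF N] by blast
  have "x ^ (m - 1) = 1" by (subst m_half(1)) (simp only: power_mult x(2) y)
  then show "y \<in> SqM" using x mem_M_iff[OF x(1)] by (auto simp: SqM nonzero_squares_def)
qed

lemma mult_cong_minus_one_iff: "mult_cong SqM D (-1) \<longleftrightarrow> (- D) ^ ((m - 1) div 2) = 1"
  by (simp add: mult_cong_def mem_SqM_iff)

text \<open>Membership in \<open>M\<close> makes the square of \<open>\<delta> ^ (m - 1)\<close>
  equal to 1, and being a nonsquare excludes \<open>\<delta> ^ (m - 1) = 1\<close>; the value -1 is
  then raised to the power \<open>(m + 1) div 2\<close>.\<close>

lemma germ_condition_inverse_square: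
  assumes "inverse \<delta> ^ 2 \<in> M - SqM"
  shows "\<delta> ^ N = (-1) ^ ((m + 1) div 2)"
proof -
  have y0: "inverse \<delta> ^ 2 \<noteq> 0" using \<delta> by simp
  have "(inverse \<delta> ^ 2) ^ (m - 1) = 1" using assms mem_M_iff[OF y0] by simp
  then have "(inverse (\<delta> ^ (m - 1)))\<^sup>2 = 1"
    by (simp add: power_inverse mult.commute flip: power_mult)
  moreover have "(inverse x)\<^sup>2 = 1 \<Longrightarrow> x = 1 \<or> x = -1" for x :: 'k
    unfolding power2_eq_1_iff by (metis inverse_inverse_eq inverse_minus_eq inverse_1)
  ultimately have pm: "\<delta> ^ (m - 1) = 1 \<or> \<delta> ^ (m - 1) = -1" by blast
  have "(inverse \<delta> ^ 2) ^ ((m - 1) div 2) = inverse (\<delta> ^ (m - 1))"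
    by (subst (2) m_half(1)) (simp add: power_inverse flip: power_mult)
  then have "\<delta> ^ (m - 1) \<noteq> 1" using assms by (auto simp: mem_SqM_iff)
  then have z: "\<delta> ^ (m - 1) = -1" using pm by simp
  show ?thesis unfolding N_eq'(1) power_mult z ..
qed

text \<open>For \<open>e = q + 1\<close> and odd \<open>h\<close>, \<open>m + 1\<close> is an odd multiple of \<open>e\<close>, which reduces to \<open>e = m + 1\<close>. For even
  \<open>h\<close>, the element \<open>z = \<delta>\<^bsup>m-1\<^esup>\<close> satisfies \<open>z\<^sup>q = z\<^bsup>-1\<^esup>\<close>, hence \<open>z\<^sup>m = z\<close> and \<open>z\<^sup>2 = 1\<close>.\<close>

lemma germ_condition:
  assumes e: "e \<in> {q + 1, q ^ (w div 2) + 1}"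
  shows "(\<delta> ^ e \<in> M \<and> \<not> mult_cong SqM (\<delta> ^ e) (-1) \<longrightarrow> \<delta> ^ N = (-1) ^ ((m + 1) div 2)) \<and>
    (inverse \<delta> ^ 2 \<notin> M - SqM \<and> mult_cong SqM (\<delta> ^ e) (-1) \<longrightarrow> \<delta> ^ N \<noteq> (-1) ^ ((m + 1) div 2))"
proof (cases "\<delta> ^ e \<in> M \<or> mult_cong SqM (\<delta> ^ e) (-1)")
  case False
  then show ?thesis by blast
next
  case True
  define H where "H = (m - 1) div 2"
  note mH = m_half[folded H_def]
  note NH = N_eq'(2)[folded H_def]
  note neq = two_nonzero'(3)
  let ?D = "\<delta> ^ e"
  have D2: "((- ?D) ^ H)\<^sup>2 = ?D ^ (m - 1)" unfolding mH(1) by (simp add: mult.commute flip: power_mult)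
  \<comment> \<open>Congruence to -1 also puts \<open>?D\<close> into \<open>M\<close>, so either
    alternative gives this equation. Without both of them the two implications are vacuous.\<close>
  have D1: "?D ^ (m - 1) = 1"
    using True mem_M_iff[of ?D] \<delta> D2 mult_cong_minus_one_iff[of ?D, folded H_def] by auto
  then have pm: "(- ?D) ^ H = 1 \<or> (- ?D) ^ H = -1" using D2 by (simp add: power2_eq_1_iff)
  \<comment> \<open>As \<open>(m + 1) div 2 = H + 1\<close>, this equation makes congruence to -1
    the exact failure of \<open>\<delta> ^ N = (-1) ^ ((m + 1) div 2)\<close>.\<close>
  have eq_if: "?thesis" if "(- ?D) ^ H = (-1) ^ H * \<delta> ^ N"
    using that pm neq unfolding mult_cong_minus_one_iff H_def[symmetric] mH(2)
    by (cases "even H") (auto simp: equation_minus_iff)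
  consider "e = m + 1" | "e = q + 1" "odd h" | "e = q + 1" "even h" using e m w by auto
  then show ?thesis
  proof cases
    case 1
    have "(- ?D) ^ H = (-1) ^ H * \<delta> ^ N"
      unfolding NH 1 power_minus[of "_ ^ _"] by (simp only: mult.commute[of H] power_mult)
    then show ?thesis by (rule eq_if)
  next
    case 2
    then obtain j where "h = 2 * j + 1" by (elim oddE)
    then obtain t where t: "odd t" "m + 1 = e * t" using alternating_factor_odd[OF odd_q, of j] m 2 by auto
    \<comment> \<open>An odd power \<open>t\<close> leaves the sign \<open>(- ?D) ^ H\<close>
      unchanged and turns \<open>\<delta> ^ e\<close> into the norm
      \<open>\<delta> ^ (m + 1)\<close>.\<close>
    have "((- ?D) ^ H) ^ t = ((- ?D) ^ t) ^ H" by (simp add: mult.commute flip: power_mult)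
    also have "(- ?D) ^ t = - (\<delta> ^ (m + 1))" using t by (simp add: power_mult)
    also have "(- (\<delta> ^ (m + 1))) ^ H = (-1) ^ H * \<delta> ^ N"
      unfolding NH power_minus[of "_ ^ _"] by (simp only: mult.commute[of H] power_mult)
    also have "((- ?D) ^ H) ^ t = (- ?D) ^ H" using pm t(1) by auto
    finally show ?thesis by (rule eq_if)
  next
    case 3
    then obtain j where j: "h = 2 * j" by (elim evenE)
    define z where "z = \<delta> ^ (m - 1)"
    have "z ^ e = ?D ^ (m - 1)" by (simp only: z_def power_mult[symmetric] mult.commute)
    then have zq: "z ^ q * z = 1" using D1 3(1) by (simp add: mult.commute)
    have z0: "z \<noteq> 0" using \<delta> by (simp add: z_def)
    then have zq': "z ^ q = inverse z" using zq by (simp add: field_simps)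
    have "z ^ (q * q) = z" unfolding power_mult zq' by (simp add: zq' power_inverse)
    then have "z ^ ((q * q) ^ i) = z" for i by (induction i) (simp_all add: power_mult)
    then have "z ^ m = z" by (simp add: m j power_mult power2_eq_square)
    moreover have "z ^ (m + 1) = 1"
      using finite_field_power_card_minus_one[OF \<delta>]
      by (simp only: z_def card_k_minus_one[OF odd_q w m N] power_mult)
    then have "z ^ m * z = 1" by (simp add: mult.commute)
    ultimately have "z\<^sup>2 = 1" by (simp add: power2_eq_square)
    then have z: "z = 1 \<or> z = -1" by (simp add: power2_eq_1_iff)
    \<comment> \<open>\<open>m\<close> is the square of an odd number, hence 1 modulo 4.\<close>
    have "even H"
    proof -
      have "odd (q ^ j)" using odd_q by simp
      then obtain r where r: "q ^ j = 2 * r + 1" by (elim oddE)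
      have "m = (q ^ j)\<^sup>2" unfolding m j by (simp add: mult.commute flip: power_mult)
      also have "\<dots> = 4 * (r * r + r) + 1" unfolding r by (simp add: power2_eq_square)
      finally have "H = 2 * (r * r + r)" by (simp add: H_def)
      then show ?thesis by simp
    qed
    have "\<delta> ^ N = z ^ (H + 1)" unfolding N_eq'(1) mH(2) z_def power_mult ..
    also have "\<dots> = z" using z \<open>even H\<close> by auto
    finally have plus: "\<delta> ^ N = (-1) ^ ((m + 1) div 2) \<longleftrightarrow> z = -1" using \<open>even H\<close> mH(2) by simp
    \<comment> \<open>\<open>z = 1\<close> forces the congruence, and \<open>z = -1\<close> puts the
      inverse square into \<open>M - SqM\<close>. The congruence alone would not decide: for q = 3
      modulo 4 it also holds when \<open>z = -1\<close>.\<close>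
    show ?thesis
    proof (cases "z = 1")
      case True
      obtain g where g: "q + 1 = 2 * g" using odd_q by (metis evenE even_Suc Suc_eq_plus1)
      have "(- ?D) ^ H = \<delta> ^ (e * H)" using \<open>even H\<close> by (simp add: power_mult)
      also have "e * H = (m - 1) * g" using 3 g mH(1) by simp
      also have "\<delta> ^ ((m - 1) * g) = 1" using True by (simp add: power_mult z_def)
      finally show ?thesis using plus True neq mult_cong_minus_one_iff[of ?D, folded H_def] by auto
    next
      case False
      have y0: "inverse \<delta> ^ 2 \<noteq> 0" using \<delta> by simp
      have "(inverse \<delta> ^ 2) ^ (m - 1) = inverse (z\<^sup>2)"
        by (simp add: z_def power_inverse mult.commute flip: power_mult)
      then have "inverse \<delta> ^ 2 \<in> M" using mem_M_iff[OF y0] \<open>z\<^sup>2 = 1\<close> by simp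
      moreover have "(inverse \<delta> ^ 2) ^ H = inverse z"
        by (simp add: z_def power_inverse mH(1) del: One_nat_def flip: power_mult)
      then have "inverse \<delta> ^ 2 \<notin> SqM" using False by (simp add: mem_SqM_iff H_def)
      ultimately show ?thesis using plus z False by auto
    qed
  qed
qed

end

end

section \<open>Germs as anisotropic lines over a totally singular subspace\<close>

context finite_vector_space begin

text \<open>Each element of \<open>P\<close> has unique coordinates \<open>(y, c)\<close>, and a
  function of \<open>c\<close> alone is constant on cosets of \<open>E\<close>. \<open>H\<close>,
  \<open>g\<close> and \<open>R\<close> are left generic to serve quadratic and hermitian values
  alike.\<close>

lemma card_line_extension:
  assumes E: "subspace E" and u: "u \<notin> E" and P: "P = {y + scale c u | y c. y \<in> E}"
  shows "card P = card E * CARD('k)"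
    and "(\<And>y c. y \<in> E \<Longrightarrow> H (y + scale c u) = g c) \<Longrightarrow>
      card {v \<in> P. R (H v)} = card E * card {c. R (g c)}"
proof -
  let ?f = "\<lambda>(y, c). y + scale c u"
  have inj: "inj_on ?f (E \<times> UNIV)"
  proof (rule inj_onI, clarify)
    fix y c y' c' assume y: "y \<in> E" "y' \<in> E" and eq: "y + scale c u = y' + scale c' u"
    have "scale (c - c') u = y' - y" using eq by (simp add: scale_left_diff_distrib algebra_simps)
    then have mem: "scale (c - c') u \<in> E" using subspace_diff[OF E y(2,1)] by simp
    have "c = c'"
    proof (rule ccontr)
      assume "c \<noteq> c'"
      then have "scale (inverse (c - c')) (scale (c - c') u) = u" by simp
      then show False using subspace_scale[OF E mem, of "inverse (c - c')"] u by simp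
    qed
    then show "y = y' \<and> c = c'" using eq by simp
  qed
  have "P = ?f ` (E \<times> UNIV)" unfolding P by auto
  then show "card P = card E * CARD('k)" using inj by (simp add: card_image card_cartesian_product)
  assume H: "\<And>y c. y \<in> E \<Longrightarrow> H (y + scale c u) = g c"
  have "{v \<in> P. R (H v)} = ?f ` (E \<times> {c. R (g c)})" unfolding P using H by auto
  moreover have "inj_on ?f (E \<times> {c. R (g c)})" by (rule inj_on_subset[OF inj]) auto
  ultimately show "card {v \<in> P. R (H v)} = card E * card {c. R (g c)}"
    by (simp add: card_image card_cartesian_product)
qed

text \<open>\<open>E\<close> is spanned by one vector \<open>e i\<close> from each hyperbolic pair
  and \<open>u\<close> spans the germ; the vectors \<open>f i\<close> are cut off by passing to the
  perp of \<open>E\<close>.\<close>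

lemma germ_coeffE:
  assumes Q: "quadratic_form scale Q" and g: "germ_coeff scale Q \<gamma>"
  obtains E u where "totally_singular scale Q E" "u \<notin> E" "\<gamma> \<noteq> 0"
    "left_perp (polar Q) E = {y + scale c u | y c. y \<in> E}"
    "\<And>y c. y \<in> E \<Longrightarrow> Q (y + scale c u) = \<gamma> * c\<^sup>2"
proof -
  note sesq = sesq_simps[OF polar_sesq[OF Q]]
  obtain U u where germ: "germ scale Q U" and u: "u \<in> U" "u \<noteq> 0" and Qu: "\<And>x. Q (scale x u) = \<gamma> * x\<^sup>2"
    using g by (auto simp: germ_coeff_def)
  have sU: "subspace U" and dU: "dim U = 1" and aU: "\<And>v. v \<in> U \<Longrightarrow> Q v = 0 \<Longrightarrow> v = 0"
    using germ by (auto simp: germ_def)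
  obtain m :: nat and W where hyp: "\<forall>i<m. hyperbolic_line scale Q (W i)" and Wm: "W m = U"
    and sum: "orthogonal_direct_sum scale Q {..m} W UNIV" using germ unfolding germ_def by blast
  have \<gamma>: "\<gamma> \<noteq> 0" using aU[OF u(1)] Qu[of 1] u(2) by auto
  have U: "U = range (\<lambda>c. scale c u)"
  proof -
    have "inj (\<lambda>c. scale c u)" using u(2) by (auto intro: injI)
    then have "card (range (\<lambda>c. scale c u)) = card U"
      using dU by (simp add: card_image card_subspace[OF sU])
    moreover have "range (\<lambda>c. scale c u) \<subseteq> U" using subspace_scale[OF sU u(1)] by auto
    ultimately show ?thesis by (intro card_subset_eq[symmetric]) auto
  qed
  have orth: "polar Q x y = 0" if "i \<le> m" "j \<le> m" "i \<noteq> j" "x \<in> W i" "y \<in> W j" for i j x y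
    using sum that unfolding orthogonal_direct_sum_def by (meson atMost_iff)
  have "\<forall>i. \<exists>e f. i < m \<longrightarrow> Q e = 0 \<and> Q f = 0 \<and> polar Q e f = 1 \<and> W i = span {e, f}"
    using hyp unfolding hyperbolic_line_def by blast
  then obtain e f where "\<forall>i. i < m \<longrightarrow> Q (e i) = 0 \<and> Q (f i) = 0 \<and> polar Q (e i) (f i) = 1 \<and> W i = span {e i, f i}"
    by metis
  then have ef: "Q (e i) = 0" "polar Q (e i) (f i) = 1" "W i = span {e i, f i}" if "i < m" for i
    using that by auto
  have eW: "e i \<in> W i" if "i < m" for i unfolding ef(3)[OF that] by (auto intro: span_base)
  have ee: "polar Q (e i) (e j) = 0" if "i < m" "j < m" for i j
    using orth[of i j "e i" "e j"] that eW polar_self[OF Q, of "e i"] ef(1)[of i] by (cases "i = j") auto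
  define E where "E = span (e ` {..<m})"
  have E0: "Q x = 0 \<and> (\<forall>j<m. polar Q x (e j) = 0)" if "x \<in> E" for x
    using that unfolding E_def
  proof (induction rule: span_induct_alt)
    case base
    then show ?case by (simp add: Q_0[OF Q] sesq)
  next
    case (step c b y)
    then obtain i where i: "i < m" "b = e i" by auto
    have "polar Q (e i) y = 0" using step(2) i(1) polar_commute by metis
    then show ?case
      using step(2) i ef(1)[OF i(1)] ee[OF i(1)]
      by (simp add: quadratic_add[of Q "scale c (e i)"] Q_scale[OF Q] sesq)
  qed
  have ts: "totally_singular scale Q E"
    using E0 by (simp add: totally_singular_def) (simp add: E_def)
  have ue: "polar Q u (e j) = 0" if "j < m" for j
    using orth[of m j u "e j"] that eW Wm u(1) by simp
  have uE: "polar Q u y = 0" if "y \<in> E" for y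
    using that unfolding E_def
    by (induction rule: span_induct_alt) (auto simp: sesq ue)
  have val: "Q (y + scale c u) = \<gamma> * c\<^sup>2" if "y \<in> E" for y c
    using E0[OF that] uE[OF that] Qu[of c] by (simp add: quadratic_add[of Q y] sesq polar_commute[of Q y])
  have "u \<notin> E" using E0[of u] aU u by blast
  moreover have "left_perp (polar Q) E = {y + scale c u | y c. y \<in> E}"
  proof
    show "{y + scale c u | y c. y \<in> E} \<subseteq> left_perp (polar Q) E"
      using totally_singular_subset_perp[OF ts] uE by (fastforce simp: left_perp_def sesq)
    show "left_perp (polar Q) E \<subseteq> {y + scale c u | y c. y \<in> E}"
    proof
      fix v assume v: "v \<in> left_perp (polar Q) E"
      obtain x where x: "\<And>i. i \<le> m \<Longrightarrow> x i \<in> W i" "v = (\<Sum>i\<le>m. x i)"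
      proof -
        have "v \<in> {\<Sum>i\<le>m. x i | x. \<forall>i\<in>{..m}. x i \<in> W i}"
          using sum by (auto simp: orthogonal_direct_sum_def)
        then show ?thesis using that by (auto simp: atMost_def)
      qed
      \<comment> \<open>Pairing \<open>v\<close> with \<open>e j\<close> isolates the coefficient of
        \<open>f j\<close> in \<open>x j\<close>, which must therefore vanish.\<close>
      have xE: "x j \<in> E" if j: "j < m" for j
      proof -
        have ej: "e j \<in> E" using j by (auto simp: E_def intro: span_base)
        have lin: "polar Q (sum x I) (e j) = (\<Sum>i\<in>I. polar Q (x i) (e j))" for I
          by (induction I rule: infinite_finite_induct) (auto simp: sesq)
        have "0 = polar Q v (e j)" using left_perpD[OF v ej] by simp
        also have "\<dots> = (\<Sum>i\<le>m. polar Q (x i) (e j))" unfolding x(2) by (rule lin)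
        also have "\<dots> = (\<Sum>i\<le>m. if i = j then polar Q (x j) (e j) else 0)"
        proof (rule sum.cong[OF refl])
          fix i assume "i \<in> {..m}"
          then have "polar Q (x i) (e j) = 0" if "i \<noteq> j"
            using orth[of i j "x i" "e j"] that j x(1) eW[OF j] by simp
          then show "polar Q (x i) (e j) = (if i = j then polar Q (x j) (e j) else 0)" by simp
        qed
        also have "\<dots> = polar Q (x j) (e j)" using j by simp
        finally have z: "polar Q (x j) (e j) = 0" ..
        obtain a b where ab: "x j = scale a (e j) + scale b (f j)"
        proof -
          have "x j \<in> span {e j, f j}" using x(1)[of j] j ef(3)[OF j] by simp
          then obtain k where "x j - scale k (e j) \<in> span {f j}" using span_breakdown_eq by blast
          then obtain l where "x j - scale k (e j) = scale l (f j)" by (auto simp: span_singleton)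
          then show ?thesis using that[of k l] by (simp add: algebra_simps)
        qed
        have "b = 0"
          using z ee[OF j j] ef(2)[OF j] by (simp add: ab sesq polar_commute[of Q "f j"])
        then show ?thesis using ab ej by (simp add: E_def span_scale)
      qed
      have "x m \<in> U" using x(1)[of m] Wm by simp
      then obtain c where "x m = scale c u" by (auto simp: U)
      moreover have "v = (\<Sum>i<m. x i) + x m" unfolding x(2) by (simp add: lessThan_Suc_atMost[symmetric])
      moreover have "(\<Sum>i<m. x i) \<in> E" unfolding E_def
        by (rule span_sum) (use xE E_def in auto)
      ultimately show "v \<in> {y + scale c u | y c. y \<in> E}"
        by (intro CollectI exI[of _ "\<Sum>i<m. x i"] exI[of _ c]) simp
    qed
  qed
  ultimately show ?thesis using that[OF ts _ \<gamma> _ val] by blast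
qed

end

context trace_lift begin

text \<open>\<open>E\<close> remains totally singular for \<open>L \<circ> Q\<close> but is in
  general no longer maximal; its perp modulo \<open>E\<close> is a copy of GF(q^w) carrying
  \<open>L (\<gamma> * c\<^sup>2)\<close>.\<close>

lemma type_germ:
  assumes Q: "quadratic_form s Q" and nd: "\<And>z. (\<And>v. polar Q v z = 0) \<Longrightarrow> z = 0"
    and g: "germ_coeff s Q \<gamma>" and pos: "K.dim UNIV > 0"
    and odd_q: "odd q" and w: "w = 2 * h" and m: "m = q ^ h" and N: "CARD('k) - 1 = N * 2"
  shows "(\<alpha> * \<gamma>) ^ N = (-1) ^ ((m + 1) div 2) \<Longrightarrow> type_O_plus sq (L \<circ> Q)"
    and "(\<alpha> * \<gamma>) ^ N \<noteq> (-1) ^ ((m + 1) div 2) \<Longrightarrow> type_O_minus sq (L \<circ> Q)"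
proof -
  obtain E u where ts: "totally_singular s Q E" and u: "u \<notin> E" and \<gamma>: "\<gamma> \<noteq> 0"
    and perp: "left_perp (polar Q) E = {y + s c u | y c. y \<in> E}"
    and val: "\<And>y c. y \<in> E \<Longrightarrow> Q (y + s c u) = \<gamma> * c\<^sup>2"
    by (rule K.germ_coeffE[OF Q g]) (rule that)
  have sE: "K.subspace E" using ts by (simp add: totally_singular_def)
  note LQ = quadratic_form_L[OF Q] and Lnd = polar_nondegenerate_L[OF Q nd]
  have "F.dim UNIV = 2 * (K.dim UNIV * h)" by (simp only: dim_sq w ac_simps)
  then obtain r where r: "F.dim UNIV = 2 * Suc r" by (rule half_dim_sq[OF _ pos])
  have tsL: "totally_singular sq (L \<circ> Q) E"
    using ts subspace_sq by (simp add: totally_singular_def)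
  have perpL: "left_perp (polar (L \<circ> Q)) E = {y + s c u | y c. y \<in> E}"
  proof -
    have "polar (L \<circ> Q) = (\<lambda>u v. L (polar Q u v))" by (intro ext polar_L)
    then show ?thesis using left_perp_L[OF K.polar_sesq[OF Q] sE] perp by (simp only:)
  qed
  have cP: "card (left_perp (polar (L \<circ> Q)) E) = card E * CARD('f) ^ (2 * h)"
    using K.card_line_extension(1)[OF sE u perpL] by (simp add: card_k card_f w)
  have cZ: "card {v \<in> left_perp (polar (L \<circ> Q)) E. (L \<circ> Q) v = 0} = card E * card {c. L (\<gamma> * c\<^sup>2) = 0}"
    using K.card_line_extension(2)[OF sE u perpL, of "L \<circ> Q" "\<lambda>c. L (\<gamma> * c\<^sup>2)" "\<lambda>x. x = 0"] val
    by simp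
  {
    assume \<chi>: "(\<alpha> * \<gamma>) ^ N = (-1) ^ ((m + 1) div 2)"
    have "int CARD('f) * int (card {v \<in> left_perp (polar (L \<circ> Q)) E. (L \<circ> Q) v = 0})
      = int (card E) * (int CARD('f) ^ (2 * h) + 1 * (int CARD('f) - 1) * int CARD('f) ^ h)"
      using card_trace_square_plus[OF odd_q w m N \<gamma> \<chi>] unfolding cZ card_f by (simp add: mult.left_commute)
    from F.zero_count_from_perp[OF LQ Lnd r tsL cP this]
    show "type_O_plus sq (L \<circ> Q)" by (simp add: F.type_O_plus_iff[OF LQ Lnd r])
  next
    assume \<chi>: "(\<alpha> * \<gamma>) ^ N \<noteq> (-1) ^ ((m + 1) div 2)"
    have "int CARD('f) * int (card {v \<in> left_perp (polar (L \<circ> Q)) E. (L \<circ> Q) v = 0})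
      = int (card E) * (int CARD('f) ^ (2 * h) + (-1) * (int CARD('f) - 1) * int CARD('f) ^ h)"
      using card_trace_square_minus[OF odd_q w m N \<gamma> \<chi>] unfolding cZ card_f
      by (simp add: mult.left_commute left_diff_distrib)
    from F.zero_count_from_perp[OF LQ Lnd r tsL cP this]
    show "type_O_minus sq (L \<circ> Q)" by (simp add: F.type_O_minus_iff[OF LQ Lnd r] left_diff_distrib)
  }
qed

end

subsection \<open>Involutions of finite fields\<close>

text \<open>With \<open>m = |S|\<close>, the element \<open>x\<^sup>m\<close> is a root of \<open>(X - x) (X - \<sigma> x)\<close>, whose coefficients lie in the
  fixed field \<open>S\<close>.\<close>

lemma field_involution:
  fixes \<sigma> :: "'k::{finite,field} \<Rightarrow> 'k"
  assumes hom: "field_hom \<sigma>" and nt: "\<sigma> \<noteq> id" and inv: "\<And>x. \<sigma> (\<sigma> x) = x"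
  defines "S \<equiv> {x. \<sigma> x = x}"
  shows "CARD('k) = (card S)\<^sup>2" and "\<sigma> x = x ^ card S"
proof -
  note hs = field_hom_simps[OF hom]
  obtain t where t: "\<sigma> t \<noteq> t" using nt by (metis ext id_apply)
  \<comment> \<open>1 and \<open>t\<close> form a basis of the field over \<open>S\<close>.\<close>
  let ?f = "\<lambda>(a, b). a + b * t"
  have "inj_on ?f (S \<times> S)"
  proof (rule inj_onI, clarify)
    fix a b c d assume *: "a \<in> S" "b \<in> S" "c \<in> S" "d \<in> S" and eq: "a + b * t = c + d * t"
    have "\<sigma> (a + b * t) = \<sigma> (c + d * t)" using eq by simp
    then have "a + b * \<sigma> t = c + d * \<sigma> t" using * by (simp add: hs S_def)
    then have "(b - d) * (\<sigma> t - t) = 0" using eq by algebra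
    then have "b = d" using t by simp
    then show "a = c \<and> b = d" using eq by simp
  qed
  moreover have "?f ` (S \<times> S) = UNIV"
  proof -
    have "x \<in> ?f ` (S \<times> S)" for x
    proof -
      \<comment> \<open>Subtracting from \<open>x = a + b * t\<close> its image under
        \<open>\<sigma>\<close>, with \<open>a\<close> and \<open>b\<close> fixed, determines
        \<open>b\<close>.\<close>
      define b where "b = (x - \<sigma> x) / (t - \<sigma> t)"
      have b: "b * (t - \<sigma> t) = x - \<sigma> x" using t by (simp add: b_def)
      have "\<sigma> (b * (t - \<sigma> t)) = \<sigma> (x - \<sigma> x)" by (simp only: b)
      then have "\<sigma> b * (\<sigma> t - t) = \<sigma> x - x" by (simp add: hs inv)
      then have "(\<sigma> b - b) * (\<sigma> t - t) = 0" using b by algebra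
      then have \<sigma>b: "\<sigma> b = b" using t by simp
      have "\<sigma> (x - b * t) = \<sigma> x - b * \<sigma> t" by (simp add: hs \<sigma>b)
      also have "\<dots> = x - b * t" using b by algebra
      finally have "\<sigma> (x - b * t) = x - b * t" .
      then show ?thesis by (intro image_eqI[of _ _ "(x - b * t, b)"]) (auto simp: S_def \<sigma>b)
    qed
    then show ?thesis by auto
  qed
  ultimately show card: "CARD('k) = (card S)\<^sup>2"
    by (metis card_image card_cartesian_product power2_eq_square)
  have S: "0 \<in> S" "1 \<in> S" "\<And>x y. x \<in> S \<Longrightarrow> y \<in> S \<Longrightarrow> x * y \<in> S" "\<And>x y. x \<in> S \<Longrightarrow> y \<in> S \<Longrightarrow> x + y \<in> S"
    by (auto simp: S_def hs)
  have m0: "card S > 0" using S(1) by (auto simp: card_gt_0_iff)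
  have pw: "x ^ card S = x" if "x \<in> S" for x
  proof (cases "x = 0")
    case False
    then have "x ^ (card S - 1) = 1" using that S by (intro power_card_minus_one_eq_1) auto
    then show ?thesis using power_minus_mult[OF m0, of x] by simp
  qed (use m0 in simp)
  have add: "(x + y) ^ card S = x ^ card S + y ^ card S" for x y :: 'k
    by (rule power_subfield_order_add[OF _ refl]) (use S pw m0 in auto)
  define y where "y = x ^ card S"
  have "x + \<sigma> x \<in> S" "x * \<sigma> x \<in> S" by (simp_all add: S_def hs inv add.commute mult.commute)
  then have e: "(x + \<sigma> x) ^ card S = x + \<sigma> x" "(x * \<sigma> x) ^ card S = x * \<sigma> x" by (simp_all add: pw)
  have "\<sigma> x ^ card S = x + \<sigma> x - y" using e(1) by (simp add: add y_def algebra_simps)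
  then have "y * (x + \<sigma> x - y) = x * \<sigma> x" using e(2) by (simp add: power_mult_distrib y_def)
  then have "(y - x) * (y - \<sigma> x) = 0" by algebra
  then consider "y = x" | "y = \<sigma> x" by auto
  then show "\<sigma> x = x ^ card S"
  proof cases
    \<comment> \<open>The equation \<open>x ^ card S = x\<close> has at most \<open>card S\<close>
      solutions, and the elements of \<open>S\<close> are solutions; so \<open>x\<close> lies in
      \<open>S\<close> and is fixed by \<open>\<sigma>\<close> too.\<close>
    case 1
    have m1: "card S > 1"
    proof -
      have "card {0, 1 :: 'k} \<le> card S" using S by (intro card_mono) auto
      then show ?thesis by simp
    qed
    have "{x::'k. x ^ card S = x} \<subseteq> insert 0 {x. x ^ (card S - 1) = 1}"
    proof
      fix x :: 'k assume "x \<in> {x. x ^ card S = x}"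
      then have "x ^ (card S - 1) * x = x" using power_minus_mult[OF m0, of x] by simp
      then show "x \<in> insert 0 {x. x ^ (card S - 1) = 1}" by auto
    qed
    then have "card {x::'k. x ^ card S = x} \<le> card (insert 0 {x::'k. x ^ (card S - 1) = 1})"
      by (intro card_mono) auto
    also have "\<dots> \<le> Suc (card {x::'k. x ^ (card S - 1) = 1})" by (rule card_insert_le_m1) auto
    also have "\<dots> \<le> card S" using card_roots_monom_le(1)[of "card S - 1" "1::'k"] m1 by simp
    finally have "S = {x. x ^ card S = x}" using pw by (intro card_seteq) auto
    then have "x \<in> S" using 1 by (auto simp: y_def)
    then have "\<sigma> x = x" by (simp add: S_def)
    then show ?thesis using 1 by (simp only: y_def)
  qed (simp add: y_def)
qed

context traced_extension begin

lemma L_ext: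
  assumes "\<And>x. L x = L (a * x)" shows "a = 1"
proof -
  have "L (x * (1 - a)) = 0" for x using assms[of x] by (simp add: algebra_simps L_diff)
  then have "1 - a = 0" using L_eq_0_iff by blast
  then show ?thesis by simp
qed

context
  fixes \<sigma> :: "'k \<Rightarrow> 'k" and m :: nat
  assumes auto: "field_auto \<sigma>" and nt: "\<sigma> \<noteq> id" and inv: "\<sigma> \<circ> \<sigma> = id"
    and m: "m = card {x. \<sigma> x = x}"
begin

abbreviation "\<tau> \<equiv> restrict_auto \<iota> \<sigma>"

lemma \<sigma>_hom: "field_hom \<sigma>" using auto by (simp add: field_auto_def)

lemma \<sigma>_\<sigma>: "\<sigma> (\<sigma> x) = x" using inv by (metis comp_apply id_apply)

lemmas \<sigma>_simps = field_hom_simps[OF \<sigma>_hom]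

lemma card_k_fixed: "CARD('k) = m\<^sup>2" and \<sigma>_eq_power: "\<sigma> x = x ^ m"
  unfolding m by (fact field_involution[OF \<sigma>_hom nt \<sigma>_\<sigma>])+

text \<open>\<open>range \<iota>\<close> consists of the solutions of \<open>x ^ q = x\<close>, a
  set that every automorphism preserves, so the restriction of \<open>\<sigma>\<close> is well
  defined.\<close>

lemma \<sigma>_\<iota>: "\<sigma> (\<iota> c) = \<iota> (\<tau> c)"
proof -
  have "\<sigma> (\<iota> c) ^ q = \<sigma> (\<iota> c)" by (simp only: \<sigma>_simps(7)[symmetric] \<iota>_power_q)
  then have "\<sigma> (\<iota> c) \<in> range \<iota>" by (simp add: range_\<iota>)
  then show ?thesis unfolding restrict_auto_def by (rule f_the_inv_into_f[OF \<iota>_simps(10), symmetric])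
qed

lemma \<tau>_\<tau>: "\<tau> (\<tau> c) = c"
  using \<sigma>_\<sigma>[of "\<iota> c"] by (simp add: \<sigma>_\<iota> \<iota>_eq_iff)

lemma field_auto_\<tau>: "field_auto \<tau>"
  unfolding field_auto_def field_hom_def
proof (intro conjI allI)
  show "\<tau> 1 = 1" "\<tau> (x + y) = \<tau> x + \<tau> y" "\<tau> (x * y) = \<tau> x * \<tau> y" for x y
    by (simp_all add: \<iota>_eq_iff[symmetric] \<sigma>_\<iota>[symmetric] \<iota>_simps \<sigma>_simps)
  show "bij \<tau>" by (rule bij_betw_byWitness[where f'=\<tau>]) (auto simp: \<tau>_\<tau>)
qed

lemma m_eq: "w = 2 * h \<Longrightarrow> m = q ^ h"
proof -
  assume h: "w = 2 * h"
  have "m\<^sup>2 = (q ^ h)\<^sup>2" using card_k_fixed by (simp add: card_k h mult.commute flip: power_mult)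
  then show "m = q ^ h" by (rule power2_eq_imp_eq) auto
qed

lemma \<tau>_eq_id:
  assumes "even w" shows "\<tau> = id"
proof
  fix c
  obtain h where h: "w = 2 * h" using assms by (elim evenE)
  have "\<sigma> (\<iota> c) = \<iota> c" by (simp only: \<sigma>_eq_power m_eq[OF h] \<iota>_power_q_power)
  then show "\<tau> c = id c" by (simp add: \<sigma>_\<iota> \<iota>_eq_iff)
qed

text \<open>If \<open>\<sigma>\<close> fixed GF(q), its fixed field would be a vector space over
  GF(q); its order is the square root of \<open>q ^ w\<close>, so \<open>w\<close> would be twice
  its dimension.\<close>

lemma \<tau>_neq_id:
  assumes "odd w" shows "\<tau> \<noteq> id"
proof
  assume id: "\<tau> = id"
  interpret E: finite_vector_space "\<lambda>c x. \<iota> c * x :: 'k" by (rule finite_vector_space_extension)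
  have "E.subspace {x. \<sigma> x = x}" by (rule E.subspaceI) (simp_all add: \<sigma>_simps \<sigma>_\<iota> id)
  then have "m = q ^ E.dim {x. \<sigma> x = x}" unfolding m card_f[symmetric] by (rule E.card_subspace)
  then have "q ^ w = q ^ (E.dim {x. \<sigma> x = x} * 2)"
    using card_k_fixed card_k by (simp add: power_mult)
  then have "w = E.dim {x. \<sigma> x = x} * 2" using q_gt_1 by simp
  then show False using assms by (metis dvd_triv_right)
qed

text \<open>The trace commutes with automorphisms; only the multiplier \<alpha> inside
  \<open>L\<close> is moved, and \<open>\<sigma> \<alpha> / \<alpha>\<close> corrects for it. The
  case distinctions on \<open>\<sigma> \<alpha>\<close> originate here.\<close>

lemma L_\<sigma>: "L (\<sigma> x) = \<tau> (L (\<sigma> \<alpha> * x / \<alpha>))"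
proof -
  have "\<iota> (\<tau> (L (\<sigma> \<alpha> * x / \<alpha>))) = (\<Sum>i<w. (\<sigma> (\<sigma> \<alpha> * x)) ^ (q ^ i))"
    using \<alpha>_nonzero by (simp add: \<sigma>_\<iota>[symmetric] \<iota>_L \<sigma>_simps)
  also have "\<dots> = \<iota> (L (\<sigma> x))" by (simp add: \<iota>_L \<sigma>_simps \<sigma>_\<sigma>)
  finally show ?thesis by (simp add: \<iota>_eq_iff)
qed

lemma card_trace_norm:
  assumes w: "w = 2 * h" and odd_q: "odd q" and \<sigma>\<alpha>: "\<sigma> \<alpha> = \<alpha>" and \<kappa>: "\<sigma> \<kappa> = \<kappa>" "\<kappa> \<noteq> 0"
  shows "int q * int (card {c. L (c * \<sigma> c * \<kappa>) = 0}) = int q ^ (2 * h) - (int q - 1) * int q ^ h"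
proof -
  let ?S = "{x. \<sigma> x = x}"
  have mh: "m = q ^ h" by (rule m_eq[OF w])
  have h0: "h > 0" using w w_pos by simp
  have m1: "m > 1" unfolding mh using q_gt_1 h0 by (rule one_less_power)
  have cm1: "CARD('k) - 1 = (m - 1) * (m + 1)"
    using card_k_fixed m1 by (cases m) (auto simp: power2_eq_square)
  have id: "\<tau> = id" using \<tau>_eq_id w by simp
  have two: "(2::'f) \<noteq> 0" using odd_q two_eq_0_iff_even_card[where 'a='f] card_f by simp
  \<comment> \<open>\<open>L\<close> maps the fixed field onto GF(q): \<open>x + \<sigma> x\<close>
    is fixed and has the value \<open>2 * L x\<close>, nonzero for suitable \<open>x\<close> as
    \<open>q\<close> is odd.\<close>
  have kerS: "q * card {x \<in> ?S. L x = 0} = m"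
    unfolding m card_f[symmetric]
  proof (rule card_fiber_additive)
    obtain x where x: "L x \<noteq> 0" using L_nonzero by blast
    have "L (\<sigma> x) = L x" using L_\<sigma>[of x] \<sigma>\<alpha> \<alpha>_nonzero by (simp add: id)
    then have "L (x + \<sigma> x) = 2 * L x" by (simp add: L_add)
    then have nz: "L (x + \<sigma> x) \<noteq> 0" using x two by simp
    fix a
    have "L (\<iota> (a / L (x + \<sigma> x)) * (x + \<sigma> x)) = a" using nz unfolding L_scale by simp
    moreover have "\<sigma> (\<iota> (a / L (x + \<sigma> x)) * (x + \<sigma> x)) = \<iota> (a / L (x + \<sigma> x)) * (x + \<sigma> x)"
      unfolding \<sigma>_simps(3,4) \<sigma>_\<iota> \<sigma>_\<sigma> id by (simp add: add.commute)
    ultimately show "\<exists>w\<in>?S. L w = a" by blast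
  qed (auto simp: \<sigma>_simps L_add)
  have fix_iff: "a \<in> ?S \<longleftrightarrow> a ^ (m - 1) = 1" if "a \<noteq> 0" for a
  proof -
    have "\<sigma> a = a ^ (m - 1) * a" using m1 power_minus_mult[of m a] by (simp add: \<sigma>_eq_power)
    then show ?thesis using that by simp
  qed
  let ?B = "{b \<in> ?S. L b = 0} - {0}"
  \<comment> \<open>\<open>c * \<sigma> c\<close> is the norm \<open>c ^ (m + 1)\<close>, whose
    fibers over nonzero fixed elements have \<open>m + 1\<close> elements.\<close>
  have fib: "card {c. c * \<sigma> c * \<kappa> = b} = m + 1" if "b \<in> ?B" for b
  proof -
    have "{c. c * \<sigma> c * \<kappa> = b} = {c. c ^ (m + 1) = b / \<kappa>}" using \<kappa>(2) by (auto simp: \<sigma>_eq_power field_simps)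
    moreover have "b / \<kappa> \<in> ?S"
    proof -
      have "\<sigma> (b / \<kappa>) * \<kappa> = \<sigma> (b / \<kappa> * \<kappa>)" by (simp only: \<sigma>_simps(4) \<kappa>(1))
      then show ?thesis using \<kappa>(2) that by (simp add: field_simps)
    qed
    ultimately show ?thesis using that \<kappa>(2) card_power_fiber[OF cm1, of "b / \<kappa>"] fix_iff[of "b / \<kappa>"] by simp
  qed
  have "{c. L (c * \<sigma> c * \<kappa>) = 0} = {0} \<union> (\<Union>b\<in>?B. {c. c * \<sigma> c * \<kappa> = b})"
  proof -
    have "c * \<sigma> c * \<kappa> \<in> ?S" for c by (simp add: \<sigma>_simps \<sigma>_\<sigma> \<kappa> mult.commute)
    moreover have "c * \<sigma> c * \<kappa> = 0 \<longleftrightarrow> c = 0" for c using \<kappa>(2) \<sigma>_simps(9) by simp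
    ultimately show ?thesis by (auto simp: \<sigma>_simps(1))
  qed
  then have "card {c. L (c * \<sigma> c * \<kappa>) = 0} = 1 + card (\<Union>b\<in>?B. {c. c * \<sigma> c * \<kappa> = b})"
    by (simp only:) (subst card_Un_disjoint, auto simp: \<sigma>_simps(1))
  also have "card (\<Union>b\<in>?B. {c. c * \<sigma> c * \<kappa> = b}) = (\<Sum>b\<in>?B. card {c. c * \<sigma> c * \<kappa> = b})"
    by (rule card_UN_disjoint) auto
  also have "\<dots> = (\<Sum>b\<in>?B. m + 1)" by (rule sum.cong[OF refl fib])
  also have "\<dots> = card ?B * (m + 1)" by simp
  finally have T: "card {c. L (c * \<sigma> c * \<kappa>) = 0} = 1 + card ?B * (m + 1)" .
  have "Suc (card ?B) = card {b \<in> ?S. L b = 0}"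
    by (rule card_Suc_Diff1) (auto simp: \<sigma>_simps(1))
  then have "int m = int (q * (card ?B + 1))" using kerS by simp
  also have "\<dots> = int q * int (card ?B) + int q" unfolding of_nat_mult of_nat_add by (simp add: distrib_left)
  finally have "int q * int (card ?B) = int m - int q" by simp
  then have "int q * int (card {c. L (c * \<sigma> c * \<kappa>) = 0}) = int q + (int m - int q) * (int m + 1)"
    unfolding T by (simp add: distrib_left mult.assoc[symmetric])
  then show ?thesis by (simp add: mh mult_2 mult_2_right power_add algebra_simps)
qed

end

end

section \<open>Symmetric and hermitian forms on a fixed space\<close>

context finite_vector_space begin

lemma half_form_quadratic:
  assumes b: "symmetric_form scale b" and two: "(2::'k) \<noteq> 0"
  shows "quadratic_form scale (half_form b)" and "polar (half_form b) = b"
proof -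
  have sesq: "sesquilinear_form scale id b" and sym: "\<And>u v. b u v = b v u"
    using b by (auto simp: symmetric_form_def)
  note ss = sesq_simps[OF sesq]
  show p: "polar (half_form b) = b"
  proof (intro ext)
    fix u v
    have "b (u + v) (u + v) = b u u + 2 * b u v + b v v"
      unfolding ss(1,2) sym[of v u] by algebra
    then have "2 * polar (half_form b) u v = 2 * b u v"
      using two by (simp add: polar_def half_form_def add_divide_distrib right_diff_distrib)
    then show "polar (half_form b) u v = b u v" using two by simp
  qed
  show "quadratic_form scale (half_form b)"
    unfolding quadratic_form_iff p using sesq by (simp add: half_form_def ss power2_eq_square)
qed

text \<open>A nonzero value lets the automorphism be read off from scalars in the second argument;
  this excludes bilinearity when the automorphism is not the identity.\<close>

lemma sesq_auto_unique:
  assumes "sesquilinear_form scale \<sigma> b" "sesquilinear_form scale \<tau> b" "b u v \<noteq> 0"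
  shows "\<sigma> = \<tau>"
proof
  fix c
  have "\<sigma> c * b u v = \<tau> c * b u v"
    using sesq_simps(4)[OF assms(1), of u c v] sesq_simps(4)[OF assms(2), of u c v] by metis
  then show "\<sigma> c = \<tau> c" using assms(3) by auto
qed

text \<open>A vector of \<open>W\<^sup>\<bottom>\<close> orthogonal to \<open>u\<close> can be made isotropic by adding a multiple of \<open>u\<close>, because
  norms fill the fixed field; so an anisotropic part of \<open>W\<^sup>\<bottom>/W\<close> has dimension at most 1.\<close>

lemma hermitian_maximal_isotropic:
  assumes b: "hermitian_form scale \<sigma> b"
  obtains W where "subspace W" "\<And>x y. x \<in> W \<Longrightarrow> y \<in> W \<Longrightarrow> b x y = 0"
    "left_perp b W = W \<or> (\<exists>u. u \<notin> W \<and> b u u \<noteq> 0 \<and>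
      left_perp b W = {y + scale c u | y c. y \<in> W} \<and>
      (\<forall>y c. y \<in> W \<longrightarrow> b (y + scale c u) (y + scale c u) = c * \<sigma> c * b u u))"
proof -
  have sesq: "sesquilinear_form scale \<sigma> b" and nt: "\<sigma> \<noteq> id" and inv: "\<sigma> \<circ> \<sigma> = id"
    and herm: "\<And>u v. b u v = \<sigma> (b v u)" using b unfolding hermitian_form_def by blast+
  note ss = sesq_simps[OF sesq]
  have hom: "field_hom \<sigma>" using sesq by (simp add: sesquilinear_form_def field_auto_def)
  note hs = field_hom_simps[OF hom]
  have inv': "\<sigma> (\<sigma> x) = x" for x using fun_cong[OF inv, of x] by simp
  have refl: "b u v = 0 \<longleftrightarrow> b v u = 0" for u v by (subst herm) (rule hs(9))
  let ?iso = "\<lambda>W. subspace W \<and> (\<forall>u\<in>W. \<forall>v\<in>W. b u v = 0)"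
  have finC: "finite {W. ?iso W}" by (rule finite_subset[OF subset_UNIV]) (simp add: Finite_Set.finite_set)
  have "{0} \<in> {W. ?iso W}" by (simp add: ss(5))
  then have "{W. ?iso W} \<noteq> {}" by blast
  then have "\<exists>W\<in>{W. ?iso W}. \<forall>W'\<in>{W. ?iso W}. W \<subseteq> W' \<longrightarrow> W = W'"
    by (rule finite_has_maximal[OF finC])
  then obtain W where W: "?iso W" and max: "\<And>W'. ?iso W' \<Longrightarrow> W \<subseteq> W' \<Longrightarrow> W = W'"
    unfolding Bex_def Ball_def mem_Collect_eq by metis
  have sW: "subspace W" using W by simp
  let ?P = "left_perp b W"
  have sP: "subspace ?P" by (rule subspace_left_perp[OF sesq])
  have WP: "W \<subseteq> ?P" using W by (auto simp: left_perp_def)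
  have iso_mem: "v \<in> W" if v: "v \<in> ?P" "b v v = 0" for v
  proof -
    have "b x y = 0" if xy: "x \<in> span (insert v W)" "y \<in> span (insert v W)" for x y
    proof -
      obtain k where k: "x - scale k v \<in> W"
        using xy(1) span_eq_iff[THEN iffD2, OF sW] by (auto simp: span_insert)
      obtain l where l: "y - scale l v \<in> W"
        using xy(2) span_eq_iff[THEN iffD2, OF sW] by (auto simp: span_insert)
      have 1: "b (x - scale k v) (y - scale l v) = 0" using W k l by blast
      have 2: "b v (y - scale l v) = 0" using left_perpD[OF v(1) l] .
      have 3: "b (x - scale k v) v = 0" using left_perpD[OF v(1) k] refl by blast
      have "b (x - scale k v + scale k v) (y - scale l v + scale l v) = 0"
        unfolding ss(1-4) by (simp only: 1 2 3 v(2)) simp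
      then show ?thesis by simp
    qed
    then have "?iso (span (insert v W))" by simp
    then have "W = span (insert v W)" by (rule max) (auto intro: span_base)
    then show ?thesis using span_base[of v "insert v W"] by auto
  qed
  have ex: "\<exists>u. u \<notin> W \<and> b u u \<noteq> 0 \<and> ?P = {y + scale c u | y c. y \<in> W} \<and>
      (\<forall>y c. y \<in> W \<longrightarrow> b (y + scale c u) (y + scale c u) = c * \<sigma> c * b u u)" if PW: "?P \<noteq> W"
  proof -
    from PW obtain u where u: "u \<in> ?P" "u \<notin> W" using WP by auto
    have uu: "b u u \<noteq> 0" using iso_mem u by blast
    have uW: "b u y = 0" "b y u = 0" if "y \<in> W" for y using left_perpD[OF u(1) that] refl by auto
    have "?P = {y + scale c u | y c. y \<in> W}"
    proof
      show "{y + scale c u | y c. y \<in> W} \<subseteq> ?P"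
        using subspace_add[OF sP] subspace_scale[OF sP u(1)] WP by auto
      show "?P \<subseteq> {y + scale c u | y c. y \<in> W}"
      proof
        fix v assume v: "v \<in> ?P"
        \<comment> \<open>The component of \<open>v\<close> orthogonal to \<open>u\<close>.\<close>
        define v' where "v' = v - scale (b v u / b u u) u"
        have v'P: "v' \<in> ?P" unfolding v'_def by (intro subspace_diff[OF sP] v subspace_scale[OF sP] u(1))
        have v'u: "b v' u = 0" using uu by (simp add: v'_def ss)
        then have uv': "b u v' = 0" using refl by blast
        have "v' \<in> W"
        proof (rule ccontr)
          assume "v' \<notin> W"
          then have vv: "b v' v' \<noteq> 0" using iso_mem v'P by blast
          define m where "m = card {x. \<sigma> x = x}"
          have card: "CARD('k) = m\<^sup>2" and pw: "\<And>x. \<sigma> x = x ^ m"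
            using field_involution[OF hom nt inv'] unfolding m_def by blast+
          have m0: "m > 0" using card by (auto intro: gr0I)
          then have cm1: "CARD('k) - 1 = (m - 1) * (m + 1)"
            using card by (cases m) (auto simp: power2_eq_square)
          \<comment> \<open>A \<open>c\<close> of norm \<open>a\<close> makes
            \<open>v' + scale c u\<close> isotropic; \<open>a\<close> is a norm because it is fixed
            by \<open>\<sigma>\<close>.\<close>
          define a where "a = - (b v' v' / b u u)"
          have a0: "a \<noteq> 0" using vv uu by (simp add: a_def)
          have fixed: "\<sigma> (b x x) = b x x" for x using herm[of x x] by simp
          have "\<sigma> a * b u u = \<sigma> (a * b u u)" by (simp add: hs fixed)
          also have "a * b u u = - b v' v'" using uu by (simp add: a_def)
          also have "\<sigma> (- b v' v') = a * b u u" using uu by (simp add: hs fixed a_def)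
          finally have "\<sigma> a = a" using uu by simp
          then have "a ^ (m - 1) * a = a" using pw[of a] power_minus_mult[OF m0, of a] by simp
          then have "a ^ (m - 1) = 1" using a0 by simp
          then obtain c where c: "c \<noteq> 0" "c ^ (m + 1) = a" using ex_power_eq[OF cm1] by blast
          let ?x = "v' + scale c u"
          have "b ?x ?x = b v' v' + c * \<sigma> c * b u u" by (simp add: ss v'u uv' mult.assoc)
          also have "c * \<sigma> c = a" using c(2) by (simp add: pw)
          finally have "b ?x ?x = 0" using uu by (simp add: a_def)
          moreover have "?x \<in> ?P" by (intro subspace_add[OF sP] v'P subspace_scale[OF sP] u(1))
          ultimately have "?x \<in> W" by (intro iso_mem)
          \<comment> \<open>Elements of \<open>W\<close> are orthogonal to \<open>u\<close>, whereas
            \<open>b ?x u = c * b u u\<close> is not 0.\<close>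
          then have "b ?x u = 0" by (rule uW)
          then show False using c(1) uu by (simp add: ss v'u)
        qed
        moreover have "v = v' + scale (b v u / b u u) u" by (simp add: v'_def)
        ultimately show "v \<in> {y + scale c u | y c. y \<in> W}" by blast
      qed
    qed
    moreover have "b (y + scale c u) (y + scale c u) = c * \<sigma> c * b u u" if "y \<in> W" for y c
    proof -
      have "b y y = 0" using W that by blast
      then show ?thesis using uW[OF that] by (simp add: ss mult.assoc)
    qed
    ultimately show ?thesis
      using u(2) uu by (intro exI[of _ u]) simp
  qed
  show ?thesis
  proof (rule that[OF sW])
    show "b x y = 0" if "x \<in> W" "y \<in> W" for x y using W that by blast
    show "?P = W \<or> (\<exists>u. u \<notin> W \<and> b u u \<noteq> 0 \<and> ?P = {y + scale c u | y c. y \<in> W} \<and>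
      (\<forall>y c. y \<in> W \<longrightarrow> b (y + scale c u) (y + scale c u) = c * \<sigma> c * b u u))"
    proof (cases "?P = W")
      case True then show ?thesis by (rule disjI1)
    next
      case False then show ?thesis by (intro disjI2 ex)
    qed
  qed
qed

end

subsection \<open>Hermitian forms composed with the trace\<close>

context trace_lift begin

lemma half_form_L: "half_form (\<lambda>u v. L (b u v)) = L \<circ> half_form b"
proof
  fix v
  have "L (\<iota> (1 / 2) * b v v) = 1 / 2 * L (b v v)" by (rule L_scale)
  moreover have "\<iota> (1 / 2) = 1 / 2"
  proof -
    have "\<iota> (1 + 1) = 1 + 1" by (simp only: \<iota>_simps(2,3))
    then have \<iota>2: "\<iota> 2 = 2" by (simp only: one_add_one)
    show ?thesis
    proof (cases "(2::'f) = 0")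
      \<comment> \<open>Both quotients are 0 by the convention for division by 0.\<close>
      case True
      then have "(2::'k) = 0" using \<iota>2 \<iota>_simps(1) by simp
      then show ?thesis using True by (simp add: \<iota>_simps(1))
    next
      case False
      then have "\<iota> (1 / 2 * 2) = 1" by (simp add: \<iota>_simps(2))
      then have "\<iota> (1 / 2) * 2 = 1" unfolding \<iota>_simps(4) \<iota>2 .
      moreover have "(2::'k) \<noteq> 0" using False \<iota>_simps(9)[of 2] \<iota>2 by simp
      ultimately show ?thesis by (simp add: field_simps)
    qed
  qed
  ultimately show "half_form (\<lambda>u v. L (b u v)) v = (L \<circ> half_form b) v"
    by (simp add: half_form_def)
qed

lemma form_value_surj:
  assumes b: "sesquilinear_form s \<sigma> b" and nd: "form_nondegenerate b" and pos: "K.dim UNIV > 0"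
  shows "\<exists>u v. b u v = a"
proof -
  have "card (UNIV :: 'v set) \<noteq> 1" using pos card_pos_field[where 'a='k] by (simp add: K.card_V)
  then obtain u :: 'v where "u \<noteq> 0" by (metis UNIV_I UNIV_eq_I card_1_singleton_iff One_nat_def singletonI)
  then obtain v where "b u v \<noteq> 0" using nd by (auto simp: form_nondegenerate_def)
  then show ?thesis using K.sesq_surj_right[OF b] by blast
qed

lemma symmetric_L:
  assumes "symmetric_form s b" shows "symmetric_form sq (\<lambda>u v. L (b u v))"
  using assms sesquilinear_L[of id b id] by (simp add: symmetric_form_def F.field_auto_id)

context
  fixes \<sigma> b m
  assumes herm: "hermitian_form s \<sigma> b" and nd: "form_nondegenerate b" and pos: "K.dim UNIV > 0"
begin

lemma sesq: "sesquilinear_form s \<sigma> b" and \<sigma>_neq_id: "\<sigma> \<noteq> id"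
  and \<sigma>_involution: "\<sigma> \<circ> \<sigma> = id" and b_commute: "b u v = \<sigma> (b v u)"
  using herm unfolding hermitian_form_def by blast+

lemma \<sigma>_auto: "field_auto \<sigma>" using sesq by (simp add: sesquilinear_form_def)

lemmas \<sigma>_facts = \<sigma>_auto \<sigma>_neq_id \<sigma>_involution refl
lemmas \<sigma>_\<iota>' = \<sigma>_\<iota>[OF \<sigma>_facts] and \<tau>_\<tau>' = \<tau>_\<tau>[OF \<sigma>_facts]
  and field_auto_\<tau>' = field_auto_\<tau>[OF \<sigma>_facts] and \<tau>_eq_id' = \<tau>_eq_id[OF \<sigma>_facts]
  and \<tau>_neq_id' = \<tau>_neq_id[OF \<sigma>_facts] and L_\<sigma>' = L_\<sigma>[OF \<sigma>_facts]

abbreviation "\<tau>' \<equiv> restrict_auto \<iota> \<sigma>"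
abbreviation "Lb \<equiv> \<lambda>u v. L (b u v)"

lemma sesq_Lb: "sesquilinear_form sq \<tau>' Lb"
  by (rule sesquilinear_L[OF sesq field_auto_\<tau>' \<sigma>_\<iota>'])

lemma Lb_nonzero: "\<exists>u v. Lb u v \<noteq> 0"
  using L_nonzero form_value_surj[OF sesq nd pos] by metis

lemma L_b_commute: "L (b u v) = \<tau>' (L (\<sigma> \<alpha> / \<alpha> * b v u))"
  using L_\<sigma>'[of "b v u"] b_commute[of u v] by simp

text \<open>The form takes every value, so an identity for \<open>L\<close> on its values holds on
  the whole field and determines the multiplier. This recovers \<open>\<sigma> \<alpha>\<close> from
  a symmetry of the composed form.\<close>

lemma L_ext_form:
  assumes "\<And>u v. L (b u v) = L (a * b u v)" shows "a = 1"
proof (rule L_ext)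
  fix x
  obtain u v where "b u v = x" using form_value_surj[OF sesq nd pos] by blast
  then show "L x = L (a * x)" using assms[of u v] by simp
qed

lemma hermitian_Lb:
  assumes "odd w" "\<sigma> \<alpha> = \<alpha>" shows "hermitian_form sq \<tau>' Lb"
  unfolding hermitian_form_def
proof (intro conjI allI)
  show "\<tau>' \<circ> \<tau>' = id" by (auto simp: \<tau>_\<tau>')
  show "L (b u v) = \<tau>' (L (b v u))" for u v
    using L_b_commute[of u v] assms(2) \<alpha>_nonzero by simp
qed (use sesq_Lb \<tau>_neq_id' assms in auto)

lemma hermitian_Lb_imp:
  assumes "hermitian_form sq \<tau>' Lb" shows "\<sigma> \<alpha> = \<alpha>"
proof -
  have "L (b v u) = L (\<sigma> \<alpha> / \<alpha> * b v u)" for u v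
  proof -
    have "L (b u v) = \<tau>' (L (b v u))" using assms unfolding hermitian_form_def by blast
    from trans[OF sym[OF this] L_b_commute]
    have "\<tau>' (\<tau>' (L (b v u))) = \<tau>' (\<tau>' (L (\<sigma> \<alpha> / \<alpha> * b v u)))" by (rule arg_cong)
    then show ?thesis by (simp only: \<tau>_\<tau>')
  qed
  then have "\<sigma> \<alpha> / \<alpha> = 1" by (rule L_ext_form)
  then show ?thesis using \<alpha>_nonzero by simp
qed

lemma atypical_Lb_odd:
  assumes "odd w" "\<sigma> \<alpha> \<noteq> \<alpha>" shows "atypical_form sq \<tau>' Lb"
proof -
  have "\<not> sesquilinear_form sq id Lb"
    using F.sesq_auto_unique[OF sesq_Lb] Lb_nonzero \<tau>_neq_id'[OF assms(1)] by metis
  then show ?thesis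
    using sesq_Lb hermitian_Lb_imp assms(2)
    by (auto simp: atypical_form_def alternating_form_def symmetric_form_def)
qed

text \<open>The restricted automorphism is the identity, so hermitian is impossible. Symmetry would
  force \<open>\<sigma> \<alpha> / \<alpha> = 1\<close>, and skew symmetry, which follows from
  alternating, \<open>- \<sigma> \<alpha> / \<alpha> = 1\<close>.\<close>

lemma atypical_Lb_even:
  assumes "even w" "\<sigma> \<alpha> \<noteq> \<alpha>" "\<sigma> \<alpha> \<noteq> - \<alpha>" shows "atypical_form sq \<tau>' Lb"
proof -
  note id = \<tau>_eq_id'[OF assms(1)]
  have comm: "L (b u v) = L (\<sigma> \<alpha> / \<alpha> * b v u)" for u v using L_b_commute[of u v] by (simp add: id)
  have "\<not> symmetric_form sq Lb"
  proof
    assume "symmetric_form sq Lb"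
    then have "L (b v u) = L (\<sigma> \<alpha> / \<alpha> * b v u)" for u v
      using comm[of u v] by (simp add: symmetric_form_def)
    then have "\<sigma> \<alpha> / \<alpha> = 1" by (rule L_ext_form)
    then show False using assms \<alpha>_nonzero by simp
  qed
  moreover have "\<not> alternating_form sq Lb"
  proof
    assume alt: "alternating_form sq Lb"
    have "L (b v u) = L ((- \<sigma> \<alpha> / \<alpha>) * b v u)" for u v
    proof -
      have z: "L (b x x) = 0" for x using alt by (simp add: alternating_form_def)
      have "L (b u v) + L (b v u) = 0"
        using z[of "u + v"] z[of u] z[of v] by (simp add: K.sesq_simps[OF sesq] L_add add.commute)
      then have "L (b v u) = - L (\<sigma> \<alpha> / \<alpha> * b v u)" using comm[of u v] by (simp add: eq_neg_iff_add_eq_0 add.commute)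
      then show ?thesis by (simp flip: L_minus)
    qed
    then have "- \<sigma> \<alpha> / \<alpha> = 1" by (rule L_ext_form)
    then have "- \<sigma> \<alpha> = \<alpha>" using \<alpha>_nonzero nonzero_divide_eq_eq[of \<alpha> "- \<sigma> \<alpha>" 1] by simp
    then show False using assms(3) by (metis minus_minus)
  qed
  moreover have "\<not> hermitian_form sq \<tau>' Lb" using id by (simp add: hermitian_form_def)
  ultimately show ?thesis using sesq_Lb by (simp add: atypical_form_def)
qed

text \<open>\<open>b x x\<close> is fixed by \<open>\<sigma>\<close>, so
  \<open>\<alpha> * b x x\<close> changes sign under \<open>\<sigma>\<close>, which is the power
  \<open>q ^ h\<close>; its trace therefore vanishes.\<close>

lemma alternating_Lb:
  assumes "even w" "\<sigma> \<alpha> = - \<alpha>" shows "alternating_form sq Lb"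
proof -
  obtain h where h: "w = 2 * h" using assms(1) by (elim evenE)
  have "L (b x x) = 0" for x
  proof -
    let ?z = "\<alpha> * b x x"
    have "?z ^ (q ^ h) = \<sigma> ?z"
      using \<sigma>_eq_power[OF \<sigma>_facts, of ?z] m_eq[OF \<sigma>_facts h] by simp
    also have "\<dots> = - ?z"
      using assms(2) b_commute[of x x] by (simp add: field_hom_simps(4) \<sigma>_hom[OF \<sigma>_facts])
    finally have "\<iota> (L (b x x)) = \<iota> 0"
      unfolding \<iota>_L \<iota>_simps(1) by (rule trace_eq_0_if_antifixed[OF h])
    then show ?thesis by (simp only: \<iota>_eq_iff)
  qed
  then show ?thesis using sesq_Lb \<tau>_eq_id'[OF assms(1)] by (simp add: alternating_form_def)
qed

lemma symmetric_Lb: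
  assumes "even w" "\<sigma> \<alpha> = \<alpha>" shows "symmetric_form sq Lb"
  unfolding symmetric_form_def
proof (intro conjI allI)
  show "sesquilinear_form sq id Lb" using sesq_Lb \<tau>_eq_id'[OF assms(1)] by (simp only:)
  show "L (b u v) = L (b v u)" for u v
    using L_b_commute[of u v] \<tau>_eq_id'[OF assms(1)] assms(2) \<alpha>_nonzero by simp
qed

lemma type_Lb:
  assumes even_w: "even w" and odd_q: "odd q" and \<sigma>\<alpha>: "\<sigma> \<alpha> = \<alpha>"
  shows "even (K.dim UNIV) \<Longrightarrow> type_O_plus sq (half_form Lb)"
    and "odd (K.dim UNIV) \<Longrightarrow> type_O_minus sq (half_form Lb)"
proof -
  obtain h where h: "w = 2 * h" using even_w by (elim evenE)
  let ?A = "K.dim UNIV" and ?H = "half_form Lb"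
  have two: "(2::'f) \<noteq> 0" using odd_q two_eq_0_iff_even_card[where 'a='f] card_f by simp
  note sym = symmetric_Lb[OF even_w \<sigma>\<alpha>]
  note Q = F.half_form_quadratic(1)[OF sym two] and pol = F.half_form_quadratic(2)[OF sym two]
  have ndH: "z = 0" if "\<And>v. polar ?H v z = 0" for z
    using that form_nondegenerate_L[OF sesq nd] sym
    by (auto simp: pol form_nondegenerate_def symmetric_form_def)
  have "F.dim UNIV = 2 * (?A * h)" by (simp only: dim_sq h ac_simps)
  then obtain r where r: "F.dim UNIV = 2 * Suc r" by (rule half_dim_sq[OF _ pos])
  obtain W where W: "K.subspace W" "\<And>x y. x \<in> W \<Longrightarrow> y \<in> W \<Longrightarrow> b x y = 0"
    and cases: "left_perp b W = W \<or> (\<exists>u. u \<notin> W \<and> b u u \<noteq> 0 \<and>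
      left_perp b W = {y + s c u | y c. y \<in> W} \<and>
      (\<forall>y c. y \<in> W \<longrightarrow> b (y + s c u) (y + s c u) = c * \<sigma> c * b u u))"
    by (rule K.hermitian_maximal_isotropic[OF herm]) (rule that)
  have ts: "totally_singular sq ?H W"
    using W subspace_sq by (simp add: totally_singular_def half_form_def)
  have perpL: "left_perp (polar ?H) W = left_perp b W"
    unfolding pol by (rule left_perp_L[OF sesq W(1)])
  have "w = 0" if "\<And>v. b v w = 0" for w
  proof -
    have "\<forall>v. b w v = 0" using that b_commute[of w] field_hom_simps(1)[OF \<sigma>_hom[OF \<sigma>_facts]] by simp
    then show ?thesis using nd by (simp add: form_nondegenerate_def)
  qed
  then have "card (left_perp b W) * card W = card (UNIV :: 'v set)"
    by (rule K.card_left_perp_nondegenerate[OF sesq W(1)])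
  then have cc: "card (left_perp b W) * CARD('k) ^ K.dim W = CARD('k) ^ ?A"
    by (simp add: K.card_V K.card_subspace[OF W(1)])
  have n1: "1 < CARD('k)" by (rule card_pos_field)
  \<comment> \<open>The orders of \<open>W\<close> and its perp give dimension
    \<open>2 * K.dim W\<close> in the first case and one more in the second, so the cases match the
    parity of the dimension.\<close>
  from cases have "(even ?A \<and> type_O_plus sq ?H) \<or> (odd ?A \<and> type_O_minus sq ?H)"
  proof
    assume P: "left_perp b W = W"
    have "CARD('k) ^ (K.dim W + K.dim W) = CARD('k) ^ ?A"
      using cc unfolding P by (simp add: K.card_subspace[OF W(1)] power_add)
    then have "?A = K.dim W + K.dim W" using n1 by simp
    then have "even ?A" by simp
    moreover have "{v \<in> left_perp (polar ?H) W. ?H v = 0} = W"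
      unfolding perpL P using ts by (auto simp: totally_singular_def)
    then have "int CARD('f) * int (card {v \<in> left_perp (polar ?H) W. ?H v = 0})
      = int (card W) * (int CARD('f) ^ (2 * 0) + 1 * (int CARD('f) - 1) * int CARD('f) ^ 0)" by simp
    moreover have "card (left_perp (polar ?H) W) = card W * CARD('f) ^ (2 * 0)" by (simp add: perpL P)
    ultimately show ?thesis
      using F.zero_count_from_perp[OF Q ndH r ts, where \<epsilon>=1 and h=0] by (simp add: F.type_O_plus_iff[OF Q ndH r])
  next
    assume "\<exists>u. u \<notin> W \<and> b u u \<noteq> 0 \<and> left_perp b W = {y + s c u | y c. y \<in> W} \<and>
      (\<forall>y c. y \<in> W \<longrightarrow> b (y + s c u) (y + s c u) = c * \<sigma> c * b u u)"
    then obtain u where u: "u \<notin> W" "b u u \<noteq> 0" and P: "left_perp b W = {y + s c u | y c. y \<in> W}"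
      and val: "\<And>y c. y \<in> W \<Longrightarrow> b (y + s c u) (y + s c u) = c * \<sigma> c * b u u" by blast
    have cP: "card (left_perp b W) = card W * CARD('k)"
      by (rule K.card_line_extension(1)[OF W(1) u(1) P])
    have "CARD('k) ^ (K.dim W + K.dim W + 1) = CARD('k) ^ ?A"
      using cc unfolding cP by (simp add: K.card_subspace[OF W(1)] power_add ac_simps)
    then have "?A = K.dim W + K.dim W + 1" using n1 by (simp only: power_inject_exp)
    then have "odd ?A" by simp
    have cZ: "card {v \<in> left_perp b W. L (b v v) = 0} = card W * card {c. L (c * \<sigma> c * b u u) = 0}"
      using K.card_line_extension(2)[OF W(1) u(1) P, of "\<lambda>v. b v v" "\<lambda>c. c * \<sigma> c * b u u" "\<lambda>x. L x = 0"] val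
      by simp
    have H0: "?H v = 0 \<longleftrightarrow> L (b v v) = 0" for v using two by (simp add: half_form_def)
    have "\<sigma> (b u u) = b u u" using b_commute[of u u] by simp
    from card_trace_norm[OF \<sigma>_facts h odd_q \<sigma>\<alpha> this u(2)]
    have "int CARD('f) * int (card {v \<in> left_perp (polar ?H) W. ?H v = 0})
      = int (card W) * (int CARD('f) ^ (2 * h) + (-1) * (int CARD('f) - 1) * int CARD('f) ^ h)"
      unfolding perpL H0 cZ card_f by (simp add: mult.left_commute left_diff_distrib)
    moreover have "card (left_perp (polar ?H) W) = card W * CARD('f) ^ (2 * h)"
      unfolding perpL using cP by (simp add: card_k card_f h)
    ultimately show ?thesis
      using F.zero_count_from_perp[OF Q ndH r ts, where \<epsilon>="-1" and h=h] \<open>odd ?A\<close>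
      by (simp add: F.type_O_minus_iff[OF Q ndH r] left_diff_distrib)
  qed
  then show "even ?A \<Longrightarrow> type_O_plus sq ?H" "odd ?A \<Longrightarrow> type_O_minus sq ?H" by auto
qed

end

end

section \<open>From the counts to the cases of the theorem\<close>

lemma finite_UNIV_if_dim_pos:
  fixes s :: "'k::{finite,field} \<Rightarrow> 'v::ab_group_add \<Rightarrow> 'v"
  assumes "vector_space s" and pos: "vector_space.dim s (UNIV :: 'v set) > 0"
  shows "finite (UNIV :: 'v set)"
proof -
  interpret vector_space s by fact
  obtain B where B: "independent B" "UNIV \<subseteq> span B" "card B = dim UNIV"
    by (rule basis_exists[of UNIV])
  \<comment> \<open>\<open>card\<close> of an infinite set is 0, so positive dimension forces a
    finite basis.\<close>
  then have "finite B" using pos by (intro card_ge_0_finite) simp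
  then have "finite (span B)"
  proof (induction B)
    case (insert a B)
    have "span (insert a B) \<subseteq> (\<lambda>(k, x). s k a + x) ` (UNIV \<times> span B)"
    proof
      fix x assume "x \<in> span (insert a B)"
      then obtain k where "x - s k a \<in> span B" by (auto simp: span_insert)
      then show "x \<in> (\<lambda>(k, x). s k a + x) ` (UNIV \<times> span B)"
        by (intro image_eqI[of _ _ "(k, x - s k a)"]) auto
    qed
    moreover have "finite ((\<lambda>(k, x). s k a + x) ` (UNIV \<times> span B))" using insert.IH by simp
    ultimately show ?case by (rule finite_subset)
  qed simp
  then show ?thesis using B(2) by (rule finite_subset[rotated])
qed

context trace_lift begin

context
  fixes Q assumes Q: "quadratic_form s Q" and nd: "qf_nondegenerate Q" and pos: "K.dim UNIV > 0"
begin

lemma polar_nondegenerate_odd_q: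
  assumes "odd q" "\<And>v. polar Q v z = 0" shows "z = 0"
proof -
  have "odd CARD('k)" using assms(1) by (simp add: card_k)
  then have "(2::'k) \<noteq> 0" using two_eq_0_iff_even_card by blast
  then show ?thesis using K.polar_nondegenerate_odd_char[OF Q nd] assms(2) by blast
qed

lemma lift_O_plus: "type_O_plus s Q \<Longrightarrow> type_O_plus sq (L \<circ> Q)"
  using type_O_plus_L[OF Q K.polar_nondegenerate[OF Q nd]] pos by (simp add: type_O_plus_def)

lemma lift_O_minus: "type_O_minus s Q \<Longrightarrow> type_O_minus sq (L \<circ> Q)"
  using type_O_minus_L[OF Q K.polar_nondegenerate[OF Q nd]] pos by (simp add: type_O_minus_def)

lemma lift_O: "type_O s Q \<Longrightarrow> odd w \<Longrightarrow> odd q \<Longrightarrow> type_O sq (L \<circ> Q)"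
  by (rule type_O_L[OF Q polar_nondegenerate_odd_q])

lemma degenerate_even_q:
  assumes "type_O s Q" "even q" "w > 1" shows "\<not> qf_nondegenerate (L \<circ> Q)"
proof -
  have "even CARD('k)" using assms(2,3) by (simp add: card_k)
  then show ?thesis
    using degenerate_L_even_char[OF Q] two_eq_0_iff_even_card[where 'a='k] assms(1,3)
    by (simp add: type_O_def)
qed

lemma lift_germ:
  fixes \<gamma> :: 'k
  assumes g: "germ_coeff s Q \<gamma>" and even_w: "even w" and odd_q: "odd q"
    and e: "e \<in> {q + 1, q ^ (w div 2) + 1}"
    and M: "M = subfield_of_order (q ^ (w div 2))" and SqM: "SqM = nonzero_squares M"
  shows "inverse (\<alpha> * \<gamma>) ^ 2 \<in> M - SqM \<or>
      ((\<alpha> * \<gamma>) ^ e \<in> M \<and> \<not> mult_cong SqM ((\<alpha> * \<gamma>) ^ e) (-1)) \<Longrightarrow> type_O_plus sq (L \<circ> Q)"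
    and "inverse (\<alpha> * \<gamma>) ^ 2 \<notin> M - SqM \<Longrightarrow> mult_cong SqM ((\<alpha> * \<gamma>) ^ e) (-1) \<Longrightarrow>
      type_O_minus sq (L \<circ> Q)"
proof -
  define N where "N = (CARD('k) - 1) div 2"
  have "odd CARD('k)" using odd_q by (simp add: card_k)
  then have N: "CARD('k) - 1 = N * 2" by (auto simp: N_def elim!: oddE)
  have w: "w = 2 * (w div 2)" using even_w by simp
  have "\<gamma> \<noteq> 0" by (rule K.germ_coeffE[OF Q g])
  then have \<delta>: "\<alpha> * \<gamma> \<noteq> 0" using \<alpha>_nonzero by simp
  note cond = germ_condition[OF odd_q w refl N M SqM \<delta> e]
    and sq = germ_condition_inverse_square[OF odd_q w refl N M SqM \<delta>]
    and type = type_germ[OF Q polar_nondegenerate_odd_q[OF odd_q] g pos odd_q w refl N]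
  show "type_O_plus sq (L \<circ> Q)"
    if "inverse (\<alpha> * \<gamma>) ^ 2 \<in> M - SqM \<or> ((\<alpha> * \<gamma>) ^ e \<in> M \<and> \<not> mult_cong SqM ((\<alpha> * \<gamma>) ^ e) (-1))"
  proof (rule type(1))
    from that show "(\<alpha> * \<gamma>) ^ N = (-1) ^ ((q ^ (w div 2) + 1) div 2)"
    proof
      assume "inverse (\<alpha> * \<gamma>) ^ 2 \<in> M - SqM"
      then show ?thesis by (rule sq)
    next
      assume "(\<alpha> * \<gamma>) ^ e \<in> M \<and> \<not> mult_cong SqM ((\<alpha> * \<gamma>) ^ e) (-1)"
      then show ?thesis by (rule cond[THEN conjunct1, THEN mp])
    qed
  qed
  show "type_O_minus sq (L \<circ> Q)"
    if "inverse (\<alpha> * \<gamma>) ^ 2 \<notin> M - SqM" "mult_cong SqM ((\<alpha> * \<gamma>) ^ e) (-1)"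
    using that by (intro type(2) cond[THEN conjunct2, THEN mp] conjI)
qed

end

lemma symmetric_half_form:
  assumes "symmetric_form s b" "form_nondegenerate b" "odd q"
  shows "quadratic_form s (half_form b)" "qf_nondegenerate (half_form b)"
proof -
  have "odd CARD('k)" using assms(3) by (simp add: card_k)
  then have two: "(2::'k) \<noteq> 0" using two_eq_0_iff_even_card by blast
  show Q: "quadratic_form s (half_form b)" by (rule K.half_form_quadratic(1)[OF assms(1) two])
  have "z = 0" if "\<And>v. polar (half_form b) v z = 0" for z
    using that assms(1,2) K.half_form_quadratic(2)[OF assms(1) two]
    by (auto simp: form_nondegenerate_def symmetric_form_def)
  then show "qf_nondegenerate (half_form b)" by (rule K.qf_nondegenerate_if_polar[OF Q])
qed

lemma alternating_L:
  assumes "alternating_form s b" shows "alternating_form sq (\<lambda>u v. L (b u v))"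
  using assms sesquilinear_L[of id b id] by (simp add: alternating_form_def F.field_auto_id)

text \<open>If \<open>b x x\<close> is not 0, the values \<open>c\<^sup>2 * b x x\<close> fill the
  large field, since squaring is onto in even order; one of them lies outside the kernel of
  \<open>L\<close>.\<close>

lemma pseudo_symplectic_L:
  assumes b: "pseudo_symplectic_form s b" and even_q: "even q"
  shows "pseudo_symplectic_form sq (\<lambda>u v. L (b u v))"
proof -
  have sym: "symmetric_form s b" and nd: "form_nondegenerate b" and na: "\<not> alternating_form s b"
    and two: "(2::'k) = 0" using b by (auto simp: pseudo_symplectic_form_def)
  have sesq: "sesquilinear_form s id b" using sym by (simp add: symmetric_form_def)
  obtain x where x: "b x x \<noteq> 0" using na sesq by (auto simp: alternating_form_def)
  have "\<not> alternating_form sq (\<lambda>u v. L (b u v))"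
  proof
    assume alt: "alternating_form sq (\<lambda>u v. L (b u v))"
    obtain y where y: "L y \<noteq> 0" using L_nonzero by blast
    have "even CARD('k)" using two two_eq_0_iff_even_card by blast
    then obtain h where h: "CARD('k) = 2 * h" by (elim evenE)
    let ?z = "y / b x x"
    have "(?z ^ h) * (?z ^ h) = ?z ^ CARD('k)" by (simp add: h mult_2 power_add)
    then have sqr: "(?z ^ h) * (?z ^ h) = ?z" by (simp only: finite_field_power_card)
    have "b (s (?z ^ h) x) (s (?z ^ h) x) = (?z ^ h) * (?z ^ h) * b x x"
      by (simp only: K.sesq_simps(3,4)[OF sesq] id_apply mult.assoc)
    also have "\<dots> = y" unfolding sqr using x by simp
    finally have "L (b (s (?z ^ h) x) (s (?z ^ h) x)) \<noteq> 0" using y by simp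
    then show False using alt by (simp add: alternating_form_def)
  qed
  moreover have "(2::'f) = 0" using even_q two_eq_0_iff_even_card[where 'a='f] card_f by simp
  ultimately show ?thesis
    using symmetric_L[OF sym] form_nondegenerate_L[OF sesq nd] by (simp add: pseudo_symplectic_form_def)
qed

text \<open>In characteristic 2 the conditions \<open>\<sigma> \<alpha> = \<alpha>\<close> and
  \<open>\<sigma> \<alpha> = - \<alpha>\<close> coincide.\<close>

lemma alternating_hermitian_even_q:
  assumes "hermitian_form s \<sigma> b" "form_nondegenerate b" "K.dim UNIV > 0"
    and "even w" "even q" "\<sigma> \<alpha> = \<alpha>"
  shows "alternating_form sq (\<lambda>u v. L (b u v))"
proof -
  have "even CARD('k)" using assms(5) w_pos by (simp add: card_k)
  then have "(2::'k) = 0" using two_eq_0_iff_even_card by blast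
  then have "\<alpha> + \<alpha> = 0" by (simp flip: mult_2)
  then have "\<sigma> \<alpha> = - \<alpha>" using assms(6) by (simp add: eq_neg_iff_add_eq_0)
  then show ?thesis using alternating_Lb[OF assms(1-3)] assms(4) by blast
qed

context
  fixes b
  assumes sym: "symmetric_form s b" and nd: "form_nondegenerate b" and odd_q: "odd q"
    and pos: "K.dim UNIV > 0"
begin

lemmas lift_half_form_O_plus =
    lift_O_plus[OF symmetric_half_form[OF sym nd odd_q] pos, folded half_form_L]
  and lift_half_form_O_minus =
    lift_O_minus[OF symmetric_half_form[OF sym nd odd_q] pos, folded half_form_L]
  and lift_half_form_O =
    lift_O[OF symmetric_half_form[OF sym nd odd_q] pos, folded half_form_L]
  and lift_half_form_germ =
    lift_germ[OF symmetric_half_form[OF sym nd odd_q] pos _ _ odd_q, folded half_form_L]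

end

end

text \<open>The exponent \<open>q ^ (w div 2) + 1\<close> gives the norm of
  \<open>\<alpha> * \<gamma>\<close> to GF(q^(w/2)), and \<open>q + 1\<close> agrees with it only
  for w = 2; the criterion is established for either value of \<open>e\<close>. Degeneracy in even
  characteristic asks for \<open>w > 1\<close> because for w = 1 the map \<open>L\<close> is
  bijective and nondegeneracy persists.\<close>

theorem theoremC:
  fixes q w A :: nat
    and \<iota> :: "'f::{finite,field} \<Rightarrow> 'k::{finite,field}"
    and s :: "'k \<Rightarrow> 'v::ab_group_add \<Rightarrow> 'v"
    and sq :: "'f \<Rightarrow> 'v \<Rightarrow> 'v"
    and \<alpha> :: 'k
    and L :: "'k \<Rightarrow> 'f"
    and M SqM :: "'k set"
  assumes "CARD('f) = q" and "CARD('k) = q ^ w" and "field_hom \<iota>"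
    and "w \<ge> 1" and "A \<ge> 1"
    and "vector_space s" and "vector_space.dim s (UNIV :: 'v set) = A"
    and "sq = restrict_scalars \<iota> s"
    and "\<alpha> \<noteq> 0" and "L = trace_map \<iota> w \<alpha>"
    and "M = subfield_of_order (q ^ (w div 2))" and "SqM = nonzero_squares M"
  shows
    "vector_space sq \<and> vector_space.dim sq (UNIV :: 'v set) = A * w \<and>
     (\<forall>Q. quadratic_form s Q \<and> qf_nondegenerate Q \<longrightarrow>
        (let LQ = L \<circ> Q;
             embedding = is_subgroup_of (qf_isometry_group s Q) (qf_isometry_group sq LQ) in
        (type_O_plus s Q \<longrightarrow> type_O_plus sq LQ \<and> embedding) \<and>
        (type_O_minus s Q \<longrightarrow> type_O_minus sq LQ \<and> embedding) \<and>
        (type_O s Q \<and> even q \<and> w > 1 \<longrightarrow> \<not> qf_nondegenerate LQ) \<and>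
        (type_O s Q \<and> odd w \<and> odd q \<longrightarrow> type_O sq LQ \<and> embedding) \<and>
        (\<forall>\<gamma>. \<forall>e\<in>{q + 1, q ^ (w div 2) + 1}.
           germ_coeff s Q \<gamma> \<and> type_O s Q \<and> even w \<and> odd q \<longrightarrow>
           (inverse (\<alpha> * \<gamma>) ^ 2 \<in> M - SqM \<or>
              ((\<alpha> * \<gamma>) ^ e \<in> M \<and> \<not> mult_cong SqM ((\<alpha> * \<gamma>) ^ e) (-1))
              \<longrightarrow> type_O_plus sq LQ \<and> embedding) \<and>
           (inverse (\<alpha> * \<gamma>) ^ 2 \<notin> M - SqM \<and> mult_cong SqM ((\<alpha> * \<gamma>) ^ e) (-1)
              \<longrightarrow> type_O_minus sq LQ \<and> embedding)))) \<and>
     (\<forall>\<sigma> \<beta>. sesquilinear_form s \<sigma> \<beta> \<and> form_nondegenerate \<beta> \<and> reflexive_form \<beta> \<and>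
        (alternating_form s \<beta> \<or> symmetric_form s \<beta> \<or> hermitian_form s \<sigma> \<beta>) \<longrightarrow>
        (let L\<beta> = (\<lambda>u v. L (\<beta> u v)); \<sigma>q = restrict_auto \<iota> \<sigma>;
             Q = half_form \<beta>; LQ = half_form L\<beta>;
             symmetric_nondeg = (symmetric_form sq L\<beta> \<and> form_nondegenerate L\<beta>);
             embedding = is_subgroup_of (form_isometry_group s \<beta>) (form_isometry_group sq L\<beta>) in
        (odd q \<and> symmetric_form s \<beta> \<longrightarrow>
          (type_O_plus s Q \<longrightarrow> symmetric_nondeg \<and> type_O_plus sq LQ \<and> embedding) \<and>
          (type_O_minus s Q \<longrightarrow> symmetric_nondeg \<and> type_O_minus sq LQ \<and> embedding) \<and>
          (type_O s Q \<and> odd w \<longrightarrow> symmetric_nondeg \<and> type_O sq LQ \<and> embedding) \<and>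
          (\<forall>\<gamma>. \<forall>e\<in>{q + 1, q ^ (w div 2) + 1}.
             germ_coeff s Q \<gamma> \<and> type_O s Q \<and> even w \<longrightarrow>
             (inverse (\<alpha> * \<gamma>) ^ 2 \<in> M - SqM \<or>
                ((\<alpha> * \<gamma>) ^ e \<in> M \<and> \<not> mult_cong SqM ((\<alpha> * \<gamma>) ^ e) (-1))
                \<longrightarrow> symmetric_nondeg \<and> type_O_plus sq LQ \<and> embedding) \<and>
             (inverse (\<alpha> * \<gamma>) ^ 2 \<notin> M - SqM \<and> mult_cong SqM ((\<alpha> * \<gamma>) ^ e) (-1)
                \<longrightarrow> symmetric_nondeg \<and> type_O_minus sq LQ \<and> embedding))) \<and>
        (\<not> (odd q \<and> symmetric_form s \<beta>) \<longrightarrow>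
          (hermitian_form s \<sigma> \<beta> \<and> odd w \<and> \<sigma> \<alpha> = \<alpha> \<longrightarrow>
             hermitian_form sq \<sigma>q L\<beta> \<and> form_nondegenerate L\<beta> \<and> embedding) \<and>
          (hermitian_form s \<sigma> \<beta> \<and> odd w \<and> \<sigma> \<alpha> \<noteq> \<alpha> \<longrightarrow> atypical_form sq \<sigma>q L\<beta>) \<and>
          (hermitian_form s \<sigma> \<beta> \<and> even w \<and> even q \<and> \<sigma> \<alpha> = \<alpha> \<longrightarrow>
             alternating_form sq L\<beta> \<and> form_nondegenerate L\<beta> \<and> embedding) \<and>
          (hermitian_form s \<sigma> \<beta> \<and> even w \<and> odd q \<and> \<sigma> \<alpha> = - \<alpha> \<longrightarrow>
             alternating_form sq L\<beta> \<and> form_nondegenerate L\<beta> \<and> embedding) \<and>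
          (hermitian_form s \<sigma> \<beta> \<and> even w \<and> \<sigma> \<alpha> \<noteq> \<alpha> \<and> \<sigma> \<alpha> \<noteq> - \<alpha> \<longrightarrow>
             atypical_form sq \<sigma>q L\<beta>) \<and>
          (hermitian_form s \<sigma> \<beta> \<and> even w \<and> odd q \<and> even A \<and> \<sigma> \<alpha> = \<alpha> \<longrightarrow>
             symmetric_nondeg \<and> type_O_plus sq LQ \<and> embedding) \<and>
          (hermitian_form s \<sigma> \<beta> \<and> even w \<and> odd q \<and> odd A \<and> \<sigma> \<alpha> = \<alpha> \<longrightarrow>
             symmetric_nondeg \<and> type_O_minus sq LQ \<and> embedding) \<and>
          (alternating_form s \<beta> \<longrightarrow>
             alternating_form sq L\<beta> \<and> form_nondegenerate L\<beta> \<and> embedding) \<and>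
          (even q \<and> pseudo_symplectic_form s \<beta> \<longrightarrow> pseudo_symplectic_form sq L\<beta>))))"
proof -
  have pos: "vector_space.dim s (UNIV :: 'v set) > 0" using assms(5,7) by simp
  interpret trace_lift \<iota> q w \<alpha> s
    using assms finite_UNIV_if_dim_pos[OF assms(6) pos]
    by (intro trace_lift.intro traced_extension.intro finite_vector_space.intro
        finite_vector_space_axioms.intro) auto
  note quadratic = qf_embedding lift_O_plus[OF _ _ pos] lift_O_minus[OF _ _ pos] lift_O[OF _ _ pos]
    degenerate_even_q[OF _ _ pos] lift_germ[OF _ _ pos _ _ _ _ assms(11,12)]
  note symmetric = symmetric_L form_nondegenerate_L lift_half_form_O_plus[OF _ _ _ pos]
    lift_half_form_O_minus[OF _ _ _ pos] lift_half_form_O[OF _ _ _ pos] lift_half_form_germ[OF _ _ _ pos _ _ _ assms(11,12)]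
  note hermitian = hermitian_Lb[OF _ _ pos] atypical_Lb_odd[OF _ _ pos] atypical_Lb_even[OF _ _ pos]
    alternating_Lb[OF _ _ pos] alternating_hermitian_even_q[OF _ _ pos] symmetric_Lb[OF _ _ pos]
    type_Lb[OF _ _ pos, unfolded assms(7)]
  show ?thesis
    unfolding Let_def assms(8,10)
    by (intro conjI allI ballI impI; (elim conjE)?)
      (rule F.vector_space_axioms dim_sq[unfolded assms(7)] quadratic form_embedding symmetric hermitian
        alternating_L pseudo_symplectic_L; assumption)+
qed

end
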